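(* Let $\mathcal O=2\mathbb Z+1$ and $\mathcal O/\mathcal O=\{u/v:u,v\in\mathcal O\}$. Let $\beta\ge1$, $N=2^\beta m$ and $$D=\{0,a,2^\tau\ell_1,a+2^\tau\ell_2\},$$ where $m,a,\ell_1,\ell_2\in\mathcal O$, and $\tau=\beta k+r$ for some integers $k\ge0$ and $0<r<\beta$. Assume that $\mu=\mu_{N,D}$ is a singular spectral self-similar measure and that $N>4$. Then $$E_2(\mu):=\{t\in\mathbb R\setminus\{0\}:V(\mu,\{1,t\})\neq\emptyset\}=\mathcal O/\mathcal O.$$ More generally, for every $S\subset\mathbb R\setminus\{0\}$, $$V(\mu,S)\neq\emptyset\quad\Longleftrightarrow\quad S\subset T^{-1}\mathcal O\ \text{ for some }T\in\mathcal O.$$ Whenever this condition on $S$ holds, for each $0\le s\le\log4/\log N$ the set $$\{\Lambda\in V(\mu,S):\dim_{Be}(\Lambda)=s\}$$ has the cardinality of the continuum.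
   Context: A Borel probability measure $\mu$ on $\mathbb R$ is spectral if there is a countable set $\Lambda\subset\mathbb R$ such that $\{e^{2\pi i\lambda x}:\lambda\in\Lambda\}$ is an orthogonal basis of $L^2(\mu)$; such a $\Lambda$ is called a spectrum of $\mu$. For $A\subset\mathbb R$, $$V(\mu,A)=\{\Lambda:\ \Lambda\text{ is a spectrum of }\mu\text{ and }a\Lambda\text{ is a spectrum of }\mu\text{ for all }a\in A\},$$ where spectra are considered up to translation (i.e. $\Lambda$ and $\Lambda+x$, $x\in\mathbb R$, are identified). For an integer $N\ge2$ and a finite $D\subset\mathbb Z$, $\mu_{N,D}$ is the unique Borel probability measure with $\mu(E)=\frac1{\#D}\sum_{d\in D}\mu(\phi_d^{-1}(E))$ for all Borel $E$, where $\phi_d(x)=\frac1N(x+d)$. Singular means singular with respect to Lebesgue measure. For a countable $\Lambda\subset\mathbb R$, $$\dim_{Be}(\Lambda)=\limsup_{h\to\infty}\sup_{x\in\mathbb R}\frac{\log\#\left(\Lambda\cap(x-\frac h2,x+\frac h2)\right)}{\log h}.$$ *)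

theory Defs
  imports "HOL-Probability.Probability"
begin

text \<open>Elements of $L^2(\mu)$ are represented by functions; equality in $L^2(\mu)$ is
  equality almost everywhere.\<close>

definition L2 :: "real measure \<Rightarrow> (real \<Rightarrow> complex) set" where
  "L2 \<mu> = {f \<in> borel_measurable \<mu>. integrable \<mu> (\<lambda>x. (cmod (f x))\<^sup>2)}"

definition L2_norm :: "real measure \<Rightarrow> (real \<Rightarrow> complex) \<Rightarrow> real" where
  "L2_norm \<mu> f = sqrt (\<integral>x. (cmod (f x))\<^sup>2 \<partial>\<mu>)"

definition L2_inner :: "real measure \<Rightarrow> (real \<Rightarrow> complex) \<Rightarrow> (real \<Rightarrow> complex) \<Rightarrow> complex" where
  "L2_inner \<mu> f g = (\<integral>x. f x * cnj (g x) \<partial>\<mu>)"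

text \<open>Pairwise orthogonal nonzero elements whose finite linear combinations are dense
  in $L^2(\mu)$.\<close>

definition L2_orthogonal_basis :: "real measure \<Rightarrow> (real \<Rightarrow> complex) set \<Rightarrow> bool" where
  "L2_orthogonal_basis \<mu> B \<longleftrightarrow>
     B \<subseteq> L2 \<mu> \<and>
     (\<forall>b\<in>B. L2_norm \<mu> b \<noteq> 0) \<and>
     (\<forall>b\<in>B. \<forall>b'\<in>B. b \<noteq> b' \<longrightarrow> L2_inner \<mu> b b' = 0) \<and>
     (\<forall>f\<in>L2 \<mu>. \<forall>\<epsilon>>0. \<exists>F c. finite F \<and> F \<subseteq> B \<and>
        L2_norm \<mu> (\<lambda>x. f x - (\<Sum>b\<in>F. c b * b x)) < \<epsilon>)"

definition expo :: "real \<Rightarrow> real \<Rightarrow> complex" where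
  "expo l x = exp (2 * of_real pi * \<i> * of_real l * of_real x)"

definition is_spectrum :: "real measure \<Rightarrow> real set \<Rightarrow> bool" where
  "is_spectrum \<mu> \<Lambda> \<longleftrightarrow> countable \<Lambda> \<and> L2_orthogonal_basis \<mu> (expo ` \<Lambda>)"

definition spectral_measure :: "real measure \<Rightarrow> bool" where
  "spectral_measure \<mu> \<longleftrightarrow> real_distribution \<mu> \<and> (\<exists>\<Lambda>. is_spectrum \<mu> \<Lambda>)"

definition translate_rel :: "(real set \<times> real set) set" where
  "translate_rel = {(\<Lambda>, \<Lambda>'). \<exists>x. \<Lambda>' = (\<lambda>l. l + x) ` \<Lambda>}"

text \<open>Spectra are considered up to translation, so the elements of \<open>V \<mu> A\<close> are translation
  classes of spectra. The lemma \<open>is_spectrum_translate\<close> below shows that every member of such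
  a class again has the defining property.\<close>

definition V :: "real measure \<Rightarrow> real set \<Rightarrow> real set set set" where
  "V \<mu> A = {\<Lambda>. is_spectrum \<mu> \<Lambda> \<and> (\<forall>a\<in>A. is_spectrum \<mu> ((\<lambda>l. a * l) ` \<Lambda>))} // translate_rel"

text \<open>\<open>\<mu> = \<mu>\<^sub>N\<^sub>,\<^sub>D\<close>, with $\phi_d(x) = (x + d)/N$. The equation determines the Borel
  probability measure \<open>\<mu>\<close> uniquely.\<close>

definition self_similar_measure :: "int \<Rightarrow> int set \<Rightarrow> real measure \<Rightarrow> bool" where
  "self_similar_measure N D \<mu> \<longleftrightarrow>
     real_distribution \<mu> \<and>
     (\<forall>E\<in>sets borel. measure \<mu> E =
        1 / real (card D) *
          (\<Sum>d\<in>D. measure \<mu> ((\<lambda>x. (x + real_of_int d) / real_of_int N) -` E)))"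

definition lebesgue_singular :: "real measure \<Rightarrow> bool" where
  "lebesgue_singular \<mu> \<longleftrightarrow>
     (\<exists>E\<in>sets borel. emeasure lborel E = 0 \<and> emeasure \<mu> (- E) = 0)"

text \<open>$\log \# A$ with $\log 0 = -\infty$ and $\log \infty = \infty$ (the library has
  \<open>ln 0 = 0\<close>, and \<open>card\<close> is \<open>0\<close> on infinite sets).\<close>

definition log_card :: "real set \<Rightarrow> ereal" where
  "log_card A = (if infinite A then \<infinity> else if A = {} then - \<infinity> else ereal (ln (real (card A))))"

definition beurling_dim :: "real set \<Rightarrow> ereal" where
  "beurling_dim \<Lambda> =
     Limsup at_top (\<lambda>h::real. SUP x::real. log_card (\<Lambda> \<inter> {x - h/2 <..< x + h/2}) / ereal (ln h))"

definition odd_reals :: "real set" ("\<O>") where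
  "\<O> = real_of_int ` {n. odd n}"

definition odd_ratios :: "real set" where
  "odd_ratios = {u / v | u v. u \<in> \<O> \<and> v \<in> \<O>}"

definition E2 :: "real measure \<Rightarrow> real set" where
  "E2 \<mu> = {t. t \<noteq> 0 \<and> V \<mu> {1, t} \<noteq> {}}"

subsection \<open>Compatibility with translations\<close>

lemma equiv_translate_rel: "equiv UNIV translate_rel"
proof (rule equivI)
  show "refl translate_rel"
    by (auto simp: refl_on_def translate_rel_def intro!: exI[of _ 0])
  show "sym translate_rel"
  proof (rule symI)
    fix A B assume "(A, B) \<in> translate_rel"
    then obtain x where "B = (\<lambda>l. l + x) ` A" by (auto simp: translate_rel_def)
    then have "A = (\<lambda>l. l + (- x)) ` B" by (simp add: image_image)
    then show "(B, A) \<in> translate_rel" unfolding translate_rel_def by blast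
  qed
  show "trans translate_rel"
  proof (rule transI)
    fix A B C assume "(A, B) \<in> translate_rel" "(B, C) \<in> translate_rel"
    then obtain x y where "B = (\<lambda>l. l + x) ` A" "C = (\<lambda>l. l + y) ` B"
      by (auto simp: translate_rel_def)
    then have "C = (\<lambda>l. l + (x + y)) ` A" by (simp add: image_image add.assoc)
    then show "(A, C) \<in> translate_rel" unfolding translate_rel_def by blast
  qed
qed simp

lemma beurling_dim_translate: "beurling_dim ((\<lambda>l. l + y) ` \<Lambda>) = beurling_dim \<Lambda>"
proof -
  have lc: "log_card ((\<lambda>l. l + y) ` A) = log_card A" for A
    by (simp add: log_card_def card_image finite_image_iff)
  have int: "(\<lambda>l. l + y) ` \<Lambda> \<inter> {x - h/2 <..< x + h/2} =
      (\<lambda>l. l + y) ` (\<Lambda> \<inter> {(x - y) - h/2 <..< (x - y) + h/2})" for x h :: real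
    by auto
  have "(SUP x::real. log_card ((\<lambda>l. l + y) ` \<Lambda> \<inter> {x - h/2 <..< x + h/2}) / ereal (ln h)) =
      (SUP x::real. log_card (\<Lambda> \<inter> {x - h/2 <..< x + h/2}) / ereal (ln h))" for h :: real
  proof -
    let ?g = "\<lambda>x. log_card (\<Lambda> \<inter> {x - h/2 <..< x + h/2}) / ereal (ln h)"
    have "range (\<lambda>x. ?g (x - y)) = range ?g"
    proof -
      have "?g x \<in> range (\<lambda>x. ?g (x - y))" for x
        by (rule range_eqI[of _ _ "x + y"]) simp
      then show ?thesis by blast
    qed
    then show ?thesis unfolding int lc by simp
  qed
  then show ?thesis by (simp add: beurling_dim_def)
qed

lemma L2_orthogonal_basis_mult:
  assumes u: "u \<in> borel_measurable \<mu>" "\<And>x. cmod (u x) = 1"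
    and B: "L2_orthogonal_basis \<mu> B"
  shows "L2_orthogonal_basis \<mu> ((\<lambda>b x. u x * b x) ` B)"
proof -
  let ?m = "\<lambda>(b :: real \<Rightarrow> complex) x. u x * b x"
  have un: "u x * cnj (u x) = 1" for x
    using u(2)[of x] by (simp add: complex_norm_square[symmetric])
  have cun: "cnj (u x) * u x = 1" for x
    using un[of x] by (simp add: mult.commute)
  have norm: "L2_norm \<mu> (?m f) = L2_norm \<mu> f" for f
    by (simp add: L2_norm_def norm_mult u)
  have cm: "(\<lambda>x. cnj (u x) * f x) \<in> L2 \<mu>" if "f \<in> L2 \<mu>" for f
  proof -
    have "cnj \<in> borel_measurable borel"
      by (intro borel_measurable_continuous_onI continuous_intros)
    from measurable_compose[OF u(1) this] show ?thesis
      using that u by (auto simp: L2_def norm_mult)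
  qed
  have inj: "inj ?m"
  proof (rule injI)
    fix f g assume "?m f = ?m g"
    then have "u x * f x = u x * g x" for x by metis
    moreover have "u x \<noteq> 0" for x using u(2)[of x] by auto
    ultimately show "f = g" by auto
  qed
  have 1: "?m ` B \<subseteq> L2 \<mu>"
    using B u by (auto simp: L2_orthogonal_basis_def L2_def norm_mult)
  have 2: "\<forall>b\<in>?m ` B. L2_norm \<mu> b \<noteq> 0"
    using B norm by (auto simp: L2_orthogonal_basis_def)
  have inner: "L2_inner \<mu> (?m f) (?m g) = L2_inner \<mu> f g" for f g
  proof -
    have "u x * f x * cnj (u x * g x) = (u x * cnj (u x)) * (f x * cnj (g x))" for x
      by (simp add: mult_ac)
    then show ?thesis by (simp only: L2_inner_def un mult_1)
  qed
  have 3: "\<forall>b\<in>?m ` B. \<forall>b'\<in>?m ` B. b \<noteq> b' \<longrightarrow> L2_inner \<mu> b b' = 0"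
    using B by (auto simp: L2_orthogonal_basis_def inner)
  have 4: "\<exists>F c. finite F \<and> F \<subseteq> ?m ` B \<and>
        L2_norm \<mu> (\<lambda>x. f x - (\<Sum>b\<in>F. c b * b x)) < \<epsilon>"
    if f: "f \<in> L2 \<mu>" and e: "\<epsilon> > 0" for f and \<epsilon> :: real
  proof -
    obtain F c where F: "finite F" "F \<subseteq> B"
      and c: "L2_norm \<mu> (\<lambda>x. cnj (u x) * f x - (\<Sum>b\<in>F. c b * b x)) < \<epsilon>"
    proof -
      have "\<exists>F c. finite F \<and> F \<subseteq> B \<and>
          L2_norm \<mu> (\<lambda>x. cnj (u x) * f x - (\<Sum>b\<in>F. c b * b x)) < \<epsilon>"
        using B cm[OF f] e by (simp add: L2_orthogonal_basis_def)
      then show ?thesis using that by blast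
    qed
    define c' where "c' = c \<circ> the_inv_into UNIV ?m"
    have c': "c' (?m b) = c b" for b
      by (simp add: c'_def the_inv_into_f_f[OF inj])
    have "f x - (\<Sum>b\<in>?m ` F. c' b * b x) = u x * (cnj (u x) * f x - (\<Sum>b\<in>F. c b * b x))" for x
    proof -
      have "(\<Sum>b\<in>?m ` F. c' b * b x) = (\<Sum>b\<in>F. c' (?m b) * (u x * b x))"
        by (subst sum.reindex) (auto intro: inj_on_subset[OF inj])
      also have "\<dots> = u x * (\<Sum>b\<in>F. c b * b x)"
        by (simp add: c' sum_distrib_left mult.left_commute)
      finally show ?thesis
        by (simp only: right_diff_distrib mult.assoc[symmetric] un mult_1)
    qed
    then have "L2_norm \<mu> (\<lambda>x. f x - (\<Sum>b\<in>?m ` F. c' b * b x)) < \<epsilon>"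
      using c norm[of "\<lambda>x. cnj (u x) * f x - (\<Sum>b\<in>F. c b * b x)"] by simp
    with F show ?thesis by (intro exI[of _ "?m ` F"] exI[of _ c']) auto
  qed
  show ?thesis
    unfolding L2_orthogonal_basis_def
    by (intro conjI ballI allI impI 1 2 3 4) (use 2 3 in simp_all)
qed

lemma is_spectrum_translate:
  assumes \<mu>: "real_distribution \<mu>" and \<Lambda>: "is_spectrum \<mu> \<Lambda>"
  shows "is_spectrum \<mu> ((\<lambda>l. l + y) ` \<Lambda>)"
proof -
  interpret real_distribution \<mu> by fact
  have "expo y \<in> borel_measurable borel"
    unfolding expo_def by (intro borel_measurable_continuous_onI continuous_intros)
  then have "expo y \<in> borel_measurable \<mu>"
    using measurable_cong_sets[OF events_eq_borel refl] by blast
  moreover have "cmod (expo y x) = 1" for x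
    by (simp add: expo_def norm_exp_eq_Re)
  moreover have "expo (l + y) = (\<lambda>x. expo y x * expo l x)" for l
    by (rule ext) (simp add: expo_def ring_distribs exp_add)
  ultimately show ?thesis
    using L2_orthogonal_basis_mult[of "expo y" \<mu> "expo ` \<Lambda>"] \<Lambda>
    by (auto simp: is_spectrum_def image_image)
qed

end

theory Submission
  imports Defs "HOL-Real_Asymp.Real_Asymp" "HOL-Number_Theory.Cong"
begin

text \<open>
  The transform of \<open>\<mu>\<close> is \<open>ft \<xi> = (\<Prod>j. mask (\<xi> / N ^ j))\<close>. Sorted by 2-adic valuation, its zeros
  suggest the model spectrum of all \<open>\<Sum>j. N ^ j * (\<epsilon>\<^sub>j * m ^ k / 2 + \<delta>\<^sub>j / 2 ^ (\<tau> + 1))\<close> with bits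
  \<open>\<epsilon>\<^sub>j, \<delta>\<^sub>j\<close>, whose differences remain zeros after multiplication by any odd integer. The \<open>\<epsilon>\<close>-bits and
  the \<open>\<delta>\<close>-bits are out of step by \<open>k\<close> levels, so the finite approximation of \<open>ft\<close> at level \<open>T\<close> is
  \<open>\<Prod>j\<le>T. mask (\<xi> / N ^ j)\<close> times \<open>k\<close> further factors \<open>half_mask\<close>: its squared modulus sums to \<open>1\<close>
  over the finite model set. Completeness follows once \<open>ft\<close> dominates this approximation up to a constant.
  That is arranged by adding to the model points multiples of \<open>N ^ T * m ^ k\<close> which move them away from the
  zeros of \<open>ft (p * _)\<close>, where \<open>p\<close> runs through the odd integers, each infinitely often. The points with
  digits in a set of density \<open>\<alpha>\<close> are left alone and produce the Beurling dimension, all others are pushed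
  out to a lacunary set of dimension \<open>0\<close>, with one free binary choice per stage.

  Conversely, every spectrum \<open>\<Lambda>\<close> contains a difference of the smallest possible 2-adic valuation.
  Otherwise \<open>\<Lambda> / N\<close> is the union of two orthogonal sets, so that \<open>(\<Sum>l\<in>\<Lambda>. \<bar>ft (l / N)\<bar>\<^sup>2) \<le> 2\<close>,
  whereas this sum is the same for all spectra and exceeds \<open>2\<close> already for a suitable orthogonal set.
  Comparing \<open>\<Lambda>\<close> with \<open>s * \<Lambda>\<close> shows that \<open>s\<close> is a quotient of odd integers.
\<close>

section \<open>Exponentials in $L^2(\mu)$\<close>

text \<open>What no shift can repair shapes the proof. For j \<le> k, adding
  \<open>p * m ^ k * z\<close> to y changes \<open>2 ^ (\<tau> + 1) * y / N ^ j\<close> by an even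
  integer, because \<open>2 ^ \<tau> * m ^ k\<close> is an even multiple of \<open>N ^ j\<close>. So
  a zero of the second kind (2-adic valuation governed by \<tau>) on one of the first k levels
  survives every admissible shift, and \<open>ft\<close> has no positive lower bound there. The
  factors \<open>half_mask\<close> vanish at the same points, whereas \<open>mask\<close> has simple
  zeros there; hence a bound relative to \<open>half_mask\<close> holds, and this is enough since
  the finite approximations contain exactly these factors. All other zeros lie in \<int> / G. There
  a shift is found by choosing a 2-adic valuation outside both families of zeros if m = 1, and
  otherwise by making the odd part indivisible by a power of m. This is where N > 4 enters: for N =
  4 one has m = 1, \<beta> = 2, r = 1, and the two families would occupy the odd and the even
  valuations.\<close>

definition ee :: "real \<Rightarrow> complex" where
  "ee t = cis (2 * pi * t)"

lemma ee_add: "ee (s + t) = ee s * ee t"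
  by (simp add: ee_def cis_mult ring_distribs)

lemma ee_minus: "ee (- t) = cnj (ee t)"
  by (simp add: ee_def cis_cnj)

lemma ee_0 [simp]: "ee 0 = 1"
  by (simp add: ee_def)

lemma norm_ee [simp]: "cmod (ee t) = 1"
  by (simp add: ee_def)

lemma ee_nonzero [simp]: "ee t \<noteq> 0"
  using norm_ee[of t] by (metis norm_zero zero_neq_one)

lemma ee_mult_cnj: "ee s * cnj (ee t) = ee (s - t)"
  using ee_add[of s "- t"] by (simp add: ee_minus)

lemma ee_eq_1_iff: "ee t = 1 \<longleftrightarrow> t \<in> \<int>"
proof -
  have "ee t = 1 \<longleftrightarrow> cos (2 * pi * t) = 1"
    by (auto simp: ee_def complex_eq_iff cos_one_sin_zero)
  also have "\<dots> \<longleftrightarrow> (\<exists>n::int. 2 * pi * t = of_int n * 2 * pi)"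
    by (simp add: cos_one_2pi_int)
  also have "\<dots> \<longleftrightarrow> (\<exists>n::int. t = of_int n)"
    by (simp add: field_simps)
  finally show ?thesis by (auto simp: Ints_def)
qed

lemma ee_of_int [simp]: "ee (of_int n) = 1"
  by (simp add: ee_eq_1_iff)

lemma ee_Ints: "t \<in> \<int> \<Longrightarrow> ee t = 1"
  by (simp add: ee_eq_1_iff)

lemma ee_half: "ee (1 / 2) = -1"
  by (simp add: ee_def)

lemma ee_eq_minus_1_iff: "ee t = - 1 \<longleftrightarrow> (\<exists>n. odd n \<and> 2 * t = of_int n)"
proof -
  have "ee t = - 1 \<longleftrightarrow> ee (t + 1 / 2) = 1"
    by (simp add: ee_add ee_half) (metis minus_minus)
  also have "\<dots> \<longleftrightarrow> (\<exists>n::int. t + 1 / 2 = of_int n)"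
    by (auto simp: ee_eq_1_iff Ints_def)
  also have "\<dots> \<longleftrightarrow> (\<exists>n. odd n \<and> 2 * t = of_int n)"
  proof safe
    fix n :: int assume "t + 1 / 2 = of_int n"
    then show "\<exists>n. odd n \<and> 2 * t = of_int n"
      by (intro exI[of _ "2 * n - 1"]) auto
  next
    fix n :: int assume n: "odd n" "2 * t = of_int n"
    then obtain q where "n = 2 * q + 1" by (auto elim: oddE)
    with n show "\<exists>n::int. t + 1 / 2 = of_int n"
      by (intro exI[of _ "q + 1"]) auto
  qed
  finally show ?thesis .
qed

lemma expo_ee: "expo l x = ee (l * x)"
  by (simp add: expo_def ee_def cis_conv_exp mult_ac)

lemma continuous_on_ee [continuous_intros]:
  "continuous_on A f \<Longrightarrow> continuous_on A (\<lambda>x. ee (f x))"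
  unfolding ee_def by (intro continuous_intros)

lemma expo_diff: "expo (l - l') x = expo l x * cnj (expo l' x)"
  by (simp add: expo_ee ee_mult_cnj left_diff_distrib)

lemma norm_expo [simp]: "cmod (expo l x) = 1"
  by (simp add: expo_ee)

lemma expo_eq_iff: "expo l = expo l' \<longleftrightarrow> l = l'"
proof
  assume eq: "expo l = expo l'"
  show "l = l'"
  proof (rule ccontr)
    assume ne: "l \<noteq> l'"
    define x where "x = 1 / (2 * (l - l'))"
    have "expo (l - l') x = 1"
      unfolding expo_diff eq by (simp add: expo_ee ee_mult_cnj)
    moreover have "(l - l') * x = 1 / 2"
      using ne by (simp add: x_def)
    ultimately show False by (simp add: expo_ee ee_half)
  qed
qed simp

section \<open>Transform, Bessel's inequality and a completeness criterion\<close>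

definition ft :: "real measure \<Rightarrow> real \<Rightarrow> complex" where
  "ft \<mu> \<xi> = (\<integral>x. expo \<xi> x \<partial>\<mu>)"

definition trig :: "real set \<Rightarrow> (real \<Rightarrow> complex) \<Rightarrow> real \<Rightarrow> complex" where
  "trig F c x = (\<Sum>l\<in>F. c l * expo l x)"

lemma continuous_trig [continuous_intros]: "continuous_on A (trig F c)"
  unfolding trig_def expo_ee by (intro continuous_intros)

lemma norm_trig_le: "cmod (trig F c x) \<le> (\<Sum>l\<in>F. cmod (c l))"
  unfolding trig_def by (rule order_trans[OF norm_sum]) (simp add: norm_mult)

context real_distribution
begin

lemma ft_char: "ft M \<xi> = char M (2 * pi * \<xi>)"
  by (simp add: ft_def char_def expo_ee ee_def cis_conv_exp mult_ac)

lemma ft_0 [simp]: "ft M 0 = 1"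
  by (simp add: ft_char char_zero)

lemma norm_ft_le_1: "cmod (ft M \<xi>) \<le> 1"
  by (simp add: ft_char cmod_char_le_1)

lemma isCont_ft: "isCont (ft M) \<xi>"
proof -
  have "isCont (\<lambda>\<xi>. char M (2 * pi * \<xi>)) \<xi>"
    by (intro isCont_o2[OF _ isCont_char] continuous_intros)
  then show ?thesis by (simp add: ft_char[abs_def])
qed

lemma integrable_bounded_continuous:
  fixes h :: "real \<Rightarrow> 'b::{banach, second_countable_topology}"
  assumes "continuous_on UNIV h" "\<And>x. norm (h x) \<le> B"
  shows "integrable M h"
proof -
  have "h \<in> borel_measurable M"
    using borel_measurable_continuous_onI[OF assms(1)] by simp
  then show ?thesis
    by (intro integrable_const_bound[where B = B]) (use assms in auto)
qed

lemma integrable_expo [simp]: "integrable M (expo l)"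
  by (rule integrable_bounded_continuous[where B = 1])
     (auto simp: expo_ee[abs_def] intro!: continuous_intros)

lemma expo_L2: "expo l \<in> L2 M"
  using borel_measurable_integrable[OF integrable_expo[of l]] by (simp add: L2_def)

lemma L2_inner_expo: "L2_inner M (expo l) (expo l') = ft M (l - l')"
  by (simp add: L2_inner_def ft_def expo_diff)

lemma L2_norm_expo: "L2_norm M (expo l) = 1"
  using prob_space by (simp add: L2_norm_def)

lemma ft_minus: "ft M (- \<xi>) = cnj (ft M \<xi>)"
proof -
  have "ft M (- \<xi>) = (\<integral>x. cnj (expo \<xi> x) \<partial>M)"
    by (simp add: ft_def expo_ee ee_minus)
  then show ?thesis by (simp add: ft_def)
qed

lemma integrable_trig [simp]: "integrable M (trig F c)"
  by (rule integrable_bounded_continuous[OF continuous_trig norm_trig_le])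

lemma integrable_trig_sq [simp]: "integrable M (\<lambda>x. (cmod (trig F c x))\<^sup>2)"
  by (rule integrable_bounded_continuous[where B = "(\<Sum>l\<in>F. cmod (c l))\<^sup>2"])
     (auto intro!: continuous_intros power_mono norm_trig_le)

lemma integral_trig_sq:
  "of_real (\<integral>x. (cmod (trig F c x))\<^sup>2 \<partial>M) =
     (\<Sum>l\<in>F. \<Sum>l'\<in>F. c l * cnj (c l') * ft M (l - l'))"
proof -
  have "of_real (\<integral>x. (cmod (trig F c x))\<^sup>2 \<partial>M) =
      (\<integral>x. (of_real ((cmod (trig F c x))\<^sup>2) :: complex) \<partial>M)"
    by (rule integral_complex_of_real[symmetric])
  also have "\<dots> = (\<integral>x. (\<Sum>l\<in>F. \<Sum>l'\<in>F. c l * cnj (c l') * expo (l - l') x) \<partial>M)"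
    by (rule Bochner_Integration.integral_cong)
       (auto simp: complex_norm_square trig_def sum_product expo_diff mult_ac simp del: of_real_power)
  also have "\<dots> = (\<Sum>l\<in>F. \<Sum>l'\<in>F. c l * cnj (c l') * ft M (l - l'))"
    by (simp add: ft_def Bochner_Integration.integral_sum)
  finally show ?thesis .
qed

definition orth :: "real set \<Rightarrow> bool" where
  "orth F \<longleftrightarrow> (\<forall>l\<in>F. \<forall>l'\<in>F. l \<noteq> l' \<longrightarrow> ft M (l - l') = 0)"

lemma orth_subset: "orth F \<Longrightarrow> F' \<subseteq> F \<Longrightarrow> orth F'"
  by (auto simp: orth_def)

lemma integral_trig_sq_orth:
  assumes "finite F" "orth F"
  shows "(\<integral>x. (cmod (trig F c x))\<^sup>2 \<partial>M) = (\<Sum>l\<in>F. (cmod (c l))\<^sup>2)"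
proof -
  have "of_real (\<integral>x. (cmod (trig F c x))\<^sup>2 \<partial>M) =
      (\<Sum>l\<in>F. \<Sum>l'\<in>F. if l' = l then of_real ((cmod (c l))\<^sup>2) else (0::complex))"
    unfolding integral_trig_sq
    using assms(2)
    by (intro sum.cong) (auto simp: orth_def complex_norm_square simp del: of_real_power)
  also have "\<dots> = of_real (\<Sum>l\<in>F. (cmod (c l))\<^sup>2)"
    using assms(1) by (simp add: sum.delta)
  finally show ?thesis by (simp only: of_real_eq_iff)
qed

text \<open>Pythagoras: the subtracted polynomial is the orthogonal projection of
  \<open>expo \<xi>\<close> onto the span of F. Bessel's inequality is the nonnegativity of the left
  side, and completeness means that these distances become small.\<close>

lemma expo_minus_projection:
  assumes "finite F" "orth F"
  shows "(\<integral>x. (cmod (expo \<xi> x - trig F (\<lambda>l. ft M (\<xi> - l)) x))\<^sup>2 \<partial>M) =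
     1 - (\<Sum>l\<in>F. (cmod (ft M (\<xi> - l)))\<^sup>2)"
proof -
  define g where "g = trig F (\<lambda>l. ft M (\<xi> - l))"
  have eq: "(cmod (expo \<xi> x - g x))\<^sup>2 =
      1 + (cmod (g x))\<^sup>2 - 2 * Re (\<Sum>l\<in>F. cnj (ft M (\<xi> - l)) * expo (\<xi> - l) x)" for x
  proof -
    have "(\<Sum>l\<in>F. cnj (ft M (\<xi> - l)) * expo (\<xi> - l) x) = expo \<xi> x * cnj (g x)"
      by (simp add: g_def trig_def expo_diff sum_distrib_left mult_ac)
    moreover have "(cmod (u - v))\<^sup>2 = (cmod u)\<^sup>2 + (cmod v)\<^sup>2 - 2 * Re (u * cnj v)" for u v
      unfolding cmod_power2 by (simp add: power2_eq_square algebra_simps)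
    ultimately show ?thesis by simp
  qed
  have 1: "(\<integral>x. (\<Sum>l\<in>F. cnj (ft M (\<xi> - l)) * expo (\<xi> - l) x) \<partial>M) =
      of_real (\<Sum>l\<in>F. (cmod (ft M (\<xi> - l)))\<^sup>2)"
    by (simp add: ft_def[symmetric] Bochner_Integration.integral_sum complex_norm_square mult.commute
        del: of_real_power)
  have int1: "integrable M (\<lambda>x. (\<Sum>l\<in>F. cnj (ft M (\<xi> - l)) * expo (\<xi> - l) x))"
    by simp
  have "(\<integral>x. (cmod (expo \<xi> x - g x))\<^sup>2 \<partial>M) =
     1 + (\<integral>x. (cmod (g x))\<^sup>2 \<partial>M) -
       2 * Re (\<integral>x. (\<Sum>l\<in>F. cnj (ft M (\<xi> - l)) * expo (\<xi> - l) x) \<partial>M)"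
    unfolding eq integral_Re[OF int1, symmetric]
    by (subst Bochner_Integration.integral_diff Bochner_Integration.integral_add;
        (intro Bochner_Integration.integrable_add integrable_mult_right integrable_Re int1)?)+
       (use prob_space in \<open>auto simp: g_def integrable_Re[OF int1]\<close>)
  also have "\<dots> = 1 - (\<Sum>l\<in>F. (cmod (ft M (\<xi> - l)))\<^sup>2)"
    unfolding 1 using integral_trig_sq_orth[OF assms] by (simp add: g_def)
  finally show ?thesis by (simp add: g_def)
qed

lemma bessel_ft:
  assumes "finite F" "orth F"
  shows "(\<Sum>l\<in>F. (cmod (ft M (\<xi> - l)))\<^sup>2) \<le> 1"
proof -
  have "0 \<le> (\<integral>x. (cmod (expo \<xi> x - trig F (\<lambda>l. ft M (\<xi> - l)) x))\<^sup>2 \<partial>M)"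
    by (rule integral_nonneg_AE) auto
  then show ?thesis
    unfolding expo_minus_projection[OF assms] by simp
qed

lemma is_spectrum_orth:
  assumes "is_spectrum M \<Lambda>"
  shows "orth \<Lambda>"
  unfolding orth_def
proof (intro ballI impI)
  fix l l' assume l: "l \<in> \<Lambda>" "l' \<in> \<Lambda>" "l \<noteq> l'"
  have "\<forall>b\<in>expo ` \<Lambda>. \<forall>b'\<in>expo ` \<Lambda>. b \<noteq> b' \<longrightarrow> L2_inner M b b' = 0"
    using assms unfolding is_spectrum_def L2_orthogonal_basis_def by (elim conjE)
  with l have "L2_inner M (expo l) (expo l') = 0"
    by (simp add: expo_eq_iff)
  then show "ft M (l - l') = 0" by (simp add: L2_inner_expo)
qed

lemma is_spectrum_approx:
  assumes "is_spectrum M \<Lambda>" "f \<in> L2 M" "\<epsilon> > 0"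
  obtains F c where "finite F" "F \<subseteq> \<Lambda>" "L2_norm M (\<lambda>x. f x - trig F c x) < \<epsilon>"
proof -
  have "\<forall>f\<in>L2 M. \<forall>\<epsilon>>0. \<exists>F c. finite F \<and> F \<subseteq> expo ` \<Lambda> \<and>
      L2_norm M (\<lambda>x. f x - (\<Sum>b\<in>F. c b * b x)) < \<epsilon>"
    using assms(1) unfolding is_spectrum_def L2_orthogonal_basis_def by (elim conjE)
  from this[rule_format, OF assms(2,3)]
  obtain F' c' where F': "finite F'" "F' \<subseteq> expo ` \<Lambda>"
    and c': "L2_norm M (\<lambda>x. f x - (\<Sum>b\<in>F'. c' b * b x)) < \<epsilon>"
    by (elim exE conjE)
  obtain F where F: "finite F" "F \<subseteq> \<Lambda>" "F' = expo ` F"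
    using F' by (meson finite_subset_image)
  have "(\<Sum>b\<in>F'. c' b * b x) = trig F (\<lambda>l. c' (expo l)) x" for x
    unfolding F(3) trig_def by (subst sum.reindex) (auto simp: inj_on_def expo_eq_iff)
  with F c' show ?thesis using that[of F "\<lambda>l. c' (expo l)"] by simp
qed

text \<open>A spectral measure has some spectrum \<open>\<Lambda>0\<close>, so trigonometric
  polynomials are dense in \<open>L2 M\<close>. Completeness of another orthogonal set therefore
  needs testing on exponentials only, where the distance to the span is the mass missing in Bessel's
  inequality.\<close>

lemma is_spectrumI:
  assumes M: "spectral_measure M" and "countable \<Lambda>" and o: "orth \<Lambda>"
    and approx: "\<And>\<xi> \<epsilon>. \<epsilon> > 0 \<Longrightarrow> \<exists>F. finite F \<and> F \<subseteq> \<Lambda> \<and> (\<Sum>l\<in>F. (cmod (ft M (\<xi> - l)))\<^sup>2) > 1 - \<epsilon>"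
  shows "is_spectrum M \<Lambda>"
proof -
  have key: "\<exists>F c. finite F \<and> F \<subseteq> expo ` \<Lambda> \<and> L2_norm M (\<lambda>x. f x - (\<Sum>b\<in>F. c b * b x)) < \<epsilon>"
    if f: "f \<in> L2 M" and e: "\<epsilon> > 0" for f \<epsilon>
  proof -
    obtain \<Lambda>0 where L0: "is_spectrum M \<Lambda>0"
      using M by (auto simp: spectral_measure_def)
    obtain G d where G: "finite G" "G \<subseteq> \<Lambda>0" "L2_norm M (\<lambda>x. f x - trig G d x) < \<epsilon> / 2"
      by (rule is_spectrum_approx[OF L0 f half_gt_zero[OF e]])
    \<comment> \<open>Cauchy-Schwarz over the \<open>card G\<close> frequencies turns an error
      \<eta> per exponential into at most (K - 1) * \<eta> for the polynomial; the added 1 makes K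
      positive and the later inequality strict.\<close>
    define K where "K = (\<Sum>l\<in>G. (cmod (d l))\<^sup>2) * real (card G) + 1"
    have K: "K > 0"
      unfolding K_def by (intro add_nonneg_pos mult_nonneg_nonneg sum_nonneg) auto
    define \<eta> where "\<eta> = \<epsilon>\<^sup>2 / (4 * K)"
    have eta: "\<eta> > 0" using K e by (simp add: \<eta>_def)
    have "\<exists>F. \<forall>\<xi>. finite (F \<xi>) \<and> F \<xi> \<subseteq> \<Lambda> \<and> (\<Sum>l\<in>F \<xi>. (cmod (ft M (\<xi> - l)))\<^sup>2) > 1 - \<eta>"
      using approx[OF eta] by metis
    then obtain F where F: "\<And>\<xi>. finite (F \<xi>)" "\<And>\<xi>. F \<xi> \<subseteq> \<Lambda>"
      "\<And>\<xi>. (\<Sum>l\<in>F \<xi>. (cmod (ft M (\<xi> - l)))\<^sup>2) > 1 - \<eta>" by blast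
    define H where "H = (\<Union>\<xi>\<in>G. F \<xi>)"
    have H: "finite H" "H \<subseteq> \<Lambda>" using G F by (auto simp: H_def)
    have oH: "orth H" using orth_subset[OF o H(2)] .
    define err where "err \<xi> x = expo \<xi> x - trig H (\<lambda>l. ft M (\<xi> - l)) x" for \<xi> x
    have err: "(\<integral>x. (cmod (err \<xi> x))\<^sup>2 \<partial>M) \<le> \<eta>" if "\<xi> \<in> G" for \<xi>
    proof -
      have "(\<Sum>l\<in>F \<xi>. (cmod (ft M (\<xi> - l)))\<^sup>2) \<le> (\<Sum>l\<in>H. (cmod (ft M (\<xi> - l)))\<^sup>2)"
        using that H by (intro sum_mono2) (auto simp: H_def)
      then show ?thesis
        unfolding err_def expo_minus_projection[OF H(1) oH] using F(3)[of \<xi>] by simp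
    qed
    define c where "c l = (\<Sum>\<xi>\<in>G. d \<xi> * ft M (\<xi> - l))" for l
    have diff: "trig G d x - trig H c x = (\<Sum>\<xi>\<in>G. d \<xi> * err \<xi> x)" for x
    proof -
      have "(\<Sum>\<xi>\<in>G. d \<xi> * trig H (\<lambda>l. ft M (\<xi> - l)) x) = trig H c x"
        unfolding trig_def c_def sum_distrib_left sum_distrib_right
        by (subst sum.swap) (simp add: mult_ac)
      moreover have "trig G d x = (\<Sum>\<xi>\<in>G. d \<xi> * expo \<xi> x)"
        by (simp add: trig_def)
      ultimately show ?thesis
        by (simp only: err_def right_diff_distrib sum_subtractf)
    qed
    have cerr: "continuous_on UNIV (err \<xi>)" for \<xi>
      unfolding err_def expo_ee by (intro continuous_intros)
    have berr: "cmod (err \<xi> x) \<le> 1 + (\<Sum>l\<in>H. cmod (ft M (\<xi> - l)))" for \<xi> x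
      unfolding err_def by (rule order_trans[OF norm_triangle_ineq4]) (simp add: norm_trig_le)
    have ierr: "integrable M (\<lambda>x. (cmod (err \<xi> x))\<^sup>2)" for \<xi>
      by (rule integrable_bounded_continuous[where B = "(1 + (\<Sum>l\<in>H. cmod (ft M (\<xi> - l))))\<^sup>2"])
         (auto intro!: continuous_intros power_mono berr cerr)
    have pt: "(cmod (trig G d x - trig H c x))\<^sup>2 \<le> (\<Sum>l\<in>G. (cmod (d l))\<^sup>2) * (\<Sum>l\<in>G. (cmod (err l x))\<^sup>2)" for x
    proof -
      have "cmod (trig G d x - trig H c x) \<le> (\<Sum>\<xi>\<in>G. cmod (d \<xi>) * cmod (err \<xi> x))"
        unfolding diff by (rule order_trans[OF norm_sum]) (simp add: norm_mult)
      then have "(cmod (trig G d x - trig H c x))\<^sup>2 \<le> (\<Sum>\<xi>\<in>G. cmod (d \<xi>) * cmod (err \<xi> x))\<^sup>2"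
        by (intro power_mono) auto
      also have "\<dots> \<le> (\<Sum>l\<in>G. (cmod (d l))\<^sup>2) * (\<Sum>l\<in>G. (cmod (err l x))\<^sup>2)"
        by (rule Cauchy_Schwarz_ineq_sum)
      finally show ?thesis .
    qed
    have idiff: "integrable M (\<lambda>x. (cmod (trig G d x - trig H c x))\<^sup>2)"
      by (rule integrable_bounded_continuous[where B = "((\<Sum>l\<in>G. cmod (d l)) + (\<Sum>l\<in>H. cmod (c l)))\<^sup>2"])
         (auto intro!: continuous_intros power_mono order_trans[OF norm_triangle_ineq4]
               add_mono norm_trig_le)
    have "(\<integral>x. (cmod (trig G d x - trig H c x))\<^sup>2 \<partial>M) \<le>
        (\<integral>x. (\<Sum>l\<in>G. (cmod (d l))\<^sup>2) * (\<Sum>l\<in>G. (cmod (err l x))\<^sup>2) \<partial>M)"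
      by (intro integral_mono idiff pt integrable_mult_right Bochner_Integration.integrable_sum ierr)
    also have "\<dots> = (\<Sum>l\<in>G. (cmod (d l))\<^sup>2) * (\<Sum>l\<in>G. (\<integral>x. (cmod (err l x))\<^sup>2 \<partial>M))"
      by (simp add: Bochner_Integration.integral_sum ierr)
    also have "\<dots> \<le> (\<Sum>l\<in>G. (cmod (d l))\<^sup>2) * (\<Sum>l\<in>G. \<eta>)"
      by (intro mult_left_mono sum_mono err sum_nonneg) auto
    also have "\<dots> < K * \<eta>"
      using eta by (simp add: K_def algebra_simps)
    also have "\<dots> = \<epsilon>\<^sup>2 / 4"
      using K by (simp add: \<eta>_def)
    finally have n2: "(\<integral>x. (cmod (trig G d x - trig H c x))\<^sup>2 \<partial>M) < \<epsilon>\<^sup>2 / 4" .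
    have fm: "f \<in> borel_measurable M" "integrable M (\<lambda>x. (cmod (f x))\<^sup>2)"
      using f by (auto simp: L2_def)
    have par: "(cmod (u + v))\<^sup>2 \<le> 2 * (cmod u)\<^sup>2 + 2 * (cmod v)\<^sup>2" for u v
    proof -
      have "(cmod (u + v))\<^sup>2 \<le> (cmod u + cmod v)\<^sup>2"
        by (intro power_mono norm_triangle_ineq) auto
      also have "\<dots> \<le> 2 * (cmod u)\<^sup>2 + 2 * (cmod v)\<^sup>2"
        using sum_squares_bound[of "cmod u" "cmod v"] by (simp add: power2_sum)
      finally show ?thesis .
    qed
    have tm: "trig F c \<in> borel_measurable M" for F c
      using integrable_trig by (rule borel_measurable_integrable)
    have if1: "integrable M (\<lambda>x. (cmod (f x - trig G d x))\<^sup>2)"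
    proof (rule Bochner_Integration.integrable_bound)
      show "integrable M (\<lambda>x. 2 * (cmod (f x))\<^sup>2 + 2 * (cmod (trig G d x))\<^sup>2)"
        using fm by auto
      show "(\<lambda>x. (cmod (f x - trig G d x))\<^sup>2) \<in> borel_measurable M"
        using fm tm by measurable
    qed (use par[of "f x" "- trig G d x" for x] in auto)
    have n1: "(\<integral>x. (cmod (f x - trig G d x))\<^sup>2 \<partial>M) < \<epsilon>\<^sup>2 / 4"
    proof -
      have "sqrt (\<integral>x. (cmod (f x - trig G d x))\<^sup>2 \<partial>M) < sqrt (\<epsilon>\<^sup>2 / 4)"
        using G(3) e by (simp add: L2_norm_def real_sqrt_divide)
      then show ?thesis by (simp only: real_sqrt_less_iff)
    qed
    have "(\<integral>x. (cmod (f x - trig H c x))\<^sup>2 \<partial>M) \<le>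
       (\<integral>x. 2 * (cmod (f x - trig G d x))\<^sup>2 + 2 * (cmod (trig G d x - trig H c x))\<^sup>2 \<partial>M)"
    proof (rule integral_mono_AE')
      show "integrable M (\<lambda>x. 2 * (cmod (f x - trig G d x))\<^sup>2 + 2 * (cmod (trig G d x - trig H c x))\<^sup>2)"
        using if1 idiff by auto
      show "AE x in M. (cmod (f x - trig H c x))\<^sup>2 \<le>
          2 * (cmod (f x - trig G d x))\<^sup>2 + 2 * (cmod (trig G d x - trig H c x))\<^sup>2"
        using par[of "f x - trig G d x" "trig G d x - trig H c x" for x] by auto
    qed auto
    also have "\<dots> = 2 * (\<integral>x. (cmod (f x - trig G d x))\<^sup>2 \<partial>M) +
        2 * (\<integral>x. (cmod (trig G d x - trig H c x))\<^sup>2 \<partial>M)"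
      using if1 idiff by simp
    also have "\<dots> < \<epsilon>\<^sup>2" using n1 n2 by simp
    finally have "L2_norm M (\<lambda>x. f x - trig H c x) < \<epsilon>"
      unfolding L2_norm_def using e by (intro real_less_lsqrt) auto
    moreover have "trig H c x = (\<Sum>b\<in>expo ` H. c (the_inv expo b) * b x)" for x
      unfolding trig_def
      by (subst sum.reindex) (auto simp: inj_on_def expo_eq_iff the_inv_f_f)
    ultimately show ?thesis
      using H by (intro exI[of _ "expo ` H"] exI[of _ "\<lambda>b. c (the_inv expo b)"]) auto
  qed
  show ?thesis
    unfolding is_spectrum_def L2_orthogonal_basis_def
  proof (intro conjI ballI allI impI \<open>countable \<Lambda>\<close>)
    show "expo ` \<Lambda> \<subseteq> L2 M" using expo_L2 by blast
    show "L2_norm M b \<noteq> 0" if "b \<in> expo ` \<Lambda>" for b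
      using that L2_norm_expo by auto
    show "L2_inner M b b' = 0" if "b \<in> expo ` \<Lambda>" "b' \<in> expo ` \<Lambda>" "b \<noteq> b'" for b b'
      using that o by (auto simp: orth_def L2_inner_expo expo_eq_iff)
    show "\<exists>F c. finite F \<and> F \<subseteq> expo ` \<Lambda> \<and> L2_norm M (\<lambda>x. f x - (\<Sum>b\<in>F. c b * b x)) < \<epsilon>"
      if "f \<in> L2 M" "\<epsilon> > 0" for f and \<epsilon> :: real
      by (rule key[OF that])
  qed
qed

end

section \<open>The self-similarity equation\<close>

text \<open>The defining equation speaks of sets; induction over Borel functions carries it to
  integrals.\<close>

lemma self_similar_nn_integral:
  assumes \<mu>: "self_similar_measure N D \<mu>" and f: "f \<in> borel_measurable borel"
  shows "(\<integral>\<^sup>+x. f x \<partial>\<mu>) =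
    ennreal (1 / card D) * (\<Sum>d\<in>D. \<integral>\<^sup>+x. f ((x + real_of_int d) / real_of_int N) \<partial>\<mu>)"
proof -
  interpret real_distribution \<mu>
    using \<mu> by (simp add: self_similar_measure_def)
  define \<phi> where "\<phi> d x = (x + real_of_int d) / real_of_int N" for d x
  have \<phi> [measurable]: "\<phi> d \<in> borel_measurable borel" for d
    unfolding \<phi>_def by measurable
  have comp: "(\<lambda>x. g (\<phi> d x)) \<in> borel_measurable \<mu>"
    if "g \<in> borel_measurable borel" for g :: "real \<Rightarrow> ennreal" and d
    using that by (simp add: measurable_compose[OF \<phi>])
  have "(\<integral>\<^sup>+x. f x \<partial>\<mu>) = ennreal (1 / card D) * (\<Sum>d\<in>D. \<integral>\<^sup>+x. f (\<phi> d x) \<partial>\<mu>)"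
    using f
  proof (induction rule: borel_measurable_induct)
    case (cong f g)
    then show ?case by (simp cong: nn_integral_cong_simp)
  next
    case (set A)
    have vim: "\<phi> d -` A \<in> sets borel" for d
      using measurable_sets[OF \<phi> set] by simp
    have "emeasure \<mu> A = ennreal (measure \<mu> A)" by (rule emeasure_eq_measure)
    also have "measure \<mu> A = 1 / card D * (\<Sum>d\<in>D. measure \<mu> (\<phi> d -` A))"
      using \<mu> set by (auto simp: self_similar_measure_def \<phi>_def[abs_def])
    also have "ennreal \<dots> = ennreal (1 / card D) * (\<Sum>d\<in>D. ennreal (measure \<mu> (\<phi> d -` A)))"
      by (simp add: ennreal_mult'[symmetric] sum_nonneg)
    also have "\<dots> = ennreal (1 / card D) * (\<Sum>d\<in>D. \<integral>\<^sup>+x. indicator A (\<phi> d x) \<partial>\<mu>)"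
    proof -
      have "(\<integral>\<^sup>+x. indicator A (\<phi> d x) \<partial>\<mu>) = ennreal (measure \<mu> (\<phi> d -` A))" for d
      proof -
        have "(\<integral>\<^sup>+x. indicator A (\<phi> d x) \<partial>\<mu>) = (\<integral>\<^sup>+x. indicator (\<phi> d -` A) x \<partial>\<mu>)"
          by (rule nn_integral_cong) (simp add: indicator_def)
        then show ?thesis using vim[of d] by (simp add: emeasure_eq_measure)
      qed
      then show ?thesis by simp
    qed
    finally show ?case using set by simp
  next
    case (mult u c)
    have "(\<integral>\<^sup>+x. c * u x \<partial>\<mu>) = c * (\<integral>\<^sup>+x. u x \<partial>\<mu>)"
      using mult by (intro nn_integral_cmult) simp
    moreover have "(\<integral>\<^sup>+x. c * u (\<phi> d x) \<partial>\<mu>) = c * (\<integral>\<^sup>+x. u (\<phi> d x) \<partial>\<mu>)" for d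
      using comp[OF mult(2)] by (intro nn_integral_cmult) simp
    ultimately show ?case
      using mult.IH by (simp add: sum_distrib_left[symmetric] mult.left_commute)
  next
    case (add u v)
    have "(\<integral>\<^sup>+x. v x + u x \<partial>\<mu>) = (\<integral>\<^sup>+x. v x \<partial>\<mu>) + (\<integral>\<^sup>+x. u x \<partial>\<mu>)"
      using add by (intro nn_integral_add) simp_all
    moreover have "(\<integral>\<^sup>+x. v (\<phi> d x) + u (\<phi> d x) \<partial>\<mu>) =
        (\<integral>\<^sup>+x. v (\<phi> d x) \<partial>\<mu>) + (\<integral>\<^sup>+x. u (\<phi> d x) \<partial>\<mu>)" for d
      using add comp by (intro nn_integral_add) simp_all
    ultimately show ?case
      using add.IH by (simp add: sum.distrib distrib_left)
  next
    case (seq U)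
    have "(\<integral>\<^sup>+x. (SUP i. U i) x \<partial>\<mu>) = (\<integral>\<^sup>+x. (SUP i. U i x) \<partial>\<mu>)"
      by (simp add: image_comp)
    also have "\<dots> = (SUP i. \<integral>\<^sup>+x. U i x \<partial>\<mu>)"
      using seq by (intro nn_integral_monotone_convergence_SUP) simp_all
    also have "\<dots> = (SUP i. ennreal (1 / card D) * (\<Sum>d\<in>D. \<integral>\<^sup>+x. U i (\<phi> d x) \<partial>\<mu>))"
      using seq.IH by simp
    also have "\<dots> = ennreal (1 / card D) * (\<Sum>d\<in>D. SUP i. \<integral>\<^sup>+x. U i (\<phi> d x) \<partial>\<mu>)"
      using \<open>incseq U\<close>
      by (subst ennreal_SUP_sum[symmetric])
         (auto simp: SUP_mult_left_ennreal incseq_def le_fun_def intro!: nn_integral_mono)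
    also have "\<dots> = ennreal (1 / card D) * (\<Sum>d\<in>D. \<integral>\<^sup>+x. (SUP i. U i (\<phi> d x)) \<partial>\<mu>)"
      using seq comp
      by (subst nn_integral_monotone_convergence_SUP) (auto simp: incseq_def le_fun_def)
    finally show ?case by (simp add: image_comp)
  qed
  then show ?thesis by (simp add: \<phi>_def)
qed

lemma self_similar_integral_nonneg:
  fixes h :: "real \<Rightarrow> real"
  assumes \<mu>: "self_similar_measure N D \<mu>" and "continuous_on UNIV h" "\<And>x. 0 \<le> h x" "\<And>x. h x \<le> B"
  shows "(\<integral>x. h x \<partial>\<mu>) = (\<Sum>d\<in>D. \<integral>x. h ((x + real_of_int d) / real_of_int N) \<partial>\<mu>) / card D"
proof -
  interpret real_distribution \<mu>
    using \<mu> by (simp add: self_similar_measure_def)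
  have c: "continuous_on UNIV (\<lambda>x. h ((x + real_of_int d) / real_of_int N))" for d
    by (rule continuous_on_compose2[OF assms(2)]) (auto simp: divide_inverse intro!: continuous_intros)
  have i1: "integrable \<mu> h"
    by (rule integrable_bounded_continuous[OF assms(2), where B = B]) (use assms in auto)
  have i2: "integrable \<mu> (\<lambda>x. h ((x + real_of_int d) / real_of_int N))" for d
    by (rule integrable_bounded_continuous[OF c, where B = B]) (use assms in auto)
  have "ennreal (\<integral>x. h x \<partial>\<mu>) = (\<integral>\<^sup>+x. ennreal (h x) \<partial>\<mu>)"
    using i1 assms by (intro nn_integral_eq_integral[symmetric]) auto
  also have "\<dots> = ennreal (1 / card D) *
      (\<Sum>d\<in>D. \<integral>\<^sup>+x. ennreal (h ((x + real_of_int d) / real_of_int N)) \<partial>\<mu>)"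
    by (rule self_similar_nn_integral[OF \<mu>])
       (use borel_measurable_continuous_onI[OF assms(2)] in measurable)
  also have "\<dots> = ennreal (1 / card D) *
      (\<Sum>d\<in>D. ennreal (\<integral>x. h ((x + real_of_int d) / real_of_int N) \<partial>\<mu>))"
    using i2 assms by (subst nn_integral_eq_integral) auto
  also have "\<dots> = ennreal ((\<Sum>d\<in>D. \<integral>x. h ((x + real_of_int d) / real_of_int N) \<partial>\<mu>) / card D)"
    using assms by (simp add: ennreal_mult'[symmetric] sum_nonneg)
  finally show ?thesis
    using assms by (subst (asm) ennreal_inj) (auto intro!: divide_nonneg_nonneg sum_nonneg)
qed

lemma self_similar_integral_real:
  fixes h :: "real \<Rightarrow> real"
  assumes \<mu>: "self_similar_measure N D \<mu>" and D: "finite D" "D \<noteq> {}"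
    and h: "continuous_on UNIV h" "\<And>x. \<bar>h x\<bar> \<le> B"
  shows "(\<integral>x. h x \<partial>\<mu>) = (\<Sum>d\<in>D. \<integral>x. h ((x + real_of_int d) / real_of_int N) \<partial>\<mu>) / card D"
proof -
  interpret real_distribution \<mu>
    using \<mu> by (simp add: self_similar_measure_def)
  have c: "continuous_on UNIV (\<lambda>x. h ((x + real_of_int d) / real_of_int N))" for d
    by (rule continuous_on_compose2[OF h(1)]) (auto simp: divide_inverse intro!: continuous_intros)
  have i1: "integrable \<mu> h"
    by (rule integrable_bounded_continuous[OF h(1), where B = B]) (use h in auto)
  have i2: "integrable \<mu> (\<lambda>x. h ((x + real_of_int d) / real_of_int N))" for d
    by (rule integrable_bounded_continuous[OF c, where B = B]) (use h in auto)
  \<comment> \<open>Adding the bound B makes the integrand nonnegative; B cancels because both sides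
    are averages over probability measures.\<close>
  have "(\<integral>x. h x + B \<partial>\<mu>) = (\<Sum>d\<in>D. \<integral>x. h ((x + real_of_int d) / real_of_int N) + B \<partial>\<mu>) / card D"
    by (rule self_similar_integral_nonneg[OF \<mu>, where B = "2 * B"])
       (use h(2) in \<open>auto intro!: continuous_intros h(1) simp: abs_le_iff\<close>,
        (metis add.commute add.right_inverse add_left_mono minus_le_iff h(2) abs_le_iff)?)
  then have "(\<integral>x. h x \<partial>\<mu>) + B = (\<Sum>d\<in>D. (\<integral>x. h ((x + real_of_int d) / real_of_int N) \<partial>\<mu>) + B) / card D"
    using i1 i2 prob_space by simp
  then show ?thesis
    using D by (simp add: sum.distrib add_divide_distrib)
qed

lemma self_similar_integral:
  fixes h :: "real \<Rightarrow> complex"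
  assumes \<mu>: "self_similar_measure N D \<mu>" and D: "finite D" "D \<noteq> {}"
    and h: "continuous_on UNIV h" "\<And>x. cmod (h x) \<le> B"
  shows "(\<integral>x. h x \<partial>\<mu>) = (\<Sum>d\<in>D. \<integral>x. h ((x + real_of_int d) / real_of_int N) \<partial>\<mu>) / card D"
proof -
  interpret real_distribution \<mu>
    using \<mu> by (simp add: self_similar_measure_def)
  have c: "continuous_on UNIV (\<lambda>x. h ((x + real_of_int d) / real_of_int N))" for d
    by (rule continuous_on_compose2[OF h(1)]) (auto simp: divide_inverse intro!: continuous_intros)
  have i1: "integrable \<mu> h"
    by (rule integrable_bounded_continuous[OF h(1), where B = B]) (use h in auto)
  have i2: "integrable \<mu> (\<lambda>x. h ((x + real_of_int d) / real_of_int N))" for d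
    by (rule integrable_bounded_continuous[OF c, where B = B]) (use h in auto)
  have "(\<integral>x. Re (h x) \<partial>\<mu>) = (\<Sum>d\<in>D. \<integral>x. Re (h ((x + real_of_int d) / real_of_int N)) \<partial>\<mu>) / card D"
    by (rule self_similar_integral_real[OF \<mu> D, where B = B])
       (auto intro!: continuous_intros h(1) order_trans[OF abs_Re_le_cmod h(2)])
  moreover have "(\<integral>x. Im (h x) \<partial>\<mu>) = (\<Sum>d\<in>D. \<integral>x. Im (h ((x + real_of_int d) / real_of_int N)) \<partial>\<mu>) / card D"
    by (rule self_similar_integral_real[OF \<mu> D, where B = B])
       (auto intro!: continuous_intros h(1) order_trans[OF abs_Im_le_cmod h(2)])
  ultimately show ?thesis
    using i1 i2 by (simp add: complex_eq_iff)
qed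

section \<open>The mask and its zeros\<close>

text \<open>For unit numbers conjugation is inversion. Multiplying the conjugated equation by u v w
  shows that (1 + u)(1 + v)(1 + w) is a sum of two vanishing expressions; so one of u, v, w is -1
  and the other two cancel.\<close>

lemma unit_sum_zero:
  fixes u v w :: complex
  assumes "cmod u = 1" "cmod v = 1" "cmod w = 1" and sum: "1 + u + v + w = 0"
  shows "u = -1 \<and> v = - w \<or> v = -1 \<and> u = - w \<or> w = -1 \<and> u = - v"
proof -
  have nz: "u \<noteq> 0" "v \<noteq> 0" "w \<noteq> 0"
    using assms by auto
  have inv: "u * cnj u = 1" "v * cnj v = 1" "w * cnj w = 1"
    using assms by (simp_all add: complex_norm_square[symmetric])
  have cs: "1 + cnj u + cnj v + cnj w = 0"
    using arg_cong[OF sum, of cnj] by simp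
  have "u * v * w + v * w * (u * cnj u) + u * w * (v * cnj v) + u * v * (w * cnj w) =
      u * v * w * (1 + cnj u + cnj v + cnj w)"
    by (simp add: algebra_simps)
  then have e2: "u * v * w + v * w + u * w + u * v = 0"
    using inv cs by simp
  have "(1 + u) * (1 + v) * (1 + w) = (1 + u + v + w) + (u * v * w + v * w + u * w + u * v)"
    by (simp add: algebra_simps)
  then have "(1 + u) * (1 + v) * (1 + w) = 0"
    using sum e2 by simp
  then have "1 + u = 0 \<or> 1 + v = 0 \<or> 1 + w = 0" by auto
  then show ?thesis
  proof (elim disjE)
    assume "1 + u = 0"
    with sum have "v + w = 0" by (simp add: add.assoc)
    with \<open>1 + u = 0\<close> show ?thesis by (simp add: eq_neg_iff_add_eq_0 add.commute)
  next
    assume "1 + v = 0"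
    moreover from this sum have "u + w = 0" by (metis add.assoc add.commute add.left_neutral)
    ultimately show ?thesis by (simp add: eq_neg_iff_add_eq_0 add.commute)
  next
    assume "1 + w = 0"
    moreover from this sum have "u + v = 0" by (metis add.assoc add.commute add.left_neutral)
    ultimately show ?thesis by (simp add: eq_neg_iff_add_eq_0 add.commute)
  qed
qed

section \<open>The transform of the four-digit measure as a product of masks\<close>

locale four_digit_measure = real_distribution \<mu> for \<mu> :: "real measure" +
  fixes \<beta> \<tau> k r :: nat and N m a l1 l2 :: int
  assumes N_eq: "N = 2 ^ \<beta> * m"
    and odds: "odd m" "odd a" "odd l1" "odd l2"
    and \<tau>_eq: "\<tau> = \<beta> * k + r" and r: "0 < r" "r < \<beta>"
    and self_similar: "self_similar_measure N {0, a, 2 ^ \<tau> * l1, a + 2 ^ \<tau> * l2} \<mu>"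
    and spectral: "spectral_measure \<mu>"
    and N_gt: "N > 4"
begin

definition mask :: "real \<Rightarrow> complex" where
  "mask x = (1 + ee (of_int a * x) + ee (2 ^ \<tau> * of_int l1 * x) + ee ((of_int a + 2 ^ \<tau> * of_int l2) * x)) / 4"

text \<open>The mask of the digit pair 0, \<open>2 ^ \<tau> * l1\<close>: it vanishes at the zeros
  of the second kind of \<open>mask\<close>, and it supplies two instead of four digits on each of
  the k extra levels.\<close>

definition half_mask :: "real \<Rightarrow> complex" where
  "half_mask x = (1 + ee (2 ^ \<tau> * of_int l1 * x)) / 2"

text \<open>A common odd multiple of the three odd coefficients occurring in the zeros of
  \<open>mask\<close>: every zero x has \<open>2 * G * x\<close> or
  \<open>2 ^ (\<tau> + 1) * G * x\<close> odd.\<close>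

definition G :: int where
  "G = a * l1 * (a + 2 ^ \<tau> * l2)"

definition oddreal :: "real \<Rightarrow> bool" where
  "oddreal x \<longleftrightarrow> (\<exists>n::int. odd n \<and> x = of_int n)"

lemma \<tau>_pos: "\<tau> > 0"
  using \<tau>_eq r by simp

lemma odd_G: "odd G"
  using odds \<tau>_pos by (simp add: G_def)

lemma G_nonzero: "G \<noteq> 0"
  using odd_G by auto

lemma m_pos: "m > 0"
proof -
  have "0 < (2::int) ^ \<beta> * m" using N_gt N_eq by simp
  then show ?thesis by (simp add: zero_less_mult_iff)
qed

lemma oddreal_mult: "oddreal x \<Longrightarrow> oddreal y \<Longrightarrow> oddreal (x * y)"
  unfolding oddreal_def by (metis even_mult_iff of_int_mult)

lemma oddreal_of_int [simp]: "oddreal (of_int n) \<longleftrightarrow> odd n"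
  by (auto simp: oddreal_def)

lemma ee_eq_minus_1: "ee t = -1 \<longleftrightarrow> oddreal (2 * t)"
  by (simp add: ee_eq_minus_1_iff oddreal_def)

lemma continuous_mask [continuous_intros]: "continuous_on A f \<Longrightarrow> continuous_on A (\<lambda>x. mask (f x))"
  unfolding mask_def by (intro continuous_intros) auto

lemma continuous_half_mask [continuous_intros]: "continuous_on A f \<Longrightarrow> continuous_on A (\<lambda>x. half_mask (f x))"
  unfolding half_mask_def by (intro continuous_intros) auto

lemma norm_half_mask_le_1: "cmod (half_mask x) \<le> 1"
  using norm_triangle_ineq[of 1 "ee (2 ^ \<tau> * of_int l1 * x)"] by (simp add: half_mask_def norm_divide)

lemma ee_plus_Ints: "t \<in> \<int> \<Longrightarrow> ee (s + t) = ee s"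
  by (simp add: ee_add ee_Ints)

lemma mask_period: "t \<in> \<int> \<Longrightarrow> mask (x + t) = mask x"
  by (simp add: mask_def distrib_left ee_plus_Ints)

lemma half_mask_period: "t \<in> \<int> \<Longrightarrow> half_mask (x + t) = half_mask x"
  by (simp add: half_mask_def distrib_left ee_plus_Ints)

lemma digits_distinct: "card {0, a, 2 ^ \<tau> * l1, a + 2 ^ \<tau> * l2} = 4"
proof -
  define u v where "u = 2 ^ \<tau> * l1" and "v = 2 ^ \<tau> * l2"
  have e: "even u" "even v" "u \<noteq> 0" "v \<noteq> 0"
    using \<tau>_pos odds by (auto simp: u_def v_def)
  have "odd (a + v)" using e(2) odds(2) by simp
  then have "a \<noteq> u" "a \<noteq> 0" "a + v \<noteq> 0" "u \<noteq> a + v" "a \<noteq> a + v"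
    using e odds(2) by fastforce+
  then have "card {0, a, u, a + v} = 4"
    using e by (simp add: card_insert_if)
  then show ?thesis by (simp only: u_def v_def)
qed

lemma sum_digits: "(\<Sum>d\<in>{0, a, 2 ^ \<tau> * l1, a + 2 ^ \<tau> * l2}. f d) =
    f 0 + f a + f (2 ^ \<tau> * l1) + f (a + 2 ^ \<tau> * l2)" for f :: "int \<Rightarrow> 'b::comm_monoid_add"
proof -
  have d: "distinct [0, a, 2 ^ \<tau> * l1, a + 2 ^ \<tau> * l2]"
    using digits_distinct by (intro card_distinct) simp
  have "(\<Sum>d\<in>set [0, a, 2 ^ \<tau> * l1, a + 2 ^ \<tau> * l2]. f d) =
      sum_list (map f [0, a, 2 ^ \<tau> * l1, a + 2 ^ \<tau> * l2])"
    by (rule sum.distinct_set_conv_list[OF d])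
  then show ?thesis by (simp add: add.assoc)
qed

lemma ft_rec: "ft \<mu> \<xi> = mask (\<xi> / of_int N) * ft \<mu> (\<xi> / of_int N)"
proof -
  have "expo \<xi> ((x + of_int d) / of_int N) = ee (d * (\<xi> / of_int N)) * expo (\<xi> / of_int N) x" for d x
    by (simp add: expo_ee ee_add[symmetric] algebra_simps add_divide_distrib)
  then have *: "(\<integral>x. expo \<xi> ((x + of_int d) / of_int N) \<partial>\<mu>) = ee (d * (\<xi> / of_int N)) * ft \<mu> (\<xi> / of_int N)" for d
    by (simp add: ft_def)
  have "ft \<mu> \<xi> = (\<Sum>d\<in>{0, a, 2 ^ \<tau> * l1, a + 2 ^ \<tau> * l2}. ee (d * (\<xi> / of_int N)) * ft \<mu> (\<xi> / of_int N)) / 4"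
    unfolding ft_def[of \<mu> \<xi>] *[symmetric]
    by (subst self_similar_integral[OF self_similar, where B = 1])
       (auto simp: digits_distinct expo_ee intro!: continuous_intros)
  then show ?thesis
    unfolding sum_digits by (simp add: mask_def algebra_simps)
qed

lemma ft_prod: "ft \<mu> \<xi> = (\<Prod>j=1..T. mask (\<xi> / of_int N ^ j)) * ft \<mu> (\<xi> / of_int N ^ T)"
proof (induction T)
  case (Suc T)
  have "ft \<mu> (\<xi> / of_int N ^ T) = mask (\<xi> / of_int N ^ Suc T) * ft \<mu> (\<xi> / of_int N ^ Suc T)"
    by (subst ft_rec) (simp add: mult.commute)
  then show ?case by (subst Suc.IH) (simp add: mult_ac)
qed simp

text \<open>\<open>x / N\<close> is the branch of the digit 0 in the self-similarity equation, one
  of four branches of weight 1/4; the other three contribute nonnegatively.\<close>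

lemma integral_scale_le:
  fixes h :: "real \<Rightarrow> real"
  assumes "continuous_on UNIV h" "\<And>x. 0 \<le> h x" "\<And>x. h x \<le> B"
  shows "(\<integral>x. h (x / of_int N) \<partial>\<mu>) \<le> 4 * (\<integral>x. h x \<partial>\<mu>)"
proof -
  have "0 \<le> (\<integral>x. h ((x + of_int d) / of_int N) \<partial>\<mu>)" for d
    using assms by (intro integral_nonneg_AE) auto
  note nn = this[of a] this[of "2 ^ \<tau> * l1"] this[of "a + 2 ^ \<tau> * l2"]
  show ?thesis
    unfolding self_similar_integral_nonneg[OF self_similar assms] sum_digits digits_distinct
    using nn by simp
qed

text \<open>The four unit terms cancel in pairs. If 1 cancels against a term of odd frequency, the
  zero is of the first kind. If it cancels against the even frequency
  \<open>2 ^ \<tau> * l1\<close>, the quotient of the remaining two terms,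
  \<open>ee (2 ^ \<tau> * l2 * x)\<close>, must be -1 too; this is the second kind.\<close>

lemma mask_zero:
  assumes "mask x = 0"
  shows "oddreal (2 * of_int G * x) \<or> oddreal (2 * (2 ^ \<tau> * of_int l1 * x)) \<and> oddreal (2 * (2 ^ \<tau> * of_int l2 * x))"
proof -
  have sum: "1 + ee (of_int a * x) + ee (2 ^ \<tau> * of_int l1 * x) + ee ((of_int a + 2 ^ \<tau> * of_int l2) * x) = 0"
    using assms by (simp add: mask_def)
  have split: "ee ((of_int a + 2 ^ \<tau> * of_int l2) * x) = ee (of_int a * x) * ee (2 ^ \<tau> * of_int l2 * x)"
    by (simp add: ee_add[symmetric] distrib_right)
  from unit_sum_zero[OF norm_ee norm_ee norm_ee sum] show ?thesis
  proof (elim disjE conjE)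
    assume "ee (of_int a * x) = -1"
    then have "oddreal (2 * (of_int a * x))" by (simp add: ee_eq_minus_1)
    moreover have "oddreal (of_int (l1 * (a + 2 ^ \<tau> * l2)))"
      using odds \<tau>_pos by (simp only: oddreal_of_int) simp
    ultimately have "oddreal (2 * (of_int a * x) * of_int (l1 * (a + 2 ^ \<tau> * l2)))"
      by (rule oddreal_mult)
    then show ?thesis by (simp add: G_def algebra_simps)
  next
    assume 1: "ee (2 ^ \<tau> * of_int l1 * x) = -1" and 2: "ee (of_int a * x) = - ee ((of_int a + 2 ^ \<tau> * of_int l2) * x)"
    from 2 have "ee (2 ^ \<tau> * of_int l2 * x) = -1"
      unfolding split by (metis ee_nonzero minus_mult_right mult_cancel_left1 minus_minus)
    with 1 show ?thesis by (simp add: ee_eq_minus_1)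
  next
    assume "ee ((of_int a + 2 ^ \<tau> * of_int l2) * x) = -1"
    then have "oddreal (2 * ((of_int a + 2 ^ \<tau> * of_int l2) * x))" by (simp add: ee_eq_minus_1)
    moreover have "oddreal (of_int (a * l1))"
      using odds by (simp only: oddreal_of_int) simp
    ultimately have "oddreal (2 * ((of_int a + 2 ^ \<tau> * of_int l2) * x) * of_int (a * l1))"
      by (rule oddreal_mult)
    then show ?thesis by (simp add: G_def algebra_simps)
  qed
qed

lemma oddreal_G:
  assumes "oddreal (2 * (2 ^ \<tau> * of_int l1 * x))"
  shows "oddreal (2 ^ (\<tau> + 1) * of_int G * x)"
proof -
  have "oddreal (of_int (a * (a + 2 ^ \<tau> * l2)))"
    using odds \<tau>_pos by (simp only: oddreal_of_int) simp
  from oddreal_mult[OF assms this] show ?thesis by (simp add: G_def mult_ac)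
qed

lemma mask_zeroI1:
  assumes "oddreal (2 * x)"
  shows "mask x = 0"
proof -
  obtain n where n: "odd n" "2 * x = of_int n" using assms by (auto simp: oddreal_def)
  obtain t where t: "\<tau> = Suc t" using \<tau>_pos by (cases \<tau>) auto
  have I: "2 ^ \<tau> * y * x \<in> \<int>" if "y \<in> \<int>" for y :: real
  proof -
    have "2 ^ \<tau> * y * x = 2 ^ t * y * (2 * x)" by (simp add: t)
    then show ?thesis using that by (simp only: n(2)) simp
  qed
  have "oddreal (2 * x * of_int a)"
    using oddreal_mult[OF assms, of "of_int a"] odds by simp
  then have "ee (of_int a * x) = -1" by (simp add: ee_eq_minus_1 mult_ac)
  moreover have "ee ((of_int a + 2 ^ \<tau> * of_int l2) * x) = ee (of_int a * x)"
    by (simp add: distrib_right ee_plus_Ints I)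
  ultimately show ?thesis using I[of l1] by (simp add: mask_def ee_Ints)
qed

lemma zeroI2:
  assumes "oddreal (2 ^ (\<tau> + 1) * x)"
  shows "mask x = 0" "half_mask x = 0"
proof -
  have *: "ee (2 ^ \<tau> * of_int l * x) = -1" if "odd l" for l
    using oddreal_mult[OF assms, of "of_int l"] that by (simp add: ee_eq_minus_1 mult_ac)
  have "ee ((of_int a + 2 ^ \<tau> * of_int l2) * x) = - ee (of_int a * x)"
    using *[OF odds(4)] by (simp add: distrib_right ee_add)
  then show "mask x = 0" "half_mask x = 0"
    using *[OF odds(3)] by (simp_all add: mask_def half_mask_def)
qed

lemma N_real_gt: "real_of_int N > 4" "real_of_int N \<noteq> 0"
  using N_gt by linarith+

lemma N_power_tendsto: "(\<lambda>T. x / real_of_int N ^ T) \<longlonglongrightarrow> 0"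
  using N_real_gt by real_asymp

lemma ft_scale_tendsto: "(\<lambda>T. ft \<mu> (x / of_int N ^ T)) \<longlonglongrightarrow> 1"
  using isCont_tendsto_compose[OF isCont_ft N_power_tendsto, of x] by simp

lemma ft_zeroI: "j \<ge> 1 \<Longrightarrow> mask (\<xi> / of_int N ^ j) = 0 \<Longrightarrow> ft \<mu> \<xi> = 0"
  using ft_prod[of \<xi> j] by (auto simp: prod_zero_iff intro!: bexI[of _ j])

text \<open>The tail \<open>ft \<mu> (\<xi> / N ^ T)\<close> tends to 1, so a zero must come from
  one of finitely many masks.\<close>

lemma ft_zeroD:
  assumes "ft \<mu> \<xi> = 0"
  obtains j where "j \<ge> 1" "mask (\<xi> / of_int N ^ j) = 0"
proof -
  have "eventually (\<lambda>T. ft \<mu> (\<xi> / of_int N ^ T) \<noteq> 0) sequentially"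
    using tendsto_imp_eventually_ne[OF ft_scale_tendsto] by simp
  then obtain T where "ft \<mu> (\<xi> / of_int N ^ T) \<noteq> 0"
    by (meson eventually_happens' sequentially_bot)
  then have "(\<Prod>j=1..T. mask (\<xi> / of_int N ^ j)) = 0"
    using assms ft_prod[of \<xi> T] by simp
  then show ?thesis using that by auto
qed

end

section \<open>Shifts away from the zeros\<close>

lemma two_power_odd_unique:
  fixes p q :: int
  assumes "2 ^ x * p = 2 ^ y * q" "odd p" "odd q"
  shows "x = y" "p = q"
proof -
  have *: "x \<le> y" if e: "2 ^ x * p = 2 ^ y * q" and o: "odd q" for x y and p q :: int
  proof (rule ccontr)
    assume "\<not> x \<le> y"
    then have "x = y + Suc (x - y - 1)" by simp
    then have "(2::int) ^ x = 2 ^ y * (2 * 2 ^ (x - y - 1))"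
      by (metis power_Suc power_add)
    then have "2 ^ y * (2 * 2 ^ (x - y - 1) * p) = 2 ^ y * q" using e by simp
    then have "2 * 2 ^ (x - y - 1) * p = q" by (subst (asm) mult_left_cancel) auto
    then show False using o by auto
  qed
  show "x = y" using *[OF assms(1,3)] *[OF assms(1)[symmetric] assms(2)] by simp
  then show "p = q" using assms(1) by simp
qed

text \<open>Near a simple zero |f| grows at least linearly, while |g| grows at most linearly near
  any zero at which g is differentiable.\<close>

lemma comparable_near_common_zero:
  fixes f g :: "real \<Rightarrow> complex"
  assumes f: "(f has_vector_derivative D) (at x0)" "D \<noteq> 0" "f x0 = 0"
    and g: "(g has_vector_derivative E) (at x0)" "g x0 = 0"
  shows "\<exists>c>0. eventually (\<lambda>x. cmod (f x) \<ge> c * cmod (g x)) (nhds x0)"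
proof -
  have "cmod D / 2 > 0" using f(2) by simp
  moreover have "(f has_derivative (\<lambda>h. h *\<^sub>R D)) (at x0)"
    using f(1) by (simp add: has_vector_derivative_def)
  ultimately obtain d1 where d1: "d1 > 0"
    "\<And>y. \<bar>y - x0\<bar> < d1 \<Longrightarrow> cmod (f y - f x0 - (y - x0) *\<^sub>R D) \<le> cmod D / 2 * \<bar>y - x0\<bar>"
    unfolding has_derivative_at_alt by (metis real_norm_def)
  have "(g has_derivative (\<lambda>h. h *\<^sub>R E)) (at x0)"
    using g(1) by (simp add: has_vector_derivative_def)
  then obtain d2 where d2: "d2 > 0"
    "\<And>y. \<bar>y - x0\<bar> < d2 \<Longrightarrow> cmod (g y - g x0 - (y - x0) *\<^sub>R E) \<le> 1 * \<bar>y - x0\<bar>"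
    unfolding has_derivative_at_alt by (metis real_norm_def zero_less_one)
  define c where "c = cmod D / 2 / (cmod E + 1)"
  have E1: "cmod E + 1 > 0" by (simp add: add_nonneg_pos)
  have c: "c > 0" unfolding c_def using f(2) E1 by simp
  have "cmod (f y) \<ge> c * cmod (g y)" if y: "\<bar>y - x0\<bar> < min d1 d2" for y
  proof -
    have "cmod ((y - x0) *\<^sub>R D) - cmod (f y) \<le> cmod (f y - (y - x0) *\<^sub>R D)"
      by (metis norm_minus_commute norm_triangle_ineq2)
    with d1(2)[of y] y f(3) have 1: "cmod (f y) \<ge> cmod D / 2 * \<bar>y - x0\<bar>"
      by (simp add: mult.commute)
    have "cmod (g y) - cmod ((y - x0) *\<^sub>R E) \<le> cmod (g y - (y - x0) *\<^sub>R E)"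
      by (rule norm_triangle_ineq2)
    with d2(2)[of y] y g(2) have 2: "cmod (g y) \<le> (cmod E + 1) * \<bar>y - x0\<bar>"
      by (simp add: distrib_left mult.commute)
    have "c * cmod (g y) \<le> c * ((cmod E + 1) * \<bar>y - x0\<bar>)"
      using 2 c by (intro mult_left_mono) auto
    also have "\<dots> = cmod D / 2 * \<bar>y - x0\<bar>"
    proof -
      have "c * (cmod E + 1) = cmod D / 2" using E1 c_def by (metis less_irrefl nonzero_eq_divide_eq)
      then show ?thesis by (metis mult.assoc)
    qed
    finally show ?thesis using 1 by simp
  qed
  then have "eventually (\<lambda>x. cmod (f x) \<ge> c * cmod (g x)) (nhds x0)"
    unfolding eventually_nhds_metric dist_real_def using d1(1) d2(1)
    by (intro exI[of _ "min d1 d2"]) simp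
  with c show ?thesis by blast
qed

lemma eventually_half_norm:
  fixes f :: "real \<Rightarrow> complex"
  assumes "isCont f x0" "f x0 \<noteq> 0"
  shows "eventually (\<lambda>x. cmod (f x) \<ge> cmod (f x0) / 2) (nhds x0)"
proof -
  have "isCont (\<lambda>x. cmod (f x)) x0" using assms by (intro continuous_intros)
  then have "((\<lambda>x. cmod (f x)) \<longlongrightarrow> cmod (f x0)) (nhds x0)"
    using tendsto_at_iff_tendsto_nhds[of "\<lambda>x. cmod (f x)" x0] by (simp add: isCont_def)
  from order_tendstoD(1)[OF this, of "cmod (f x0) / 2"] assms(2)
  show ?thesis by (auto elim: eventually_mono)
qed

lemma eventually_prod_ge:
  fixes f g :: "'i \<Rightarrow> 'x \<Rightarrow> real"
  assumes "finite I" "\<And>i x. i \<in> I \<Longrightarrow> 0 \<le> g i x"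
    and "\<And>i. i \<in> I \<Longrightarrow> \<exists>c>0. eventually (\<lambda>x. f i x \<ge> c * g i x) F"
  shows "\<exists>c>0. eventually (\<lambda>x. (\<Prod>i\<in>I. f i x) \<ge> c * (\<Prod>i\<in>I. g i x)) F"
  using assms
proof (induction I rule: finite_induct)
  case empty
  then show ?case by (intro exI[of _ 1]) auto
next
  case (insert i I)
  obtain c where c: "c > 0" "eventually (\<lambda>x. (\<Prod>i\<in>I. f i x) \<ge> c * (\<Prod>i\<in>I. g i x)) F"
    using insert by auto
  obtain d where d: "d > 0" "eventually (\<lambda>x. f i x \<ge> d * g i x) F"
    using insert.prems(2)[of i] by auto
  have "eventually (\<lambda>x. (\<Prod>i\<in>insert i I. f i x) \<ge> (d * c) * (\<Prod>i\<in>insert i I. g i x)) F"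
    using c(2) d(2)
  proof eventually_elim
    case (elim x)
    have "(d * g i x) * (c * (\<Prod>i\<in>I. g i x)) \<le> f i x * (\<Prod>i\<in>I. f i x)"
      using elim c(1) d(1) insert.prems(1)
      by (intro mult_mono) (auto intro!: mult_nonneg_nonneg prod_nonneg intro: order_trans[rotated])
    then show ?case using insert by (simp add: mult_ac)
  qed
  then show ?case using c(1) d(1) by (intro exI[of _ "d * c"]) auto
qed

context four_digit_measure
begin

section \<open>Order of vanishing of the mask\<close>

lemma ee_has_vector_derivative:
  "((\<lambda>x. ee (b * x)) has_vector_derivative (2 * of_real pi * \<i> * of_real b) * ee (b * x)) (at x)"
proof -
  have "((\<lambda>x. cis (2 * pi * (b * x))) has_vector_derivative
     (2 * pi * b) *\<^sub>R (\<i> * cis (2 * pi * (b * x)))) (at x)"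
    unfolding has_vector_derivative_def
    by (auto intro!: derivative_eq_intros simp: fun_eq_iff scaleR_conv_of_real)
  then show ?thesis by (simp add: ee_def scaleR_conv_of_real mult_ac)
qed

text \<open>Where \<open>mask\<close> is nonzero this is continuity. At a zero of the second kind
  both functions vanish, and the point is that the zero of \<open>mask\<close> is simple.\<close>

lemma mask_ge_half_mask:
  assumes "mask x0 = 0 \<Longrightarrow> oddreal (2 * (2 ^ \<tau> * of_int l1 * x0)) \<and> oddreal (2 * (2 ^ \<tau> * of_int l2 * x0))"
  shows "\<exists>c>0. eventually (\<lambda>x. cmod (mask x) \<ge> c * cmod (half_mask x)) (nhds x0)"
proof (cases "mask x0 = 0")
  case False
  have "isCont mask x0"
    using continuous_mask[OF continuous_on_id, of UNIV] by (simp add: continuous_on_eq_continuous_at)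
  from eventually_half_norm[OF this False]
  have "eventually (\<lambda>x. cmod (mask x) \<ge> (cmod (mask x0) / 2) * cmod (half_mask x)) (nhds x0)"
  proof eventually_elim
    case (elim x)
    have "(cmod (mask x0) / 2) * cmod (half_mask x) \<le> (cmod (mask x0) / 2) * 1"
      by (intro mult_left_mono norm_half_mask_le_1) auto
    with elim show ?case by simp
  qed
  then show ?thesis using False by (intro exI[of _ "cmod (mask x0) / 2"]) auto
next
  case True
  have 1: "ee (2 ^ \<tau> * of_int l1 * x0) = -1" "ee (2 ^ \<tau> * of_int l2 * x0) = -1"
    using assms[OF True] by (simp_all add: ee_eq_minus_1)
  have 2: "ee ((of_int a + 2 ^ \<tau> * of_int l2) * x0) = - ee (of_int a * x0)"
    using 1(2) by (simp add: distrib_right ee_add)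
  define c :: complex where "c = 2 * of_real pi * \<i>"
  define D where "D = (0 + (c * of_real (of_int a)) * ee (of_int a * x0) +
      (c * of_real (2 ^ \<tau> * of_int l1)) * ee (2 ^ \<tau> * of_int l1 * x0) +
      (c * of_real (of_int a + 2 ^ \<tau> * of_int l2)) * ee ((of_int a + 2 ^ \<tau> * of_int l2) * x0)) / 4"
  have D: "(mask has_vector_derivative D) (at x0)"
    unfolding mask_def[abs_def] D_def c_def
    by (intro has_vector_derivative_divide has_vector_derivative_add
        has_vector_derivative_const ee_has_vector_derivative)
  have "(half_mask has_vector_derivative (0 + (c * of_real (2 ^ \<tau> * of_int l1)) * ee (2 ^ \<tau> * of_int l1 * x0)) / 2) (at x0)"
    unfolding half_mask_def[abs_def] c_def
    by (intro has_vector_derivative_divide has_vector_derivative_add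
        has_vector_derivative_const ee_has_vector_derivative)
  \<comment> \<open>D is a nonzero multiple of \<open>l1 + l2 * ee (a * x0)\<close>. If this
    vanished, \<open>ee (a * x0)\<close> would be 1 or -1 and \<open>2 * a * x0\<close> an integer
    n; then \<open>a * q = 2 ^ \<tau> * l1 * n\<close> would be both odd and even.\<close>
  moreover have "D \<noteq> 0"
  proof
    assume "D = 0"
    moreover have "D = - (c * 2 ^ \<tau> / 4) * (of_int l1 + of_int l2 * ee (of_int a * x0))"
      unfolding D_def 1 2 by (simp add: algebra_simps)
    ultimately have eq: "of_int l1 = - (of_int l2 * ee (of_int a * x0))"
      by (simp add: c_def eq_neg_iff_add_eq_0)
    then have "cmod (of_int l1) = cmod (of_int l2 * ee (of_int a * x0))" by simp
    then have "\<bar>l1\<bar> = \<bar>l2\<bar>" by (simp add: norm_mult)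
    then have "ee (of_int a * x0) = 1 \<or> ee (of_int a * x0) = -1"
    proof (cases "l1 = l2")
      case True
      then have "of_int l2 * (ee (of_int a * x0) + 1) = 0"
        using eq by (simp add: distrib_left eq_neg_iff_add_eq_0 add.commute)
      then show ?thesis using odds by (auto simp: eq_neg_iff_add_eq_0)
    next
      case False
      then have "l1 = - l2" using \<open>\<bar>l1\<bar> = \<bar>l2\<bar>\<close> by (auto simp: abs_eq_iff)
      then have "of_int l2 * (ee (of_int a * x0) - 1) = 0"
        using eq by (simp add: right_diff_distrib)
      then show ?thesis using odds by auto
    qed
    then have "ee (of_int a * x0 + of_int a * x0) = 1"
      unfolding ee_add by (elim disjE) simp_all
    then obtain n :: int where n: "of_int a * x0 + of_int a * x0 = of_int n"
      by (auto simp: ee_eq_1_iff Ints_def)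
    obtain q :: int where q: "odd q" "2 * (2 ^ \<tau> * of_int l1 * x0) = of_int q"
      using assms[OF True] by (auto simp: oddreal_def)
    have "real_of_int (a * q) = 2 ^ \<tau> * of_int l1 * (of_int a * x0 + of_int a * x0)"
      using q(2) by (simp add: algebra_simps)
    also have "\<dots> = real_of_int (2 ^ \<tau> * l1 * n)" unfolding n by simp
    finally have "a * q = 2 ^ \<tau> * l1 * n" by (simp only: of_int_eq_iff)
    moreover have "odd (a * q)" using q odds by simp
    ultimately show False using \<tau>_pos by simp
  qed
  moreover have "half_mask x0 = 0" using 1 by (simp add: half_mask_def)
  ultimately show ?thesis
    using comparable_near_common_zero[OF D _ True] by blast
qed

lemma N_power_real: "real_of_int N ^ j = 2 ^ (\<beta> * j) * real_of_int m ^ j"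
  by (simp add: N_eq power_mult_distrib power_mult)

lemma N_power_int: "N ^ j = 2 ^ (\<beta> * j) * m ^ j"
  by (simp add: N_eq power_mult_distrib power_mult)

text \<open>Since r > 0, \<tau> exceeds \<open>\<beta> * j\<close> for j \<le> k. The surplus
  factors 2 and 4 are parity margins: adding \<open>m ^ k / 2\<close>, or an integer multiple of
  \<open>m ^ k\<close>, does not disturb a zero of the second kind on these levels.\<close>

lemma level_power:
  assumes "j \<le> k"
  obtains w where "2 ^ \<tau> * m ^ k = N ^ j * (2 * w)" "2 ^ (\<tau> + 1) * m ^ k = N ^ j * (4 * w)"
proof -
  have "\<beta> * j \<le> \<beta> * k" using assms by simp
  then have "\<tau> = \<beta> * j + Suc (\<tau> - \<beta> * j - 1)" using \<tau>_eq r by linarith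
  then have "(2::int) ^ \<tau> = 2 ^ (\<beta> * j) * 2 ^ Suc (\<tau> - \<beta> * j - 1)" by (metis power_add)
  moreover have "m ^ k = m ^ j * m ^ (k - j)" using assms by (simp add: power_add[symmetric])
  ultimately have *: "2 ^ \<tau> * m ^ k = N ^ j * (2 * (2 ^ (\<tau> - \<beta> * j - 1) * m ^ (k - j)))"
    unfolding N_power_int by (simp add: mult_ac)
  have "2 ^ (\<tau> + 1) * m ^ k = 2 * (2 ^ \<tau> * m ^ k)" by simp
  also have "\<dots> = N ^ j * (4 * (2 ^ (\<tau> - \<beta> * j - 1) * m ^ (k - j)))" unfolding * by simp
  finally show ?thesis by (rule that[OF *])
qed

section \<open>Nonvanishing of the transform at suitable integer shifts\<close>

lemma ft_zero_form:
  assumes "ft \<mu> y = 0"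
  shows "(\<exists>j\<ge>1. oddreal (2 * of_int G * (y / of_int N ^ j))) \<or>
    (\<exists>j\<ge>1. oddreal (2 ^ (\<tau> + 1) * of_int G * (y / of_int N ^ j)))"
proof -
  obtain j where j: "j \<ge> 1" "mask (y / of_int N ^ j) = 0"
    using ft_zeroD[OF assms] by blast
  show ?thesis
  proof (cases "oddreal (2 * of_int G * (y / of_int N ^ j))")
    case False
    with mask_zero[OF j(2)] have "oddreal (2 * (2 ^ \<tau> * of_int l1 * (y / of_int N ^ j)))" by blast
    from oddreal_G[OF this] show ?thesis using j(1) by blast
  qed (use j in auto)
qed

lemma ft_zero_int:
  assumes "ft \<mu> (of_int W / of_int G) = 0"
  shows "(\<exists>j\<ge>1. \<exists>v. odd v \<and> 2 * W = N ^ j * v) \<or>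
    (\<exists>j>k. \<exists>v. odd v \<and> 2 ^ (\<tau> + 1) * W = N ^ j * v)"
proof -
  have *: "\<exists>v. odd v \<and> c * W = N ^ j * v"
    if "oddreal (of_int c * of_int G * (of_int W / of_int G / of_int N ^ j))" for c j
  proof -
    have "of_int c * of_int G * (of_int W / of_int G / of_int N ^ j) = of_int c * of_int W / real_of_int N ^ j"
      using G_nonzero by simp
    with that obtain v where v: "odd v" "of_int c * of_int W / real_of_int N ^ j = of_int v"
      by (auto simp: oddreal_def)
    then have "real_of_int (c * W) = real_of_int (N ^ j * v)"
      using N_real_gt by (simp add: field_simps)
    then have "c * W = N ^ j * v" by (simp only: of_int_eq_iff)
    with v(1) show ?thesis by blast
  qed
  from ft_zero_form[OF assms] show ?thesis
  proof (elim disjE exE conjE)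
    fix j assume "j \<ge> 1" "oddreal (2 * of_int G * (of_int W / of_int G / of_int N ^ j))"
    then show ?thesis using *[of 2 j] by auto
  next
    fix j assume j: "j \<ge> 1" "oddreal (2 ^ (\<tau> + 1) * of_int G * (of_int W / of_int G / of_int N ^ j))"
    then obtain v where v: "odd v" "2 ^ (\<tau> + 1) * W = N ^ j * v"
      using *[of "2 ^ (\<tau> + 1)" j] by auto
    \<comment> \<open>For j \<le> k the left side is divisible by \<open>2 ^ (\<tau> + 1)\<close>,
      the right side by no power of 2 beyond \<open>2 ^ (\<beta> * j)\<close>.\<close>
    have "j > k"
    proof (rule ccontr)
      assume "\<not> j > k"
      then have "\<beta> * j \<le> \<beta> * k" by simp
      then have "\<tau> + 1 = \<beta> * j + Suc (\<tau> - \<beta> * j)" using \<tau>_eq by linarith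
      then have "(2::int) ^ (\<tau> + 1) = 2 ^ (\<beta> * j) * 2 ^ Suc (\<tau> - \<beta> * j)"
        by (metis power_add)
      with v(2) have "2 ^ (\<beta> * j) * (2 ^ Suc (\<tau> - \<beta> * j) * W) = 2 ^ (\<beta> * j) * (m ^ j * v)"
        unfolding N_power_int by (simp only: mult.assoc)
      then have "2 ^ Suc (\<tau> - \<beta> * j) * W = m ^ j * v"
        by (subst (asm) mult_left_cancel) auto
      moreover have "odd (m ^ j * v)" using v odds by simp
      ultimately show False by (metis dvd_triv_left even_mult_iff power_Suc)
    qed
    then show ?thesis using v by blast
  qed
qed

text \<open>As q is odd, \<open>n + q * z\<close> can be given any exact 2-adic valuation u. A zero
  forces u + 1 or u + 1 + r to be a multiple of \<beta>, and the odd part to be divisible by a power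
  of m. For m = 1 a valuation avoiding both residues is chosen; for m > 1 the odd part is
  spoiled.\<close>

lemma exists_shift_nonzero:
  fixes q n :: int
  assumes q: "odd q"
  shows "\<exists>z. n + q * z \<noteq> 0 \<and> ft \<mu> (of_int (n + q * z) / of_int G) \<noteq> 0"
proof -
  have solve: "\<exists>z t. n + q * z = 2 ^ u * (1 + 2 * t)" for u
  proof -
    have "coprime q (2 ^ Suc u)" using q by simp
    then obtain x where x: "[q * x = 1] (mod 2 ^ Suc u)"
      using cong_solve_coprime_int by blast
    then obtain y where y: "q * x = 1 + 2 ^ Suc u * y"
      by (metis cong_iff_lin cong_sym)
    have "n + q * (x * (2 ^ u - n)) = n + (q * x) * (2 ^ u - n)" by simp
    also have "\<dots> = 2 ^ u * (1 + 2 * (y * (2 ^ u - n)))"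
      unfolding y by (simp add: algebra_simps)
    finally show ?thesis by blast
  qed
  show ?thesis
  proof (cases "m = 1")
    case True
    \<comment> \<open>For \<beta> = 2 one would have r = 1, and each valuation would meet one of the
      two residues.\<close>
    have \<beta>3: "\<beta> \<ge> 3"
    proof (rule ccontr)
      assume "\<not> \<beta> \<ge> 3"
      then have "(2::int) ^ \<beta> \<le> 2 ^ 2" by (intro power_increasing) auto
      then show False using N_gt N_eq True by simp
    qed
    \<comment> \<open>The valuation 0 fails only if r + 1 = \<beta>. In that case u = 1 gives the
      numbers u + 1 = 2 and r + 1 + u = \<beta> + 1, neither of which is a multiple of \<beta> \<ge>
      3.\<close>
    define u where "u = (if r = \<beta> - 1 then 1 else 0 :: nat)"
    obtain z t where z: "n + q * z = 2 ^ u * (1 + 2 * t)" using solve by blast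
    have "ft \<mu> (of_int (n + q * z) / of_int G) \<noteq> 0"
    proof
      assume "ft \<mu> (of_int (n + q * z) / of_int G) = 0"
      from ft_zero_int[OF this] show False
      proof (elim disjE exE conjE)
        fix j :: nat and v :: int assume j: "1 \<le> j" "odd v" "2 * (n + q * z) = N ^ j * v"
        have "2 ^ Suc u * (1 + 2 * t) = 2 ^ (\<beta> * j) * v"
          using j(3) z True by (simp add: N_power_int)
        from two_power_odd_unique(1)[OF this _ j(2)] have "Suc u = \<beta> * j" by simp
        moreover have "\<beta> * j \<ge> \<beta>" using j(1) by simp
        moreover have "u \<le> 1" by (simp add: u_def)
        ultimately show False using \<beta>3 by linarith
      next
        fix j :: nat and v :: int assume j: "k < j" "odd v" "2 ^ (\<tau> + 1) * (n + q * z) = N ^ j * v"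
        obtain i where i: "j = k + Suc i" using j(1) less_imp_Suc_add by auto
        have "2 ^ (\<tau> + 1 + u) * (1 + 2 * t) = 2 ^ (\<beta> * j) * v"
          using j(3) z True by (simp add: N_power_int power_add)
        from two_power_odd_unique(1)[OF this _ j(2)] have "\<tau> + 1 + u = \<beta> * j" by simp
        then have e: "r + 1 + u = \<beta> + \<beta> * i" by (simp add: \<tau>_eq i algebra_simps)
        have u1: "u \<le> 1" "u = 1 \<longleftrightarrow> r = \<beta> - 1" by (auto simp: u_def)
        show False
        proof (cases i)
          case 0
          then have "r + 1 + u = \<beta>" using e by simp
          then show ?thesis using u1 by linarith
        next
          case (Suc i')
          then have "\<beta> * i \<ge> \<beta>" by simp
          then show ?thesis using e r u1 \<beta>3 by linarith
        qed
      qed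
    qed
    moreover have "n + q * z \<noteq> 0"
      using z by (simp, presburger)
    ultimately show ?thesis by blast
  next
    case False
    then have m3: "m \<ge> 2" using m_pos by simp
    define J where "J = Suc (nat \<bar>q\<bar>)"
    have mJ: "m ^ J > \<bar>q\<bar>"
    proof -
      have "int J < 2 ^ J" by (metis of_nat_less_two_power)
      also have "(2::int) ^ J \<le> m ^ J" using m3 by (intro power_mono) auto
      finally show ?thesis by (simp add: J_def)
    qed
    \<comment> \<open>This valuation excludes the second kind, as \<beta> does not divide r, and
      leaves J as the only possible level of the first kind.\<close>
    define u where "u = \<beta> * J - 1"
    have u: "Suc u = \<beta> * J" using r by (simp add: u_def J_def)
    obtain z0 t0 where z0: "n + q * z0 = 2 ^ u * (1 + 2 * t0)" using solve by blast
    have "\<exists>z t. n + q * z = 2 ^ u * (1 + 2 * t) \<and> \<not> m ^ J dvd (1 + 2 * t)"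
    \<comment> \<open>If the odd part happens to be divisible, a further step
      \<open>2 ^ Suc u\<close> in z changes it by \<open>2 * q\<close>, which is not divisible by
      \<open>m ^ J\<close> > |q|.\<close>
    proof (cases "m ^ J dvd (1 + 2 * t0)")
      case True
      have "n + q * (z0 + 2 ^ Suc u) = 2 ^ u * (1 + 2 * (t0 + q))"
        using z0 by (simp add: algebra_simps)
      moreover have "\<not> m ^ J dvd (1 + 2 * (t0 + q))"
      proof
        assume "m ^ J dvd (1 + 2 * (t0 + q))"
        then have "m ^ J dvd (1 + 2 * (t0 + q)) - (1 + 2 * t0)" using True by (rule dvd_diff)
        then have "m ^ J dvd 2 * q" by (simp add: algebra_simps)
        moreover have "coprime (m ^ J) 2" using odds by simp
        ultimately have "m ^ J dvd q" by (simp add: coprime_dvd_mult_right_iff)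
        moreover have "q \<noteq> 0" using q by auto
        ultimately have "\<bar>m ^ J\<bar> \<le> \<bar>q\<bar>" by (rule dvd_imp_le_int[rotated])
        then show False using mJ by simp
      qed
      ultimately show ?thesis by blast
    qed (use z0 in blast)
    then obtain z t where z: "n + q * z = 2 ^ u * (1 + 2 * t)" and t: "\<not> m ^ J dvd (1 + 2 * t)"
      by blast
    have "ft \<mu> (of_int (n + q * z) / of_int G) \<noteq> 0"
    proof
      assume "ft \<mu> (of_int (n + q * z) / of_int G) = 0"
      from ft_zero_int[OF this] show False
      proof (elim disjE exE conjE)
        fix j :: nat and v :: int assume j: "1 \<le> j" "odd v" "2 * (n + q * z) = N ^ j * v"
        have e: "2 ^ Suc u * (1 + 2 * t) = 2 ^ (\<beta> * j) * (m ^ j * v)"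
          using j(3) z by (simp add: N_power_int)
        have o: "odd (m ^ j * v)" using j(2) odds by simp
        have "Suc u = \<beta> * j" "1 + 2 * t = m ^ j * v"
          using two_power_odd_unique[OF e _ o] by auto
        moreover from this have "j = J" using u r by auto
        ultimately show False using t by simp
      next
        fix j :: nat and v :: int assume j: "k < j" "odd v" "2 ^ (\<tau> + 1) * (n + q * z) = N ^ j * v"
        have e: "2 ^ (\<tau> + Suc u) * (1 + 2 * t) = 2 ^ (\<beta> * j) * (m ^ j * v)"
          using j(3) z by (simp add: N_power_int power_add)
        have o: "odd (m ^ j * v)" using j(2) odds by simp
        have "\<tau> + Suc u = \<beta> * j" using two_power_odd_unique(1)[OF e _ o] by auto
        then have "\<beta> * (k + J) + r = \<beta> * j" unfolding u \<tau>_eq by (simp add: algebra_simps)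
        then have "\<beta> dvd r" by (metis dvd_add_right_iff dvd_triv_left)
        then show False using r by (simp add: nat_dvd_not_less)
      qed
    qed
    moreover have "n + q * z \<noteq> 0" using z t by auto
    ultimately show ?thesis by blast
  qed
qed

definition half_mask_prod :: "real \<Rightarrow> real" where
  "half_mask_prod y = (\<Prod>j=1..k. cmod (half_mask (y / of_int N ^ j)))"

lemma half_mask_prod_bounds: "0 \<le> half_mask_prod y" "half_mask_prod y \<le> 1"
  by (auto simp: half_mask_prod_def norm_half_mask_le_1 intro!: prod_nonneg prod_le_1)

lemma ft_ge_half_mask_prod_if_nonzero:
  assumes "ft \<mu> y0 \<noteq> 0"
  shows "\<exists>c>0. eventually (\<lambda>y. cmod (ft \<mu> y) \<ge> c * half_mask_prod y) (nhds y0)"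
proof -
  have "eventually (\<lambda>y. cmod (ft \<mu> y) \<ge> (cmod (ft \<mu> y0) / 2) * half_mask_prod y) (nhds y0)"
    using eventually_half_norm[OF isCont_ft assms]
  proof eventually_elim
    case (elim y)
    have "(cmod (ft \<mu> y0) / 2) * half_mask_prod y \<le> (cmod (ft \<mu> y0) / 2) * 1"
      by (intro mult_left_mono half_mask_prod_bounds) auto
    with elim show ?case by simp
  qed
  with assms show ?thesis by (intro exI[of _ "cmod (ft \<mu> y0) / 2"]) auto
qed

text \<open>A zero of the transform outside \<open>\<int> / G\<close> comes from the factors \<open>mask (y / N ^ j)\<close> with
  \<open>j \<le> k\<close> only, and there it is compensated by a zero of \<open>half_mask (y / N ^ j)\<close>.\<close>

lemma ft_ge_half_mask_prod_if_not_int: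
  assumes "of_int G * y0 \<notin> \<int>"
  shows "\<exists>c>0. eventually (\<lambda>y. cmod (ft \<mu> y) \<ge> c * half_mask_prod y) (nhds y0)"
proof -
  have type2: "j \<le> k \<and> oddreal (2 * (2 ^ \<tau> * of_int l1 * (y0 / of_int N ^ j))) \<and>
      oddreal (2 * (2 ^ \<tau> * of_int l2 * (y0 / of_int N ^ j)))"
    if j: "j \<ge> 1" and z: "mask (y0 / of_int N ^ j) = 0" for j
  proof -
    have np: "real_of_int N ^ j \<noteq> 0" using N_real_gt by simp
    have "\<not> oddreal (2 * of_int G * (y0 / of_int N ^ j))"
    proof
      assume "oddreal (2 * of_int G * (y0 / of_int N ^ j))"
      then obtain v where "2 * of_int G * (y0 / of_int N ^ j) = of_int v" by (auto simp: oddreal_def)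
      then have "2 * (of_int G * y0) = of_int N ^ j * of_int v" using np by (simp add: field_simps)
      moreover have "even (N ^ j)" using N_eq r j by simp
      then obtain N' where "N ^ j = 2 * N'" by (elim evenE)
      then have "real_of_int N ^ j = 2 * of_int N'" by (metis of_int_mult of_int_numeral of_int_power)
      ultimately have "of_int G * y0 = of_int (N' * v)" by simp
      then show False using assms by (metis Ints_of_int)
    qed
    with mask_zero[OF z] have o: "oddreal (2 * (2 ^ \<tau> * of_int l1 * (y0 / of_int N ^ j)))"
      "oddreal (2 * (2 ^ \<tau> * of_int l2 * (y0 / of_int N ^ j)))" by auto
    have "j \<le> k"
    proof (rule ccontr)
      assume "\<not> j \<le> k"
      then have "\<beta> * Suc k \<le> \<beta> * j" by (intro mult_le_mono) auto
      then have le: "\<tau> + 1 \<le> \<beta> * j" using r \<tau>_eq by simp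
      obtain v where "2 * (2 ^ \<tau> * of_int l1 * (y0 / of_int N ^ j)) = of_int v"
        using o by (auto simp: oddreal_def)
      then have "2 ^ (\<tau> + 1) * (of_int l1 * y0) = of_int N ^ j * of_int v"
        using np by (simp add: field_simps)
      also have "\<dots> = 2 ^ (\<tau> + 1) * (2 ^ (\<beta> * j - (\<tau> + 1)) * of_int m ^ j * of_int v)"
      proof -
        have "\<beta> * j = (\<tau> + 1) + (\<beta> * j - (\<tau> + 1))" using le by simp
        then have "(2::real) ^ (\<beta> * j) = 2 ^ (\<tau> + 1) * 2 ^ (\<beta> * j - (\<tau> + 1))"
          by (metis power_add)
        then show ?thesis unfolding N_power_real by (simp only: mult.assoc)
      qed
      finally have "of_int l1 * y0 = of_int (2 ^ (\<beta> * j - (\<tau> + 1)) * m ^ j * v)" by simp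
      then have "of_int (a * (a + 2 ^ \<tau> * l2)) * (of_int l1 * y0) \<in> \<int>"
        by (metis Ints_mult Ints_of_int)
      then show False using assms by (simp add: G_def mult_ac)
    qed
    with o show ?thesis by blast
  qed
  have "\<exists>c>0. eventually (\<lambda>y. cmod (mask (y / of_int N ^ j)) \<ge> c * cmod (half_mask (y / of_int N ^ j))) (nhds y0)"
    if "j \<in> {1..k}" for j
  proof -
    have j1: "j \<ge> 1" using that by simp
    obtain c where c: "c > 0" "eventually (\<lambda>x. cmod (mask x) \<ge> c * cmod (half_mask x)) (nhds (y0 / of_int N ^ j))"
      using mask_ge_half_mask[OF conjunct2[OF type2[OF j1]]] by blast
    have "isCont (\<lambda>y. y / real_of_int N ^ j) y0" using N_real_gt by (intro continuous_intros) auto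
    then have "filterlim (\<lambda>y. y / real_of_int N ^ j) (nhds (y0 / of_int N ^ j)) (nhds y0)"
      using tendsto_at_iff_tendsto_nhds[of "\<lambda>y. y / real_of_int N ^ j" y0] by (simp add: isCont_def)
    from eventually_compose_filterlim[OF c(2) this] c(1) show ?thesis by blast
  qed
  then have "\<exists>c>0. eventually (\<lambda>y. (\<Prod>j=1..k. cmod (mask (y / of_int N ^ j))) \<ge>
      c * (\<Prod>j=1..k. cmod (half_mask (y / of_int N ^ j)))) (nhds y0)"
    by (intro eventually_prod_ge) auto
  then obtain c where c: "c > 0" "eventually (\<lambda>y. (\<Prod>j=1..k. cmod (mask (y / of_int N ^ j))) \<ge>
      c * half_mask_prod y) (nhds y0)"
    by (auto simp: half_mask_prod_def)
  have "ft \<mu> (y0 / of_int N ^ k) \<noteq> 0"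
  proof
    assume "ft \<mu> (y0 / of_int N ^ k) = 0"
    then obtain j where "j \<ge> 1" "mask (y0 / of_int N ^ k / of_int N ^ j) = 0" by (rule ft_zeroD)
    then show False using type2[of "k + j"] by (simp add: power_add)
  qed
  define e where "e = cmod (ft \<mu> (y0 / of_int N ^ k)) / 2"
  have e: "e > 0" using \<open>ft \<mu> (y0 / of_int N ^ k) \<noteq> 0\<close> by (simp add: e_def)
  have "isCont (\<lambda>y. ft \<mu> (y / of_int N ^ k)) y0"
    using N_real_gt by (intro isCont_o2[OF _ isCont_ft] continuous_intros) auto
  from eventually_half_norm[OF this] \<open>ft \<mu> (y0 / of_int N ^ k) \<noteq> 0\<close>
  have "eventually (\<lambda>y. cmod (ft \<mu> (y / of_int N ^ k)) \<ge> e) (nhds y0)"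
    by (simp add: e_def)
  with c(2) have "eventually (\<lambda>y. cmod (ft \<mu> y) \<ge> (c * e) * half_mask_prod y) (nhds y0)"
  proof eventually_elim
    case (elim y)
    have "(c * half_mask_prod y) * e \<le> (\<Prod>j=1..k. cmod (mask (y / of_int N ^ j))) * cmod (ft \<mu> (y / of_int N ^ k))"
      using elim c(1) e half_mask_prod_bounds(1)[of y] by (intro mult_mono prod_nonneg) auto
    also have "\<dots> = cmod (ft \<mu> y)"
      by (subst ft_prod[of y k]) (simp add: norm_mult prod_norm)
    finally show ?case by (simp add: mult_ac)
  qed
  then show ?thesis using c(1) e by (intro exI[of _ "c * e"]) auto
qed

section \<open>Uniform and arbitrarily large shifts\<close>

text \<open>A whole ball is required because the points are later perturbed by the frequency \<xi>
  and by the low digits, both divided by a power of N.\<close>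

definition good :: "real \<Rightarrow> real \<Rightarrow> real \<Rightarrow> bool" where
  "good c \<delta> y \<longleftrightarrow> (\<forall>\<eta>. \<bar>\<eta>\<bar> \<le> \<delta> \<longrightarrow> c * half_mask_prod (y + \<eta>) \<le> cmod (ft \<mu> (y + \<eta>)))"

lemma goodI_eventually:
  assumes "eventually (\<lambda>y. cmod (ft \<mu> y) \<ge> c * half_mask_prod y) (nhds y0)"
  shows "\<exists>\<delta>>0. good c \<delta> y0"
proof -
  obtain d where d: "d > 0" "\<And>y. \<bar>y - y0\<bar> < d \<Longrightarrow> cmod (ft \<mu> y) \<ge> c * half_mask_prod y"
    using assms unfolding eventually_nhds_metric dist_real_def by blast
  then show ?thesis
    by (intro exI[of _ "d / 2"]) (auto simp: good_def)
qed

text \<open>If \<open>G * p * m ^ k * x\<close> is an integer n, the shifted points are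
  \<open>(n + q * z) / G\<close> with the odd number q = \<open>G * p * m ^ k\<close>, and one of
  them is no zero of \<open>ft\<close>. Otherwise z = 0 works relative to
  \<open>half_mask_prod\<close>.\<close>

lemma exists_good_shift:
  assumes "odd p"
  shows "\<exists>z::int. \<exists>c>0. \<exists>\<delta>>0. good c \<delta> (of_int p * of_int m ^ k * (x + of_int z))"
proof (cases "of_int G * (of_int p * of_int m ^ k * x) \<in> \<int>")
  case True
  then obtain n where n: "of_int G * (of_int p * of_int m ^ k * x) = of_int n" by (auto simp: Ints_def)
  have "odd (G * p * m ^ k)" using odd_G assms odds by simp
  then obtain z where z: "ft \<mu> (of_int (n + G * p * m ^ k * z) / of_int G) \<noteq> 0"
    using exists_shift_nonzero by blast
  have "of_int (n + G * p * m ^ k * z) / of_int G = of_int p * of_int m ^ k * (x + of_int z)"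
    using G_nonzero n[symmetric] by (simp add: field_simps)
  with z have "ft \<mu> (of_int p * of_int m ^ k * (x + of_int z)) \<noteq> 0" by simp
  from ft_ge_half_mask_prod_if_nonzero[OF this] obtain c where
    "c > 0" and "eventually (\<lambda>y. cmod (ft \<mu> y) \<ge> c * half_mask_prod y) (nhds (of_int p * of_int m ^ k * (x + of_int z)))"
    by blast
  with goodI_eventually[OF this(2)] show ?thesis by blast
next
  case False
  from ft_ge_half_mask_prod_if_not_int[OF False] obtain c where
    "c > 0" and "eventually (\<lambda>y. cmod (ft \<mu> y) \<ge> c * half_mask_prod y) (nhds (of_int p * of_int m ^ k * x))"
    by blast
  with goodI_eventually[OF this(2)] have "\<exists>c>0. \<exists>\<delta>>0. good c \<delta> (of_int p * of_int m ^ k * (x + of_int 0))"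
    by auto
  then show ?thesis by blast
qed

text \<open>Only the fractional part of x matters, since z is free, and finitely many balls cover
  [0, 1].\<close>

lemma exists_good_shift_uniform:
  assumes "odd p"
  shows "\<exists>c>0. \<exists>\<delta>>0. \<forall>x. \<exists>z::int. good c \<delta> (of_int p * of_int m ^ k * (x + of_int z))"
proof -
  define A where "A = of_int p * real_of_int m ^ k"
  have A: "\<bar>A\<bar> > 0" using assms m_pos by (auto simp: A_def)
  obtain z c d where zcd: "\<And>x. c x > 0" "\<And>x. d x > 0" "\<And>x. good (c x) (d x) (A * (x + of_int (z x)))"
    using exists_good_shift[OF assms] unfolding A_def by metis
  have "compact {0..1::real}" by simp
  \<comment> \<open>With this radius, multiplication by A uses up half of \<open>d x\<close>; the
    other half is left for \<eta>.\<close>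
  then obtain X where X: "X \<subseteq> {0..1}" "finite X" "{0..1} \<subseteq> (\<Union>x\<in>X. ball x (d x / (2 * \<bar>A\<bar>)))"
  proof (rule compactE_image)
    show "open (ball x (d x / (2 * \<bar>A\<bar>)))" for x by simp
    have "x \<in> ball x (d x / (2 * \<bar>A\<bar>))" for x using zcd(2) A by simp
    then show "{0..1} \<subseteq> (\<Union>x\<in>{0..1}. ball x (d x / (2 * \<bar>A\<bar>)))" by blast
  qed
  have Xne: "X \<noteq> {}" using X(3) by force
  define c0 where "c0 = Min (c ` X)"
  define d0 where "d0 = Min (d ` X) / 2"
  have c0: "c0 > 0" "\<And>x. x \<in> X \<Longrightarrow> c0 \<le> c x" using X(2) Xne zcd by (auto simp: c0_def)
  have d0: "d0 > 0" "\<And>x. x \<in> X \<Longrightarrow> d0 \<le> d x / 2" using X(2) Xne zcd by (auto simp: d0_def)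
  have "\<exists>z::int. good c0 d0 (A * (x + of_int z))" for x
  proof -
    have "frac x \<in> {0..1}" using frac_ge_0[of x] frac_lt_1[of x] by simp
    with X(3) obtain x' where x': "x' \<in> X" "frac x \<in> ball x' (d x' / (2 * \<bar>A\<bar>))" by blast
    then have x'd: "dist x' (frac x) < d x' / (2 * \<bar>A\<bar>)" by simp
    have "good c0 d0 (A * (x + of_int (z x' - \<lfloor>x\<rfloor>)))"
      unfolding good_def
    proof (intro allI impI)
      fix \<eta> :: real assume \<eta>: "\<bar>\<eta>\<bar> \<le> d0"
      define y where "y = A * (x + of_int (z x' - \<lfloor>x\<rfloor>)) + \<eta>"
      define \<eta>' where "\<eta>' = A * (frac x - x') + \<eta>"
      have y: "y = A * (x' + of_int (z x')) + \<eta>'"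
        by (simp add: y_def \<eta>'_def frac_def algebra_simps)
      have "\<bar>A * (frac x - x')\<bar> \<le> d x' / 2"
        using x'd A unfolding abs_mult by (simp add: dist_real_def field_simps abs_minus_commute)
      then have "\<bar>\<eta>'\<bar> \<le> d x'" using \<eta> d0(2)[OF x'(1)] unfolding \<eta>'_def by linarith
      then have "c x' * half_mask_prod y \<le> cmod (ft \<mu> y)" using zcd(3)[of x'] unfolding y good_def by blast
      moreover have "c0 * half_mask_prod y \<le> c x' * half_mask_prod y"
        using c0(2)[OF x'(1)] half_mask_prod_bounds by (intro mult_right_mono)
      ultimately show "c0 * half_mask_prod y \<le> cmod (ft \<mu> y)" by linarith
    qed
    then show ?thesis by blast
  qed
  with c0 d0 show ?thesis unfolding A_def by blast
qed

text \<open>Adding \<open>N ^ h * z2\<close> with large h changes neither the first h masks nor the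
  half masks, by periodicity, while \<open>y / N ^ h\<close> comes close to \<open>A * z2\<close>,
  where \<open>ft\<close> does not vanish. The price is one factor c2, independent of x and
  B.\<close>

lemma exists_large_good_shift:
  assumes "odd p"
  shows "\<exists>c>0. \<exists>\<delta>>0. \<forall>x B. \<exists>Z::int. Z > B \<and> good c \<delta> (of_int p * of_int m ^ k * (x + of_int Z))"
proof -
  define A where "A = of_int p * real_of_int m ^ k"
  obtain c1 d1 where c1: "c1 > 0" "d1 > 0" "\<And>x. \<exists>z::int. good c1 d1 (A * (x + of_int z))"
    using exists_good_shift_uniform[OF assms] unfolding A_def by blast
  have "odd (G * p * m ^ k)" using odd_G assms odds by simp
  then obtain z0 where z0: "0 + G * p * m ^ k * z0 \<noteq> 0" "ft \<mu> (of_int (0 + G * p * m ^ k * z0) / of_int G) \<noteq> 0"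
    using exists_shift_nonzero by blast
  have eqz: "of_int (0 + G * p * m ^ k * z0) / of_int G = A * of_int z0"
    using G_nonzero by (simp add: A_def)
  have z0': "ft \<mu> (A * of_int z0) \<noteq> 0" "z0 \<noteq> 0" using z0(2)[unfolded eqz] z0(1) by auto
  define z2 where "z2 = \<bar>z0\<bar>"
  have z2: "ft \<mu> (A * of_int z2) \<noteq> 0" "z2 > 0"
    using z0' ft_minus[of "A * of_int z0"] by (auto simp: z2_def abs_if)
  obtain d2 where d2: "d2 > 0"
    "\<And>y. \<bar>y - A * of_int z2\<bar> < d2 \<Longrightarrow> cmod (ft \<mu> y) \<ge> cmod (ft \<mu> (A * of_int z2)) / 2"
    using eventually_half_norm[OF isCont_ft z2(1)] unfolding eventually_nhds_metric dist_real_def by blast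
  define c2 where "c2 = cmod (ft \<mu> (A * of_int z2)) / 2"
  have c2: "c2 > 0" using z2 by (simp add: c2_def)
  have "\<exists>Z::int. Z > B \<and> good (c1 * c2) d1 (A * (x + of_int Z))" for x B
  proof -
    obtain z where z: "good c1 d1 (A * (x + of_int z))" using c1(3) by blast
    define Y where "Y = \<bar>A * (x + of_int z)\<bar> + d1"
    have Npow: "eventually (\<lambda>h. real_of_int N ^ h > b) sequentially" for b
      using N_real_gt by real_asymp
    have "eventually (\<lambda>h. h \<ge> k \<and> real_of_int N ^ h > Y / d2 \<and> real_of_int N ^ h > of_int (\<bar>B\<bar> + \<bar>z\<bar>)) sequentially"
      by (intro eventually_conj Npow eventually_ge_at_top)
    from eventually_happens'[OF sequentially_bot this]
    obtain h where h: "h \<ge> k" "real_of_int N ^ h > Y / d2" "real_of_int N ^ h > of_int (\<bar>B\<bar> + \<bar>z\<bar>)"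
      by blast
    define Z where "Z = z + N ^ h * z2"
    have "N ^ h > \<bar>B\<bar> + \<bar>z\<bar>" using h(3) by (metis of_int_less_iff of_int_power)
    moreover have "N ^ h * z2 \<ge> N ^ h * 1" using z2(2) N_gt by (intro mult_left_mono) auto
    ultimately have "Z > B" by (simp add: Z_def)
    moreover have "good (c1 * c2) d1 (A * (x + of_int Z))"
      unfolding good_def
    proof (intro allI impI)
      fix \<eta> :: real assume \<eta>: "\<bar>\<eta>\<bar> \<le> d1"
      define y' where "y' = A * (x + of_int z) + \<eta>"
      define y where "y = A * (x + of_int Z) + \<eta>"
      have y: "y = y' + A * of_int z2 * of_int N ^ h"
        by (simp add: y_def y'_def Z_def algebra_simps)
      have shift: "\<exists>t\<in>\<int>. y / of_int N ^ j = y' / of_int N ^ j + t" if "j \<le> h" for j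
      proof -
        have "real_of_int N ^ h = of_int N ^ j * of_int N ^ (h - j)"
          using that by (simp add: power_add[symmetric])
        then have "y / of_int N ^ j = y' / of_int N ^ j + A * of_int z2 * of_int N ^ (h - j)"
          using N_real_gt by (simp add: y add_divide_distrib)
        moreover have "A * of_int z2 * of_int N ^ (h - j) \<in> \<int>"
          by (simp add: A_def)
        ultimately show ?thesis by blast
      qed
      have mask_eq: "mask (y / of_int N ^ j) = mask (y' / of_int N ^ j)" if "j \<le> h" for j
        using shift[OF that] mask_period by auto
      have half_eq: "half_mask (y / of_int N ^ j) = half_mask (y' / of_int N ^ j)" if "j \<le> h" for j
        using shift[OF that] half_mask_period by auto
      have "half_mask_prod y = half_mask_prod y'" using h(1) by (simp add: half_mask_prod_def half_eq)
      moreover have "c1 * half_mask_prod y' \<le> cmod (ft \<mu> y')" using z \<eta> unfolding good_def y'_def by blast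
      moreover have "cmod (ft \<mu> y') \<le> (\<Prod>j=1..h. cmod (mask (y' / of_int N ^ j)))"
      proof -
        have "cmod (ft \<mu> y') = (\<Prod>j=1..h. cmod (mask (y' / of_int N ^ j))) * cmod (ft \<mu> (y' / of_int N ^ h))"
          by (subst ft_prod[of y' h]) (simp add: norm_mult prod_norm)
        also have "\<dots> \<le> (\<Prod>j=1..h. cmod (mask (y' / of_int N ^ j))) * 1"
          by (intro mult_left_mono norm_ft_le_1 prod_nonneg) auto
        finally show ?thesis by simp
      qed
      moreover have "cmod (ft \<mu> y) = (\<Prod>j=1..h. cmod (mask (y' / of_int N ^ j))) * cmod (ft \<mu> (y / of_int N ^ h))"
        by (subst ft_prod[of y h]) (simp add: norm_mult prod_norm[symmetric] mask_eq)
      moreover have "cmod (ft \<mu> (y / of_int N ^ h)) \<ge> c2"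
        unfolding c2_def
      proof (rule d2(2))
        have "y / of_int N ^ h - A * of_int z2 = y' / of_int N ^ h"
          using N_real_gt by (simp add: y add_divide_distrib)
        moreover have "\<bar>y'\<bar> \<le> Y" using \<eta> by (simp add: y'_def Y_def)
        then have "\<bar>y'\<bar> < of_int N ^ h * d2" using h(2) d2(1) by (simp add: field_simps)
        then have "\<bar>y' / of_int N ^ h\<bar> < d2" using N_real_gt by (simp add: abs_divide field_simps)
        ultimately show "\<bar>y / of_int N ^ h - A * of_int z2\<bar> < d2" by simp
      qed
      ultimately have "(c1 * half_mask_prod y) * c2 \<le> cmod (ft \<mu> y)"
        using c1(1) c2 half_mask_prod_bounds(1)[of y'] by (simp only:) (intro mult_mono prod_nonneg; simp)
      then show "c1 * c2 * half_mask_prod y \<le> cmod (ft \<mu> y)" by (simp add: mult_ac)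
    qed
    ultimately show ?thesis by blast
  qed
  with c1 c2 show ?thesis unfolding A_def by (intro exI[of _ "c1 * c2"] conjI exI[of _ d1]) auto
qed

end

section \<open>Finite approximations of the spectrum\<close>

lemma ee_sum: "finite I \<Longrightarrow> ee (\<Sum>i\<in>I. f i) = (\<Prod>i\<in>I. ee (f i))"
  by (induction I rule: finite_induct) (auto simp: ee_add)

text \<open>The matrix with entries \<open>ee (X w * l) / sqrt n\<close> is square with orthonormal rows. Its columns
  are orthonormal as well: the projection \<open>Q = U\<^sup>* U\<close> has unit diagonal, and \<open>Q\<^sup>2 = Q\<close>
  then forces its off-diagonal entries to vanish.\<close>

lemma sum_norm_sq_exponential_sums:
  fixes X :: "'w \<Rightarrow> real" and L :: "real set"
  assumes fin: "finite W" "finite L" and card: "card W = card L" "card W > 0"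
    and o: "\<And>l l'. l \<in> L \<Longrightarrow> l' \<in> L \<Longrightarrow> l \<noteq> l' \<Longrightarrow> (\<Sum>w\<in>W. ee (X w * (l - l'))) = 0"
  shows "(\<Sum>l\<in>L. (cmod (\<Sum>w\<in>W. ee (X w * (\<xi> + l))))\<^sup>2) = (real (card W))\<^sup>2"
proof -
  define Q where "Q w w' = (\<Sum>l\<in>L. ee ((X w - X w') * l))" for w w'
  define n where "n = card W"
  have n: "card L = n" "n > 0" using card by (simp_all add: n_def)
  have diag: "Q w w = of_nat n" for w
    using n by (simp add: Q_def)
  have sq: "(\<Sum>w'\<in>W. (cmod (Q w w'))\<^sup>2) = (real n)\<^sup>2" for w
  proof -
    have "of_real (\<Sum>w'\<in>W. (cmod (Q w w'))\<^sup>2) =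
        (\<Sum>w'\<in>W. \<Sum>l\<in>L. \<Sum>l'\<in>L. ee ((X w - X w') * l) * cnj (ee ((X w - X w') * l')))"
      by (simp add: complex_norm_square Q_def sum_product del: of_real_power)
    also have "\<dots> = (\<Sum>w'\<in>W. \<Sum>l\<in>L. \<Sum>l'\<in>L. ee (X w * (l - l')) * cnj (ee (X w' * (l - l'))))"
      unfolding ee_mult_cnj by (simp add: algebra_simps)
    also have "\<dots> = (\<Sum>l\<in>L. \<Sum>l'\<in>L. \<Sum>w'\<in>W. ee (X w * (l - l')) * cnj (ee (X w' * (l - l'))))"
      by (subst sum.swap) (intro sum.cong refl sum.swap)
    also have "\<dots> = (\<Sum>l\<in>L. \<Sum>l'\<in>L. ee (X w * (l - l')) * cnj (\<Sum>w'\<in>W. ee (X w' * (l - l'))))"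
      by (simp add: sum_distrib_left)
    also have "\<dots> = (\<Sum>l\<in>L. \<Sum>l'\<in>L. if l' = l then of_nat n else 0)"
      using o by (intro sum.cong refl) (auto simp: n_def simp del: cnj_sum)
    also have "\<dots> = of_nat n * of_nat n"
      using fin n by (simp add: sum.delta)
    also have "\<dots> = of_real ((real n)\<^sup>2)" by (simp add: power2_eq_square)
    finally show ?thesis by (simp only: of_real_eq_iff)
  qed
  have off: "Q w w' = 0" if w: "w \<in> W" "w' \<in> W" "w \<noteq> w'" for w w'
  proof -
    have "(\<Sum>w'\<in>W. (cmod (Q w w'))\<^sup>2) = (cmod (Q w w))\<^sup>2 + (\<Sum>w'\<in>W - {w}. (cmod (Q w w'))\<^sup>2)"
      using fin(1) w(1) by (rule sum.remove)
    then have "(\<Sum>w'\<in>W - {w}. (cmod (Q w w'))\<^sup>2) = 0"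
      unfolding sq diag by simp
    then have "\<forall>w'\<in>W - {w}. (cmod (Q w w'))\<^sup>2 = 0"
      using fin by (subst (asm) sum_nonneg_eq_0_iff) auto
    then show ?thesis using w by auto
  qed
  have "of_real (\<Sum>l\<in>L. (cmod (\<Sum>w\<in>W. ee (X w * (\<xi> + l))))\<^sup>2) =
      (\<Sum>l\<in>L. \<Sum>w\<in>W. \<Sum>w'\<in>W. ee (X w * (\<xi> + l)) * cnj (ee (X w' * (\<xi> + l))))"
    by (simp add: complex_norm_square sum_product del: of_real_power)
  also have "\<dots> = (\<Sum>l\<in>L. \<Sum>w\<in>W. \<Sum>w'\<in>W. ee ((X w - X w') * \<xi>) * ee ((X w - X w') * l))"
    unfolding ee_mult_cnj ee_add[symmetric] by (simp add: algebra_simps)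
  also have "\<dots> = (\<Sum>w\<in>W. \<Sum>w'\<in>W. \<Sum>l\<in>L. ee ((X w - X w') * \<xi>) * ee ((X w - X w') * l))"
    by (subst sum.swap) (intro sum.cong refl sum.swap)
  also have "\<dots> = (\<Sum>w\<in>W. \<Sum>w'\<in>W. ee ((X w - X w') * \<xi>) * Q w w')"
    by (simp add: Q_def sum_distrib_left)
  also have "\<dots> = (\<Sum>w\<in>W. \<Sum>w'\<in>W. if w' = w then of_nat n else 0)"
    using off diag by (intro sum.cong refl) auto
  also have "\<dots> = of_real ((real n)\<^sup>2)"
    using fin by (simp add: sum.delta power2_eq_square n_def)
  finally show ?thesis by (simp only: of_real_eq_iff n_def)
qed

context four_digit_measure
begin

section \<open>The truncated transform and its Parseval identity\<close>

definition truncated :: "nat \<Rightarrow> real \<Rightarrow> complex" where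
  "truncated T \<xi> = (\<Prod>j=1..T+k. if j \<le> T then mask (\<xi> / of_int N ^ j) else half_mask (\<xi> / of_int N ^ j))"

lemma norm_truncated: "cmod (truncated T \<xi>) = (\<Prod>j=1..T. cmod (mask (\<xi> / of_int N ^ j))) * half_mask_prod (\<xi> / of_int N ^ T)"
proof -
  have "cmod (truncated T \<xi>) = (\<Prod>j=1..T+k. if j \<le> T then cmod (mask (\<xi> / of_int N ^ j)) else cmod (half_mask (\<xi> / of_int N ^ j)))"
    unfolding truncated_def prod_norm[symmetric] by (intro prod.cong) auto
  also have "{1..T+k} = {1..T} \<union> {T+1..T+k}" by auto
  also have "(\<Prod>j\<in>{1..T} \<union> {T+1..T+k}. if j \<le> T then cmod (mask (\<xi> / of_int N ^ j)) else cmod (half_mask (\<xi> / of_int N ^ j))) =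
      (\<Prod>j=1..T. cmod (mask (\<xi> / of_int N ^ j))) * (\<Prod>j=T+1..T+k. cmod (half_mask (\<xi> / of_int N ^ j)))"
    by (subst prod.union_disjoint) auto
  also have "(\<Prod>j=T+1..T+k. cmod (half_mask (\<xi> / of_int N ^ j))) = (\<Prod>j=1..k. cmod (half_mask (\<xi> / of_int N ^ (j + T))))"
    using prod.shift_bounds_cl_nat_ivl[of "\<lambda>j. cmod (half_mask (\<xi> / of_int N ^ j))" 1 T k] by (simp add: add.commute)
  finally show ?thesis by (simp add: half_mask_prod_def power_add mult.commute)
qed

lemma norm_ft_prod: "cmod (ft \<mu> \<xi>) = (\<Prod>j=1..T. cmod (mask (\<xi> / of_int N ^ j))) * cmod (ft \<mu> (\<xi> / of_int N ^ T))"
  by (subst ft_prod[of \<xi> T]) (simp add: norm_mult prod_norm)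

lemma truncated_le_ft:
  assumes "c * half_mask_prod (\<xi> / of_int N ^ T) \<le> cmod (ft \<mu> (\<xi> / of_int N ^ T))"
  shows "c * cmod (truncated T \<xi>) \<le> cmod (ft \<mu> \<xi>)"
proof -
  have "(\<Prod>j=1..T. cmod (mask (\<xi> / of_int N ^ j))) * (c * half_mask_prod (\<xi> / of_int N ^ T)) \<le>
      (\<Prod>j=1..T. cmod (mask (\<xi> / of_int N ^ j))) * cmod (ft \<mu> (\<xi> / of_int N ^ T))"
    by (intro mult_left_mono assms prod_nonneg) auto
  then show ?thesis unfolding norm_truncated norm_ft_prod[of \<xi> T] by (simp add: mult_ac)
qed

lemma half_mask_prod_tendsto: "(\<lambda>T. half_mask_prod (\<xi> / of_int N ^ T)) \<longlonglongrightarrow> 1"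
proof -
  have "isCont half_mask_prod 0"
  proof -
    have "continuous_on UNIV half_mask_prod" unfolding half_mask_prod_def using N_real_gt by (intro continuous_intros) auto
    then show ?thesis by (simp add: continuous_on_eq_continuous_at)
  qed
  moreover have "half_mask_prod 0 = 1" by (simp add: half_mask_prod_def half_mask_def)
  ultimately show ?thesis using isCont_tendsto_compose[OF _ N_power_tendsto[of \<xi>], of half_mask_prod] by simp
qed

lemma truncated_tendsto: "(\<lambda>T. cmod (truncated T \<xi>)) \<longlonglongrightarrow> cmod (ft \<mu> \<xi>)"
proof -
  have 1: "(\<lambda>T. cmod (ft \<mu> (\<xi> / of_int N ^ T))) \<longlonglongrightarrow> 1"
    using tendsto_norm[OF ft_scale_tendsto] by simp
  have "(\<lambda>T. cmod (ft \<mu> \<xi>) * half_mask_prod (\<xi> / of_int N ^ T) / cmod (ft \<mu> (\<xi> / of_int N ^ T))) \<longlonglongrightarrow> cmod (ft \<mu> \<xi>) * 1 / 1"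
    by (intro tendsto_intros half_mask_prod_tendsto 1) auto
  moreover have "eventually (\<lambda>T. cmod (ft \<mu> \<xi>) * half_mask_prod (\<xi> / of_int N ^ T) / cmod (ft \<mu> (\<xi> / of_int N ^ T)) =
      cmod (truncated T \<xi>)) sequentially"
  proof -
    have "eventually (\<lambda>T. cmod (ft \<mu> (\<xi> / of_int N ^ T)) > 0) sequentially"
      using order_tendstoD(1)[OF 1, of 0] by simp
    then show ?thesis
    proof eventually_elim
      case (elim T)
      then show ?case unfolding norm_truncated norm_ft_prod[of \<xi> T] by simp
    qed
  qed
  ultimately show ?thesis by (simp add: tendsto_cong)
qed

text \<open>\<open>truncated T\<close> is the transform of the uniform distribution on the digit
  words in W. Since L has as many elements as W, the matrix of exponentials is square, and
  orthogonality becomes the full Parseval identity.\<close>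

lemma sum_truncated:
  assumes "finite L" "card L = 4 ^ T * 2 ^ k"
    and o: "\<And>l l'. l \<in> L \<Longrightarrow> l' \<in> L \<Longrightarrow> l \<noteq> l' \<Longrightarrow> truncated T (l - l') = 0"
  shows "(\<Sum>l\<in>L. (cmod (truncated T (\<xi> + l)))\<^sup>2) = 1"
proof -
  define B where "B j = (if j \<le> T then {0, a, 2 ^ \<tau> * l1, a + 2 ^ \<tau> * l2} else {0, 2 ^ \<tau> * l1})" for j
  define W where "W = PiE {1..T+k} B"
  define X where "X p = (\<Sum>j=1..T+k. of_int (p j) / real_of_int N ^ j)" for p :: "nat \<Rightarrow> int"
  have l1: "2 ^ \<tau> * l1 \<noteq> 0" using odds by auto
  have finB: "finite (B j)" for j by (simp add: B_def)
  have cB: "card (B j) = (if j \<le> T then 4 else 2)" for j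
    using digits_distinct l1 by (simp add: B_def)
  have split: "{1..T+k} = {1..T} \<union> {T+1..T+k}" by auto
  have cW: "card W = 4 ^ T * 2 ^ k"
  proof -
    have "card W = (\<Prod>j=1..T+k. card (B j))" unfolding W_def by (rule card_PiE) simp
    also have "\<dots> = (\<Prod>j=1..T. card (B j)) * (\<Prod>j=T+1..T+k. card (B j))"
      unfolding split by (rule prod.union_disjoint) auto
    also have "\<dots> = 4 ^ T * 2 ^ k" by (simp add: cB)
    finally show ?thesis .
  qed
  have fW: "finite W" unfolding W_def by (intro finite_PiE finB) auto
  have truncated_eq: "of_nat (card W) * truncated T \<xi> = (\<Sum>w\<in>W. ee (X w * \<xi>))" for \<xi>
  proof -
    have f: "(if j \<le> T then mask (\<xi> / of_int N ^ j) else half_mask (\<xi> / of_int N ^ j)) =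
        (\<Sum>d\<in>B j. ee (of_int d / of_int N ^ j * \<xi>)) / of_nat (card (B j))" for j
    proof (cases "j \<le> T")
      case True
      then show ?thesis
        unfolding cB by (simp only: B_def if_True sum_digits) (simp add: mask_def)
    next
      case False
      then show ?thesis using l1 unfolding cB by (simp add: B_def half_mask_def)
    qed
    have "truncated T \<xi> = (\<Prod>j=1..T+k. \<Sum>d\<in>B j. ee (of_int d / of_int N ^ j * \<xi>)) / (\<Prod>j=1..T+k. of_nat (card (B j)))"
      unfolding truncated_def f by (rule prod_dividef)
    also have "(\<Prod>j=1..T+k. of_nat (card (B j))) = (of_nat (card W) :: complex)"
      unfolding W_def by (subst card_PiE) auto
    also have "(\<Prod>j=1..T+k. \<Sum>d\<in>B j. ee (of_int d / of_int N ^ j * \<xi>)) =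
        (\<Sum>w\<in>W. \<Prod>j=1..T+k. ee (of_int (w j) / of_int N ^ j * \<xi>))"
      unfolding W_def by (rule prod_sum_PiE) (auto simp: finB)
    also have "\<dots> = (\<Sum>w\<in>W. ee (X w * \<xi>))"
      by (simp add: X_def sum_distrib_right ee_sum)
    finally show ?thesis using cW by simp
  qed
  have cpos: "card W > 0" using cW by simp
  have "(\<Sum>l\<in>L. (cmod (\<Sum>w\<in>W. ee (X w * (\<xi> + l))))\<^sup>2) = (real (card W))\<^sup>2"
  proof (rule sum_norm_sq_exponential_sums[OF fW assms(1) _ cpos])
    show "card W = card L" using assms(2) cW by simp
    show "(\<Sum>w\<in>W. ee (X w * (l - l'))) = 0" if "l \<in> L" "l' \<in> L" "l \<noteq> l'" for l l'
      using o[OF that] truncated_eq[of "l - l'"] by simp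
  qed
  then have "(real (card W))\<^sup>2 * (\<Sum>l\<in>L. (cmod (truncated T (\<xi> + l)))\<^sup>2) = (real (card W))\<^sup>2"
    unfolding truncated_eq[symmetric] by (simp add: norm_mult power_mult_distrib sum_distrib_left)
  then show ?thesis using cpos by simp
qed

section \<open>Digit expansions whose differences stay at zeros\<close>

text \<open>The differences x for which \<open>m ^ k * x\<close> is a zero of the required form. The
  first alternative is the first kind on level j. Because
  \<open>2 ^ (\<tau> + 1) * m ^ k = 2 ^ (r + 1) * N ^ k\<close>, the second is the second kind on
  level k + j.\<close>

definition Dset :: "nat \<Rightarrow> int set" where
  "Dset T = {x. \<exists>j\<in>{1..T}. \<exists>v. odd v \<and> (2 * x = N ^ j * v \<or> 2 ^ (r + 1) * x = N ^ j * v)}"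

definition separated :: "nat \<Rightarrow> int set \<Rightarrow> bool" where
  "separated T A \<longleftrightarrow> (\<forall>x\<in>A. \<forall>y\<in>A. x \<noteq> y \<longrightarrow> x - y \<in> Dset T)"

lemma N_nonzero: "N \<noteq> 0"
  using N_gt by simp

lemma even_N: "even N"
  using N_eq r by simp

lemma zero_notin_Dset: "0 \<notin> Dset T"
  using N_nonzero by (auto simp: Dset_def)

lemma Dset_mono: "T \<le> T' \<Longrightarrow> Dset T \<subseteq> Dset T'"
  unfolding Dset_def by (intro Collect_mono) (meson atLeastAtMost_iff le_trans)

text \<open>Membership depends on the residue modulo \<open>N ^ T\<close> only: on a level j \<le> T
  the added term changes v by an even integer.\<close>

lemma Dset_add:
  assumes "x \<in> Dset T"
  shows "x + N ^ T * z \<in> Dset T"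
proof -
  obtain j v where j: "j \<in> {1..T}" "odd v" and *: "2 * x = N ^ j * v \<or> 2 ^ (r + 1) * x = N ^ j * v"
    using assms by (auto simp: Dset_def)
  have p: "N ^ T = N ^ j * N ^ (T - j)" using j(1) by (simp add: power_add[symmetric])
  have "odd (v + c * (N ^ (T - j) * z))" if "even c" for c
    using j that by simp
  moreover have "c * (x + N ^ T * z) = N ^ j * (v + c * (N ^ (T - j) * z))" if "c * x = N ^ j * v" for c
    unfolding distrib_left that p by (simp add: algebra_simps)
  moreover have "even (2 ^ (r + 1) :: int)" "even (2::int)" by simp_all
  ultimately show ?thesis using * j(1) unfolding Dset_def by blast
qed

text \<open>Consequently distinct points of a separated set are incongruent modulo
  \<open>N ^ T\<close>.\<close>

lemma Dset_multiple: "N ^ T * z \<notin> Dset T"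
  using Dset_add[of "N ^ T * z" T "- z"] zero_notin_Dset by (auto simp: algebra_simps)

lemma Dset_scale:
  assumes "x \<in> Dset q"
  shows "N ^ T * x \<in> Dset (T + q)"
proof -
  obtain j v where j: "j \<in> {1..q}" "odd v" and *: "2 * x = N ^ j * v \<or> 2 ^ (r + 1) * x = N ^ j * v"
    using assms by (auto simp: Dset_def)
  have "c * (N ^ T * x) = N ^ (T + j) * v" if "c * x = N ^ j * v" for c
    using that by (simp add: power_add mult.left_commute)
  moreover have "T + j \<in> {1..T + q}" using j by auto
  ultimately show ?thesis using * j(2) unfolding Dset_def by blast
qed

lemma separated_add_pair:
  assumes "separated T A" "separated q C" "x \<in> A" "x' \<in> A" "c \<in> C" "c' \<in> C" "(x, c) \<noteq> (x', c')"
  shows "(x + N ^ T * c) - (x' + N ^ T * c') \<in> Dset (T + q)"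
proof (cases "x = x'")
  case True
  then have "c - c' \<in> Dset q" using assms by (auto simp: separated_def)
  from Dset_scale[OF this, of T] True show ?thesis by (simp add: algebra_simps)
next
  case False
  then have "x - x' \<in> Dset T" using assms by (auto simp: separated_def)
  from Dset_add[OF this, of "c - c'"] Dset_mono[of T "T + q"] show ?thesis by (auto simp: algebra_simps)
qed

definition extend :: "nat \<Rightarrow> int set \<Rightarrow> int set \<Rightarrow> int set" where
  "extend T A C = (\<lambda>(x, c). x + N ^ T * c) ` (A \<times> C)"

lemma inj_on_extend:
  assumes "separated T A" "separated q C"
  shows "inj_on (\<lambda>(x, c). x + N ^ T * c) (A \<times> C)"
proof (rule inj_onI, clarify)
  fix x c x' c' assume *: "x \<in> A" "c \<in> C" "x' \<in> A" "c' \<in> C" "x + N ^ T * c = x' + N ^ T * c'"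
  have "(x, c) = (x', c')"
  proof (rule ccontr)
    assume "(x, c) \<noteq> (x', c')"
    from separated_add_pair[OF assms *(1,3,2,4) this] *(5) zero_notin_Dset show False by simp
  qed
  then show "x = x' \<and> c = c'" by simp
qed

lemma card_extend:
  assumes "separated T A" "separated q C"
  shows "card (extend T A C) = card A * card C"
  unfolding extend_def by (subst card_image[OF inj_on_extend[OF assms]]) (rule card_cartesian_product)

lemma separated_extend:
  assumes "separated T A" "separated q C"
  shows "separated (T + q) (extend T A C)"
  unfolding separated_def
proof (intro ballI impI)
  fix y y' assume y: "y \<in> extend T A C" "y' \<in> extend T A C" "y \<noteq> y'"
  then obtain x c x' c' where *: "x \<in> A" "c \<in> C" "y = x + N ^ T * c" "x' \<in> A" "c' \<in> C" "y' = x' + N ^ T * c'"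
    by (auto simp: extend_def)
  with y(3) have "(x, c) \<noteq> (x', c')" by auto
  from separated_add_pair[OF assms *(1,4,2,5) this] show "y - y' \<in> Dset (T + q)"
    by (simp only: *)
qed

text \<open>The digits of the two bits: \<open>m ^ k * N ^ j * h1\<close> equals
  \<open>N ^ (j + 1) * m ^ k / 2\<close>, and \<open>m ^ k * N ^ j * h2\<close> equals
  \<open>N ^ (j + 1 + k) / 2 ^ (\<tau> + 1)\<close>.\<close>

definition h1 :: int where "h1 = 2 ^ (\<beta> - 1) * m"
definition h2 :: int where "h2 = 2 ^ (\<beta> - r - 1) * m"

lemma h_eqs: "2 * h1 = N" "2 ^ (r + 1) * h2 = N" "h1 = 2 ^ r * h2" "h2 > 0" "h1 > 0"
proof -
  have "Suc (\<beta> - 1) = \<beta>" "(r + 1) + (\<beta> - r - 1) = \<beta>" "r + (\<beta> - r - 1) = \<beta> - 1" using r by simp_all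
  then show "2 * h1 = N" "2 ^ (r + 1) * h2 = N" "h1 = 2 ^ r * h2"
    unfolding h1_def h2_def N_eq by (metis mult.assoc power_Suc, metis mult.assoc power_add, metis mult.assoc power_add)
  show "h2 > 0" "h1 > 0" using m_pos by (simp_all add: h1_def h2_def)
qed

definition Ldig :: "int set" where
  "Ldig = {0, h1, h2, h1 + h2}"

lemma Ldig_bounds: "l \<in> Ldig \<Longrightarrow> 0 \<le> l \<and> l \<le> N - 1"
proof -
  have "2 ^ 1 \<le> (2::int) ^ r" using r by (intro power_increasing) auto
  then have "2 * h2 \<le> h1" unfolding h_eqs(3) using h_eqs(4) by (intro mult_right_mono) auto
  then show "l \<in> Ldig \<Longrightarrow> 0 \<le> l \<and> l \<le> N - 1"
    using h_eqs by (auto simp: Ldig_def)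
qed

text \<open>As \<open>h1 = 2 ^ r * h2\<close> with r > 0, every difference in which
  \<open>h2\<close> survives is an odd multiple of \<open>h2\<close>; the remaining ones are
  \<open>h1\<close> and \<open>- h1\<close>.\<close>

lemma separated_Ldig: "separated 1 Ldig"
  unfolding separated_def
proof (intro ballI impI)
  fix x y assume xy: "x \<in> Ldig" "y \<in> Ldig" "x \<noteq> y"
  have even: "even ((2::int) ^ r)" using r by simp
  have 1: "v * h1 \<in> Dset 1" if "odd v" for v
    using that h_eqs(1) by (auto simp: Dset_def intro!: exI[of _ v])
  have 2: "v * h2 \<in> Dset 1" if "odd v" for v
    using that h_eqs(2) unfolding Dset_def
    by (auto intro!: exI[of _ v] disjI2 simp: mult.left_commute[of _ v] mult.commute[of N] simp del: power_Suc)
  have D: "h1 \<in> Dset 1" "- h1 \<in> Dset 1" "h2 \<in> Dset 1" "- h2 \<in> Dset 1"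
    "h1 + h2 \<in> Dset 1" "- h1 - h2 \<in> Dset 1" "h1 - h2 \<in> Dset 1" "h2 - h1 \<in> Dset 1"
    using 1[of 1] 1[of "- 1"] 2[of 1] 2[of "- 1"] 2[of "2 ^ r + 1"] 2[of "- (2 ^ r) - 1"]
      2[of "2 ^ r - 1"] 2[of "1 - 2 ^ r"] even
    by (simp_all add: h_eqs(3) algebra_simps)
  show "x - y \<in> Dset 1"
    using xy D by (auto simp: Ldig_def)
qed

lemma card_Ldig: "card Ldig = 4"
proof -
  have "2 ^ 1 \<le> (2::int) ^ r" using r by (intro power_increasing) auto
  then have "2 * h2 \<le> h1" unfolding h_eqs(3) using h_eqs(4) by (intro mult_right_mono) auto
  then have "h1 \<noteq> h2" "h1 \<noteq> 0" "h2 \<noteq> 0" "h1 + h2 \<noteq> 0" using h_eqs(4) by linarith+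
  then show ?thesis by (simp add: Ldig_def card_insert_if)
qed

definition Plain :: "nat set \<Rightarrow> int set" where
  "Plain J = (\<lambda>l. \<Sum>j\<in>J. N ^ j * l j) ` {l. \<forall>j. l j \<in> Ldig}"

lemma PlainI: "(\<And>j. l j \<in> Ldig) \<Longrightarrow> (\<Sum>j\<in>J. N ^ j * l j) \<in> Plain J"
  by (auto simp: Plain_def)

lemma zero_Ldig [simp]: "0 \<in> Ldig"
  by (simp add: Ldig_def)

lemma Plain_mono:
  assumes "J \<subseteq> J'" "finite J'"
  shows "Plain J \<subseteq> Plain J'"
proof
  fix x assume "x \<in> Plain J"
  then obtain l where l: "\<And>j. l j \<in> Ldig" "x = (\<Sum>j\<in>J. N ^ j * l j)" by (auto simp: Plain_def)
  have "x = (\<Sum>j\<in>J'. N ^ j * (if j \<in> J then l j else 0))"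
    unfolding l(2) using assms by (intro sum.mono_neutral_cong_left) auto
  then show "x \<in> Plain J'" using l(1) by (simp only:) (rule PlainI, simp)
qed

lemma zero_in_Plain: "0 \<in> Plain J"
  using PlainI[of "\<lambda>_. 0" J] by simp

lemma Plain_Suc: "Plain {..<Suc q} = extend q (Plain {..<q}) Ldig"
proof (intro equalityI subsetI)
  fix x assume "x \<in> Plain {..<Suc q}"
  then obtain l where l: "\<And>j. l j \<in> Ldig" "x = (\<Sum>j<Suc q. N ^ j * l j)" by (auto simp: Plain_def)
  then show "x \<in> extend q (Plain {..<q}) Ldig"
    unfolding extend_def by (auto intro!: rev_image_eqI[of "(\<Sum>j<q. N ^ j * l j, l q)"] PlainI)
next
  fix x assume "x \<in> extend q (Plain {..<q}) Ldig"
  then obtain l c where l: "\<And>j. l j \<in> Ldig" "c \<in> Ldig" "x = (\<Sum>j<q. N ^ j * l j) + N ^ q * c"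
    by (auto simp: Plain_def extend_def)
  have "x = (\<Sum>j<Suc q. N ^ j * (l(q := c)) j)" unfolding l(3) by simp
  then show "x \<in> Plain {..<Suc q}" using l(1,2) by (simp only:) (rule PlainI, simp)
qed

lemma Plain_block: "separated q (Plain {..<q}) \<and> card (Plain {..<q}) = 4 ^ q"
proof (induction q)
  case 0
  have "Plain {} = {0}" by (auto simp: Plain_def image_def intro!: exI[of _ "\<lambda>_. 0"])
  then show ?case by (simp add: separated_def)
next
  case (Suc q)
  then show ?case
    using separated_extend[OF _ separated_Ldig, of q "Plain {..<q}"]
      card_extend[OF _ separated_Ldig, of q "Plain {..<q}"]
    by (simp add: Plain_Suc card_Ldig)
qed

lemma finite_Plain_block: "finite (Plain {..<q})"
  using Plain_block[of q] by (metis card.infinite power_not_zero zero_neq_numeral)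

lemma finite_Plain: "finite J \<Longrightarrow> finite (Plain J)"
  using Plain_mono[of J "{..<Suc (Max J)}"] finite_Plain_block finite_subset
  by (metis Max_ge finite_lessThan lessThan_iff less_Suc_eq_le subsetI)

lemma Plain_bounds:
  assumes "J \<subseteq> {..<q}" "x \<in> Plain J"
  shows "0 \<le> x" "x < N ^ q"
proof -
  have "x \<in> Plain {..<q}" using Plain_mono[OF assms(1)] assms(2) by auto
  then have "0 \<le> x \<and> x < N ^ q"
  proof (induction q arbitrary: x)
    case 0
    then show ?case by (auto simp: Plain_def)
  next
    case (Suc q)
    then obtain y c where yc: "y \<in> Plain {..<q}" "c \<in> Ldig" "x = y + N ^ q * c"
      by (auto simp: Plain_Suc extend_def)
    have "0 \<le> y" "y < N ^ q" using Suc.IH yc(1) by auto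
    moreover have "0 \<le> c" "c \<le> N - 1" using Ldig_bounds yc(2) by auto
    moreover have "0 \<le> N ^ q * c" using N_gt \<open>0 \<le> c\<close> by simp
    moreover have "N ^ q * c \<le> N ^ q * (N - 1)" using N_gt \<open>c \<le> N - 1\<close> by (intro mult_left_mono) auto
    ultimately show ?case unfolding yc(3) by (simp add: algebra_simps)
  qed
  then show "0 \<le> x" "x < N ^ q" by auto
qed

text \<open>The \<open>k\<close> lowest \<open>\<delta>\<close>-digits may have negative 2-adic valuation and are collected in \<open>bb\<close>. All other
  digits contribute \<open>m ^ k\<close> times an integer with digits in \<open>Ldig\<close>.\<close>

definition bb :: "nat set \<Rightarrow> real" where
  "bb S = (\<Sum>j\<in>S. of_int N ^ j) / 2 ^ (\<tau> + 1)"

definition Lam :: "int set \<Rightarrow> real set" where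
  "Lam \<Gamma> = (\<lambda>(S, \<gamma>). bb S + of_int m ^ k * of_int \<gamma>) ` (Pow {1..k} \<times> \<Gamma>)"

definition at_zero :: "nat \<Rightarrow> real \<Rightarrow> bool" where
  "at_zero T x \<longleftrightarrow> (\<exists>j\<in>{1..T+k}. oddreal (2 ^ (\<tau> + 1) * (x / of_int N ^ j))) \<or>
     (\<exists>j\<in>{1..T}. oddreal (2 * (x / of_int N ^ j)))"

section \<open>Zeros at the differences of model points\<close>

lemma not_at_zero_0: "\<not> at_zero T 0"
  by (auto simp: at_zero_def oddreal_def)

lemma at_zero_zero:
  assumes "at_zero T x" "odd p"
  shows "truncated T (of_int p * x) = 0" "ft \<mu> (of_int p * x) = 0"
proof -
  have p: "oddreal (of_int p)" using assms by simp
  have "\<exists>j\<in>{1..T+k}. (if j \<le> T then mask (of_int p * x / of_int N ^ j) else half_mask (of_int p * x / of_int N ^ j)) = 0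
      \<and> mask (of_int p * x / of_int N ^ j) = 0"
    using assms(1) unfolding at_zero_def
  proof (elim disjE bexE)
    fix j assume j: "j \<in> {1..T+k}" "oddreal (2 ^ (\<tau> + 1) * (x / of_int N ^ j))"
    from oddreal_mult[OF p j(2)] have "oddreal (2 ^ (\<tau> + 1) * (of_int p * x / of_int N ^ j))"
      by (simp add: mult_ac)
    from zeroI2[OF this] j(1) show ?thesis by auto
  next
    fix j assume j: "j \<in> {1..T}" "oddreal (2 * (x / of_int N ^ j))"
    from oddreal_mult[OF p j(2)] have "oddreal (2 * (of_int p * x / of_int N ^ j))"
      by (simp add: mult_ac)
    from mask_zeroI1[OF this] j(1) show ?thesis by (intro bexI[of _ j]) auto
  qed
  then show "truncated T (of_int p * x) = 0" "ft \<mu> (of_int p * x) = 0"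
    by (auto simp: truncated_def prod_zero_iff intro: ft_zeroI)
qed

text \<open>The lowest nonzero digit decides, as N is even.\<close>

lemma odd_multiple_sum:
  assumes "j0 \<in> {1..k}" "\<And>j. j < j0 \<Longrightarrow> e j = 0" "odd (e j0)"
  shows "\<exists>v. odd v \<and> (\<Sum>j=1..k. N ^ j * e j) = N ^ j0 * (v::int)"
proof -
  have "(\<Sum>j=1..k. N ^ j * e j) = N ^ j0 * e j0 + (\<Sum>j\<in>{1..k} - {j0}. N ^ j * e j)"
    using assms(1) by (intro sum.remove) auto
  also have "(\<Sum>j\<in>{1..k} - {j0}. N ^ j * e j) = (\<Sum>j\<in>{1..k} - {j0}. N ^ j0 * (if j < j0 then 0 else N ^ (j - j0) * e j))"
  proof (rule sum.cong[OF refl])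
    fix j assume "j \<in> {1..k} - {j0}"
    show "N ^ j * e j = N ^ j0 * (if j < j0 then 0 else N ^ (j - j0) * e j)"
    proof (cases "j < j0")
      case False
      then have "N ^ j = N ^ j0 * N ^ (j - j0)" by (simp add: power_add[symmetric])
      then show ?thesis using False by simp
    qed (use assms in auto)
  qed
  also have "N ^ j0 * e j0 + \<dots> = N ^ j0 * (e j0 + (\<Sum>j\<in>{1..k} - {j0}. if j < j0 then 0 else N ^ (j - j0) * e j))"
    by (simp add: distrib_left sum_distrib_left)
  finally show ?thesis
  proof (intro exI conjI)
    have "even (\<Sum>j\<in>{1..k} - {j0}. if j < j0 then 0 else N ^ (j - j0) * e j)"
      using even_N by (intro dvd_sum) auto
    then show "odd (e j0 + (\<Sum>j\<in>{1..k} - {j0}. if j < j0 then 0 else N ^ (j - j0) * e j))"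
      using assms(3) by simp
  qed
qed

text \<open>If the low bits agree, the difference is \<open>m ^ k\<close> times an element of
  \<open>Dset T\<close>, and its second kind appears k levels higher. If they differ, the lowest
  differing position j0 \<le> k decides: scaled by \<open>2 ^ (\<tau> + 1)\<close>, the integer part
  is a multiple of \<open>4 * N ^ j0\<close> and leaves the parity alone.\<close>

lemma Lam_difference_at_zero:
  assumes sep: "separated T \<Gamma>" and "S \<subseteq> {1..k}" "S' \<subseteq> {1..k}" "\<gamma> \<in> \<Gamma>" "\<gamma>' \<in> \<Gamma>" "(S, \<gamma>) \<noteq> (S', \<gamma>')"
  shows "at_zero T ((bb S + of_int m ^ k * of_int \<gamma>) - (bb S' + of_int m ^ k * of_int \<gamma>'))"
proof (cases "S = S'")
  case True
  then have "\<gamma> - \<gamma>' \<in> Dset T" using assms by (auto simp: separated_def)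
  then obtain j v where j: "j \<in> {1..T}" "odd v"
    and *: "2 * (\<gamma> - \<gamma>') = N ^ j * v \<or> 2 ^ (r + 1) * (\<gamma> - \<gamma>') = N ^ j * v"
    by (auto simp: Dset_def)
  define x where "x = of_int m ^ k * real_of_int (\<gamma> - \<gamma>')"
  have ov: "odd (m ^ k * v)" using j odds by simp
  from * have "at_zero T x"
  proof
    assume "2 * (\<gamma> - \<gamma>') = N ^ j * v"
    then have "2 * real_of_int (\<gamma> - \<gamma>') = of_int N ^ j * of_int v"
      by (metis of_int_mult of_int_numeral of_int_power)
    moreover have "2 * (x / of_int N ^ j) = of_int m ^ k * (2 * real_of_int (\<gamma> - \<gamma>')) / of_int N ^ j"
      by (simp add: x_def)
    ultimately have "2 * (x / of_int N ^ j) = of_int (m ^ k * v)"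
      using N_real_gt by simp
    then show ?thesis using j(1) ov unfolding at_zero_def by (metis oddreal_of_int)
  next
    assume "2 ^ (r + 1) * (\<gamma> - \<gamma>') = N ^ j * v"
    then have 1: "2 ^ (r + 1) * real_of_int (\<gamma> - \<gamma>') = of_int N ^ j * of_int v"
      by (metis of_int_mult of_int_numeral of_int_power)
    have "2 ^ (\<tau> + 1) * x = (2 ^ (\<beta> * k) * of_int m ^ k) * (2 ^ (r + 1) * real_of_int (\<gamma> - \<gamma>'))"
      by (simp add: x_def \<tau>_eq power_add mult_ac)
    also have "\<dots> = of_int N ^ (k + j) * of_int v"
      unfolding 1 N_power_real[of k, symmetric] by (simp add: power_add)
    finally have "2 ^ (\<tau> + 1) * (x / of_int N ^ (k + j)) = of_int v"
      using N_real_gt by (simp add: field_simps)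
    moreover have "k + j \<in> {1..T + k}" using j by auto
    ultimately show ?thesis using j(2) unfolding at_zero_def by (metis oddreal_of_int)
  qed
  with True show ?thesis by (simp add: x_def algebra_simps)
next
  case False
  define e :: "nat \<Rightarrow> int" where "e j = of_bool (j \<in> S) - of_bool (j \<in> S')" for j
  have "\<exists>j. e j \<noteq> 0" using False by (auto simp: e_def of_bool_def split: if_splits)
  define j0 where "j0 = (LEAST j. e j \<noteq> 0)"
  have j0: "e j0 \<noteq> 0" "\<And>j. j < j0 \<Longrightarrow> e j = 0"
    using LeastI_ex[OF \<open>\<exists>j. e j \<noteq> 0\<close>] not_less_Least unfolding j0_def by auto
  have j0k: "j0 \<in> {1..k}" using j0(1) assms(2,3) by (auto simp: e_def of_bool_def split: if_splits)
  have "odd (e j0)" using j0(1) by (auto simp: e_def of_bool_def split: if_splits)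
  from odd_multiple_sum[of j0 e, OF j0k j0(2) this]
  obtain v where v: "odd v" "(\<Sum>j=1..k. N ^ j * e j) = N ^ j0 * v" by blast
  have bbS: "2 ^ (\<tau> + 1) * bb S = real_of_int (\<Sum>j=1..k. N ^ j * of_bool (j \<in> S))" if "S \<subseteq> {1..k}" for S
  proof -
    have "(\<Sum>j\<in>S. real_of_int N ^ j) = (\<Sum>j=1..k. of_int (N ^ j * of_bool (j \<in> S)))"
      using that by (intro sum.mono_neutral_cong_left) auto
    then show ?thesis unfolding bb_def of_int_sum by simp
  qed
  have "2 ^ (\<tau> + 1) * (bb S - bb S') = real_of_int (\<Sum>j=1..k. N ^ j * e j)"
    unfolding right_diff_distrib bbS[OF assms(2)] bbS[OF assms(3)] e_def sum_subtractf by (rule of_int_diff[symmetric])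
  then have 1: "2 ^ (\<tau> + 1) * (bb S - bb S') = of_int N ^ j0 * of_int v"
    unfolding v(2) by simp
  have "j0 \<le> k" using j0k by simp
  then obtain u where "2 ^ (\<tau> + 1) * m ^ k = N ^ j0 * (4 * u)" by (rule level_power)
  then have 2: "2 ^ (\<tau> + 1) * real_of_int m ^ k = of_int N ^ j0 * of_int (4 * u)"
    by (metis of_int_mult of_int_numeral of_int_power)
  define w where "w = v + 4 * u * (\<gamma> - \<gamma>')"
  have "odd w" using v(1) by (simp add: w_def)
  have "2 ^ (\<tau> + 1) * ((bb S + of_int m ^ k * of_int \<gamma>) - (bb S' + of_int m ^ k * of_int \<gamma>')) =
      2 ^ (\<tau> + 1) * (bb S - bb S') + (2 ^ (\<tau> + 1) * real_of_int m ^ k) * of_int (\<gamma> - \<gamma>')"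
    by (simp add: algebra_simps)
  also have "\<dots> = of_int N ^ j0 * of_int w"
    unfolding 1 2 by (simp add: w_def algebra_simps)
  finally have "2 ^ (\<tau> + 1) * (((bb S + of_int m ^ k * of_int \<gamma>) - (bb S' + of_int m ^ k * of_int \<gamma>')) / of_int N ^ j0) = of_int w"
    using N_real_gt by (simp add: field_simps)
  moreover have "j0 \<in> {1..T+k}" using j0k by auto
  ultimately show ?thesis unfolding at_zero_def using \<open>odd w\<close> by (metis oddreal_of_int)
qed

lemma Lam_difference:
  assumes "separated T \<Gamma>" "x \<in> Lam \<Gamma>" "y \<in> Lam \<Gamma>" "x \<noteq> y"
  shows "at_zero T (x - y)"
  using assms Lam_difference_at_zero[OF assms(1)] unfolding Lam_def by auto

lemma card_Lam:
  assumes "separated T \<Gamma>"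
  shows "card (Lam \<Gamma>) = 2 ^ k * card \<Gamma>"
proof -
  have "inj_on (\<lambda>(S, \<gamma>). bb S + of_int m ^ k * of_int \<gamma>) (Pow {1..k} \<times> \<Gamma>)"
  proof (rule inj_onI, clarify)
    fix S \<gamma> S' \<gamma>' assume *: "S \<subseteq> {1..k}" "\<gamma> \<in> \<Gamma>" "S' \<subseteq> {1..k}" "\<gamma>' \<in> \<Gamma>"
      "bb S + of_int m ^ k * of_int \<gamma> = bb S' + of_int m ^ k * of_int \<gamma>'"
    have "(S, \<gamma>) = (S', \<gamma>')"
    proof (rule ccontr)
      assume "(S, \<gamma>) \<noteq> (S', \<gamma>')"
      from Lam_difference_at_zero[OF assms *(1,3,2,4) this] *(5) not_at_zero_0 show False by simp
    qed
    then show "S = S' \<and> \<gamma> = \<gamma>'" by simp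
  qed
  then show ?thesis by (simp add: Lam_def card_image card_cartesian_product card_Pow)
qed

lemma sum_truncated_Lam:
  assumes "separated T \<Gamma>" "finite \<Gamma>" "card \<Gamma> = 4 ^ T" "odd p"
  shows "(\<Sum>l\<in>Lam \<Gamma>. (cmod (truncated T (\<xi> + of_int p * l)))\<^sup>2) = 1"
proof -
  have p: "real_of_int p \<noteq> 0" using assms(4) by auto
  have inj: "inj_on ((*) (real_of_int p)) (Lam \<Gamma>)" using p by (auto simp: inj_on_def)
  have "(\<Sum>l\<in>(*) (real_of_int p) ` Lam \<Gamma>. (cmod (truncated T (\<xi> + l)))\<^sup>2) = 1"
  proof (rule sum_truncated)
    show "finite ((*) (real_of_int p) ` Lam \<Gamma>)" using assms(2) by (simp add: Lam_def)
    show "card ((*) (real_of_int p) ` Lam \<Gamma>) = 4 ^ T * 2 ^ k"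
      using card_image[OF inj] card_Lam[OF assms(1)] assms(3) by simp
    show "truncated T (l - l') = 0" if l: "l \<in> (*) (real_of_int p) ` Lam \<Gamma>" "l' \<in> (*) (real_of_int p) ` Lam \<Gamma>" "l \<noteq> l'" for l l'
    proof -
      obtain x y where xy: "x \<in> Lam \<Gamma>" "y \<in> Lam \<Gamma>" "l = of_int p * x" "l' = of_int p * y" using l by auto
      then have "at_zero T (x - y)" using Lam_difference[OF assms(1)] l(3) by auto
      from at_zero_zero(1)[OF this assms(4)] show ?thesis by (simp add: xy right_diff_distrib)
    qed
  qed
  then show ?thesis by (simp add: sum.reindex[OF inj])
qed

end

section \<open>Construction by stages\<close>

definition lacunary :: "int set \<Rightarrow> bool" where
  "lacunary R \<longleftrightarrow> (\<forall>x\<in>R. \<forall>y\<in>R. x < y \<longrightarrow> 2 * x \<le> y)"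

lemma lacunary_subset: "lacunary R \<Longrightarrow> R' \<subseteq> R \<Longrightarrow> lacunary R'"
  by (auto simp: lacunary_def)

text \<open>Admissible values are unbounded, so each new one can be placed beyond twice all earlier
  ones.\<close>

lemma exists_lacunary_choice:
  fixes Q :: "int \<Rightarrow> int \<Rightarrow> bool"
  assumes "finite A" "\<And>e B. e \<in> A \<Longrightarrow> \<exists>y>B. Q e y"
  shows "\<exists>f. (\<forall>e\<in>A. Q e (f e) \<and> f e > B0) \<and> lacunary (f ` A)"
  using assms
proof (induction A rule: finite_induct)
  case empty
  then show ?case by (auto simp: lacunary_def)
next
  case (insert e A)
  then obtain f where f: "\<forall>e\<in>A. Q e (f e) \<and> f e > B0" "lacunary (f ` A)" by blast
  define B where "B = Max (insert \<bar>B0\<bar> (f ` A))"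
  have B: "B \<ge> \<bar>B0\<bar>" "\<And>x. x \<in> A \<Longrightarrow> f x \<le> B" using insert.hyps by (auto simp: B_def)
  obtain y where y: "y > 2 * B" "Q e y" using insert.prems[of e "2 * B"] by auto
  have "lacunary (insert y (f ` A))"
    unfolding lacunary_def
  proof (intro ballI impI)
    fix u v assume uv: "u \<in> insert y (f ` A)" "v \<in> insert y (f ` A)" "u < v"
    show "2 * u \<le> v"
    proof (cases "u = y \<or> v = y")
      case True
      then show ?thesis using uv B y by force
    next
      case False
      then show ?thesis using uv f(2) by (auto simp: lacunary_def)
    qed
  qed
  moreover have "(f(e := y)) ` insert e A = insert y (f ` A)" using insert.hyps by auto
  moreover have "\<forall>x\<in>insert e A. Q x ((f(e := y)) x) \<and> (f(e := y)) x > B0"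
    using f(1) y B insert.hyps by auto
  ultimately show ?case by (intro exI[of _ "f(e := y)"]) simp
qed

lemma (in four_digit_measure) exists_shift_constants:
  "\<exists>cd. \<forall>p. odd p \<longrightarrow> fst (cd p) > 0 \<and> snd (cd p) > 0 \<and> (\<forall>x B. \<exists>Z::int. Z > B \<and>
     good (fst (cd p)) (snd (cd p)) (of_int p * of_int m ^ k * (x + of_int Z)))"
proof (rule choice, rule allI)
  fix p
  show "\<exists>y. odd p \<longrightarrow> fst y > 0 \<and> snd y > 0 \<and> (\<forall>x B. \<exists>Z::int. Z > B \<and>
     good (fst y) (snd y) (of_int p * of_int m ^ k * (x + of_int Z)))"
  proof (cases "odd p")
    case True
    obtain c d where "c > 0" "d > 0" "\<forall>x B. \<exists>Z::int. Z > B \<and> good c d (of_int p * of_int m ^ k * (x + of_int Z))"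
      using exists_large_good_shift[OF True] by blast
    then show ?thesis by (intro exI[of _ "(c, d)"]) simp
  qed simp
qed

text \<open>The first component of the decoded pair names the odd integer; the second is a free
  counter that makes it recur.\<close>

definition pseq :: "nat \<Rightarrow> int" where
  "pseq i = 2 * int_decode (fst (prod_decode i)) + 1"

lemma odd_pseq: "odd (pseq i)"
  by (simp add: pseq_def)

lemma pseq_infinitely_often:
  assumes "odd p"
  shows "\<exists>i\<ge>n. pseq i = p"
proof -
  obtain q where "p = 2 * q + 1" using assms by (elim oddE)
  then have "pseq (prod_encode (int_encode q, n)) = p" by (simp add: pseq_def)
  then show ?thesis using le_prod_encode_2[of n "int_encode q"] by blast
qed

locale four_digit_construction = four_digit_measure +
  fixes \<alpha> :: real
  assumes \<alpha>: "0 \<le> \<alpha>" "\<alpha> \<le> 1"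
begin

definition cd :: "int \<Rightarrow> real \<times> real" where
  "cd = (SOME cd. \<forall>p. odd p \<longrightarrow> fst (cd p) > 0 \<and> snd (cd p) > 0 \<and> (\<forall>x B. \<exists>Z::int. Z > B \<and>
     good (fst (cd p)) (snd (cd p)) (of_int p * of_int m ^ k * (x + of_int Z))))"

lemma cd:
  assumes "odd p"
  shows "fst (cd p) > 0" "snd (cd p) > 0"
    "\<exists>Z::int. Z > B \<and> good (fst (cd p)) (snd (cd p)) (of_int p * of_int m ^ k * (x + of_int Z))"
  using someI_ex[OF exists_shift_constants, folded cd_def] assms by auto

section \<open>Digit positions of prescribed density and the parameters of a stage\<close>

text \<open>The positions where the floor of \<alpha> * j jumps. For 0 \<le> \<alpha> \<le> 1 every
  jump is 1, so counting positions telescopes.\<close>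

definition Beatty :: "nat set" where
  "Beatty = {j. \<lfloor>\<alpha> * real (Suc j)\<rfloor> \<noteq> \<lfloor>\<alpha> * real j\<rfloor>}"

lemma card_Beatty: "int (card (Beatty \<inter> {..<t})) = \<lfloor>\<alpha> * real t\<rfloor>"
proof (induction t)
  case (Suc t)
  have "\<lfloor>\<alpha> * real t\<rfloor> \<le> \<lfloor>\<alpha> * real (Suc t)\<rfloor>"
    using \<alpha> by (intro floor_mono mult_left_mono) auto
  moreover have "\<lfloor>\<alpha> * real (Suc t)\<rfloor> \<le> \<lfloor>\<alpha> * real t\<rfloor> + 1"
  proof -
    have "\<alpha> * real (Suc t) \<le> \<alpha> * real t + 1" using \<alpha> by (simp add: algebra_simps)
    then show ?thesis by (metis floor_mono floor_add_int of_int_1)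
  qed
  moreover have "Beatty \<inter> {..<Suc t} = (if t \<in> Beatty then insert t (Beatty \<inter> {..<t}) else Beatty \<inter> {..<t})"
    by (auto simp: less_Suc_eq)
  then have "card (Beatty \<inter> {..<Suc t}) = (if t \<in> Beatty then 1 else 0) + card (Beatty \<inter> {..<t})"
    by auto
  moreover have "t \<in> Beatty \<longleftrightarrow> \<lfloor>\<alpha> * real (Suc t)\<rfloor> \<noteq> \<lfloor>\<alpha> * real t\<rfloor>" by (simp add: Beatty_def)
  ultimately show ?case using Suc.IH by (cases "t \<in> Beatty") auto
qed simp

text \<open>The product makes T + i + 2 at most the fraction 1 / (i + 1) of the new level T', so
  that the positions lost in this stage do not affect the density. The other terms put all of
  \<Gamma> below \<open>N ^ (T' - (i + 1))\<close>.\<close>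

definition nextT :: "nat \<Rightarrow> nat \<Rightarrow> int set \<Rightarrow> nat" where
  "nextT i T \<Gamma> = (i + 1) * (T + i + 2) + (i + 1) + nat (Max \<Gamma>) + 1"

definition nextJ :: "nat \<Rightarrow> nat \<Rightarrow> nat \<Rightarrow> nat set \<Rightarrow> nat set" where
  "nextJ i T T' J = J \<union> (Beatty \<inter> {T..<T' - (i + 1)})"

definition kept :: "nat \<Rightarrow> nat \<Rightarrow> int set \<Rightarrow> nat set \<Rightarrow> int set" where
  "kept i T \<Gamma> J = \<Gamma> \<union> Plain (nextJ i T (nextT i T \<Gamma>) J)"

definition candidates :: "nat \<Rightarrow> nat \<Rightarrow> int set \<Rightarrow> int set" where
  "candidates i T \<Gamma> = extend T \<Gamma> (Plain {..<nextT i T \<Gamma> - T})"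

text \<open>Stage \<open>i\<close> serves the multiplier \<open>pseq i\<close>. The bound \<open>B\<close> allows two different outcomes of a stage,
  which yields continuum many spectra.\<close>

definition stepf :: "nat \<Rightarrow> int \<Rightarrow> nat \<Rightarrow> int set \<Rightarrow> nat set \<Rightarrow> (int \<Rightarrow> int) \<Rightarrow> bool" where
  "stepf i B T \<Gamma> J f \<longleftrightarrow>
     (\<forall>e\<in>kept i T \<Gamma> J. f e = e) \<and>
     (\<forall>e\<in>candidates i T \<Gamma> - kept i T \<Gamma> J. (\<exists>Z\<ge>0. f e = e + N ^ nextT i T \<Gamma> * Z) \<and> f e > B \<and> f e > 2 * Max \<Gamma> \<and>
        good (fst (cd (pseq i))) (snd (cd (pseq i)))
          (of_int (pseq i) * of_int m ^ k * (of_int (f e) / of_int N ^ nextT i T \<Gamma>))) \<and>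
     lacunary (f ` (candidates i T \<Gamma> - kept i T \<Gamma> J))"

definition stepP :: "nat \<Rightarrow> int \<Rightarrow> nat \<Rightarrow> int set \<Rightarrow> nat set \<Rightarrow> int set \<Rightarrow> bool" where
  "stepP i B T \<Gamma> J \<Gamma>' \<longleftrightarrow> (\<exists>f. \<Gamma>' = f ` candidates i T \<Gamma> \<and> stepf i B T \<Gamma> J f)"

definition stage_inv :: "nat \<Rightarrow> int set \<Rightarrow> nat set \<Rightarrow> bool" where
  "stage_inv T \<Gamma> J \<longleftrightarrow> finite \<Gamma> \<and> separated T \<Gamma> \<and> card \<Gamma> = 4 ^ T \<and> 0 \<in> \<Gamma> \<and> (\<forall>\<gamma>\<in>\<Gamma>. 0 \<le> \<gamma>) \<and>
     J \<subseteq> Beatty \<inter> {..<T} \<and> Plain J \<subseteq> \<Gamma> \<and> lacunary (\<Gamma> - Plain J)"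

section \<open>A single stage\<close>

lemma nextT_props:
  assumes "stage_inv T \<Gamma> J"
  shows "T < nextT i T \<Gamma> - (i + 1)" "\<gamma> \<in> \<Gamma> \<Longrightarrow> \<gamma> < N ^ (nextT i T \<Gamma> - (i + 1))"
    "real (nextT i T \<Gamma>) \<ge> (real i + 1) * (real T + real i + 2)" "i + 1 \<le> nextT i T \<Gamma>"
proof -
  have d: "nextT i T \<Gamma> - (i + 1) = (i + 1) * (T + i + 2) + nat (Max \<Gamma>) + 1"
    by (simp add: nextT_def)
  have "(i + 1) * (T + i + 2) = T + i + 2 + i * (T + i + 2)" by simp
  then show "T < nextT i T \<Gamma> - (i + 1)" unfolding d by (simp only:)
  show "i + 1 \<le> nextT i T \<Gamma>" by (simp add: nextT_def)
  show "real (nextT i T \<Gamma>) \<ge> (real i + 1) * (real T + real i + 2)"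
  proof -
    have "real (nextT i T \<Gamma>) \<ge> real ((i + 1) * (T + i + 2))" unfolding nextT_def by linarith
    then show ?thesis by (simp add: algebra_simps)
  qed
  assume "\<gamma> \<in> \<Gamma>"
  then have "\<gamma> \<le> Max \<Gamma>" using assms by (simp add: stage_inv_def)
  also have "Max \<Gamma> < int (nextT i T \<Gamma> - (i + 1))" unfolding d by linarith
  also have "\<dots> < 2 ^ (nextT i T \<Gamma> - (i + 1))" by (rule of_nat_less_two_power)
  also have "\<dots> \<le> N ^ (nextT i T \<Gamma> - (i + 1))" using N_gt by (intro power_mono) auto
  finally show "\<gamma> < N ^ (nextT i T \<Gamma> - (i + 1))" .
qed

lemma nextJ_subset:
  assumes "stage_inv T \<Gamma> J"
  shows "nextJ i T (nextT i T \<Gamma>) J \<subseteq> Beatty \<inter> {..<nextT i T \<Gamma> - (i + 1)}"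
  using assms nextT_props(1)[OF assms, of i] unfolding nextJ_def stage_inv_def
  by (auto intro: less_trans)

lemma finite_nextJ:
  assumes "stage_inv T \<Gamma> J"
  shows "finite (nextJ i T (nextT i T \<Gamma>) J)"
  using finite_subset[OF nextJ_subset[OF assms]] by simp

lemma kept_bounds:
  assumes "stage_inv T \<Gamma> J" "e \<in> kept i T \<Gamma> J"
  shows "0 \<le> e" "e < N ^ (nextT i T \<Gamma> - (i + 1))"
proof -
  have "nextJ i T (nextT i T \<Gamma>) J \<subseteq> {..<nextT i T \<Gamma> - (i + 1)}"
    using nextJ_subset[OF assms(1)] by blast
  note 1 = Plain_bounds[OF this]
  from assms(2) show "0 \<le> e" "e < N ^ (nextT i T \<Gamma> - (i + 1))"
    using assms(1) 1 nextT_props(2)[OF assms(1), of e i] unfolding kept_def stage_inv_def by auto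
qed

text \<open>A digit sum over J and the new positions splits at T: its low part lies in
  \<open>Plain J\<close>, hence in \<Gamma>, and its high part is one of the blocks that
  \<open>extend\<close> appends.\<close>

lemma kept_subset:
  assumes "stage_inv T \<Gamma> J"
  shows "kept i T \<Gamma> J \<subseteq> candidates i T \<Gamma>"
proof -
  define T' where "T' = nextT i T \<Gamma>"
  define q where "q = T' - T"
  have T: "T' = T + q" using nextT_props(1)[OF assms, of i] by (simp add: q_def T'_def)
  have "\<gamma> \<in> candidates i T \<Gamma>" if "\<gamma> \<in> \<Gamma>" for \<gamma>
    unfolding candidates_def extend_def using that zero_in_Plain
    by (intro rev_image_eqI[of "(\<gamma>, 0)"]) auto
  moreover have "x \<in> candidates i T \<Gamma>" if x: "x \<in> Plain (nextJ i T T' J)" for x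
  proof -
    define K where "K = Beatty \<inter> {T..<T' - (i + 1)}"
    obtain l where l: "\<And>j. l j \<in> Ldig" "x = (\<Sum>j\<in>J \<union> K. N ^ j * l j)"
      using x by (auto simp: Plain_def nextJ_def K_def)
    have J: "J \<subseteq> {..<T}" "finite J" using assms finite_subset[of J "{..<T}"] by (auto simp: stage_inv_def)
    have K: "finite K" "J \<inter> K = {}" using J by (auto simp: K_def)
    define c where "c = (\<Sum>i<q. N ^ i * (if i + T \<in> K then l (i + T) else 0))"
    have "(\<Sum>j\<in>K. N ^ j * l j) = (\<Sum>j=0+T..<q+T. if j \<in> K then N ^ j * l j else 0)"
      using K by (subst sum.inter_restrict[symmetric]) (auto simp: K_def T intro!: sum.cong)
    also have "\<dots> = (\<Sum>i=0..<q. if i + T \<in> K then N ^ (i + T) * l (i + T) else 0)"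
      by (rule sum.shift_bounds_nat_ivl)
    also have "\<dots> = N ^ T * c"
      unfolding c_def sum_distrib_left atLeast0LessThan
      by (intro sum.cong) (auto simp: power_add mult_ac)
    finally have "x = (\<Sum>j\<in>J. N ^ j * l j) + N ^ T * c"
      unfolding l(2) using J K by (simp add: sum.union_disjoint)
    moreover have "(\<Sum>j\<in>J. N ^ j * l j) \<in> \<Gamma>"
      using assms PlainI[of l J] l(1) by (auto simp: stage_inv_def)
    moreover have "c \<in> Plain {..<q}" unfolding c_def using l(1) by (intro PlainI) auto
    ultimately show ?thesis
      unfolding candidates_def extend_def T'_def[symmetric] q_def[symmetric] by auto
  qed
  ultimately show ?thesis by (auto simp: kept_def T'_def)
qed

lemma candidates_props:
  assumes "stage_inv T \<Gamma> J"
  shows "finite (candidates i T \<Gamma>)" "separated (nextT i T \<Gamma>) (candidates i T \<Gamma>)"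
    "card (candidates i T \<Gamma>) = 4 ^ nextT i T \<Gamma>"
    "e \<in> candidates i T \<Gamma> \<Longrightarrow> 0 \<le> e \<and> (\<exists>\<gamma>\<in>\<Gamma>. \<gamma> \<le> e \<and> N ^ T dvd e - \<gamma>)"
proof -
  define q where "q = nextT i T \<Gamma> - T"
  have T: "nextT i T \<Gamma> = T + q" using nextT_props(1)[OF assms, of i] by (simp add: q_def)
  have E: "candidates i T \<Gamma> = extend T \<Gamma> (Plain {..<q})" by (simp add: candidates_def q_def)
  have G: "finite \<Gamma>" "separated T \<Gamma>" "card \<Gamma> = 4 ^ T" using assms by (auto simp: stage_inv_def)
  show "finite (candidates i T \<Gamma>)" unfolding E extend_def using G finite_Plain_block by auto
  show "separated (nextT i T \<Gamma>) (candidates i T \<Gamma>)"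
    unfolding E T using separated_extend[OF G(2)] Plain_block by blast
  show "card (candidates i T \<Gamma>) = 4 ^ nextT i T \<Gamma>"
    unfolding E T using card_extend[OF G(2), of q "Plain {..<q}"] Plain_block[of q] G(3) by (simp add: power_add)
  assume "e \<in> candidates i T \<Gamma>"
  then obtain \<gamma> c where e: "\<gamma> \<in> \<Gamma>" "c \<in> Plain {..<q}" "e = \<gamma> + N ^ T * c" unfolding E by (auto simp: extend_def)
  have "0 \<le> c" using Plain_bounds(1)[OF _ e(2)] by blast
  then have "0 \<le> N ^ T * c" using N_gt by simp
  moreover have "0 \<le> \<gamma>" using assms e(1) by (auto simp: stage_inv_def)
  ultimately show "0 \<le> e \<and> (\<exists>\<gamma>\<in>\<Gamma>. \<gamma> \<le> e \<and> N ^ T dvd e - \<gamma>)"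
    using e by (intro conjI bexI[of _ \<gamma>]) auto
qed

lemma stepP_exists:
  assumes "stage_inv T \<Gamma> J"
  shows "\<exists>\<Gamma>'. stepP i B T \<Gamma> J \<Gamma>'"
proof -
  define T' where "T' = nextT i T \<Gamma>"
  define A where "A = candidates i T \<Gamma> - kept i T \<Gamma> J"
  define Q where "Q e y \<longleftrightarrow> (\<exists>Z\<ge>0. y = e + N ^ T' * Z) \<and>
     good (fst (cd (pseq i))) (snd (cd (pseq i)))
          (of_int (pseq i) * of_int m ^ k * (of_int y / of_int N ^ T'))" for e y :: int
  have Np: "N ^ T' \<ge> 1" using N_gt by simp
  have "\<exists>y>b. Q e y" if "e \<in> A" for e b
  proof -
    have e0: "e \<ge> 0" using candidates_props(4)[OF assms, of e i] that by (auto simp: A_def)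
    obtain Z :: int where Z: "Z > \<bar>b\<bar>" "good (fst (cd (pseq i))) (snd (cd (pseq i)))
        (of_int (pseq i) * of_int m ^ k * (of_int e / of_int N ^ T' + of_int Z))"
      using cd(3)[OF odd_pseq] by blast
    have "of_int e / of_int N ^ T' + of_int Z = of_int (e + N ^ T' * Z) / real_of_int N ^ T'"
      using N_real_gt by (simp add: add_divide_distrib)
    moreover have "1 * Z \<le> N ^ T' * Z" using Np Z(1) by (intro mult_right_mono) auto
    ultimately have "e + N ^ T' * Z > b" "Q e (e + N ^ T' * Z)"
      using Z e0 unfolding Q_def by (linarith, intro conjI exI[of _ Z]) simp_all
    then show ?thesis by blast
  qed
  moreover have "finite A" using candidates_props(1)[OF assms] by (simp add: A_def)
  ultimately obtain g where g: "\<forall>e\<in>A. Q e (g e) \<and> g e > max B (2 * Max \<Gamma>)" "lacunary (g ` A)"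
    using exists_lacunary_choice[of A Q "max B (2 * Max \<Gamma>)"] by blast
  define f where "f e = (if e \<in> A then g e else e)" for e
  have "f ` A = g ` A" by (auto simp: f_def)
  then have "stepf i B T \<Gamma> J f"
    unfolding stepf_def A_def[symmetric] T'_def[symmetric]
    using g by (auto simp: f_def Q_def A_def)
  then show ?thesis unfolding stepP_def by blast
qed

text \<open>Points move by multiples of \<open>N ^ T'\<close> only, which \<open>Dset T'\<close>
  does not see; so separation and cardinality pass from the candidates to the new set. The last
  claim provides a marker: the candidate with sole digit \<open>h1\<close> in the top position is
  too large to be kept, so its image exceeds B.\<close>

lemma stepP_props:
  assumes inv: "stage_inv T \<Gamma> J" and step: "stepP i B T \<Gamma> J \<Gamma>'"
  defines "T' \<equiv> nextT i T \<Gamma>"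
  defines "J' \<equiv> nextJ i T T' J"
  shows "stage_inv T' \<Gamma>' J'" "\<Gamma> \<subseteq> \<Gamma>'"
    "\<gamma>' \<in> \<Gamma>' \<Longrightarrow> \<exists>\<gamma>\<in>\<Gamma>. \<gamma> \<le> \<gamma>' \<and> N ^ T dvd \<gamma>' - \<gamma>"
    "\<gamma>' \<in> \<Gamma>' \<Longrightarrow> \<gamma>' < N ^ (T' - (i + 1)) \<or> good (fst (cd (pseq i))) (snd (cd (pseq i)))
        (of_int (pseq i) * of_int m ^ k * (of_int \<gamma>' / of_int N ^ T'))"
    "\<exists>\<gamma>'\<in>\<Gamma>'. \<gamma>' > B \<and> N ^ T' dvd \<gamma>' - N ^ (T' - 1) * h1"
proof -
  define E where "E = candidates i T \<Gamma>"
  define F where "F = kept i T \<Gamma> J"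
  obtain f where f: "\<Gamma>' = f ` E" "stepf i B T \<Gamma> J f"
    using step by (auto simp: stepP_def E_def)
  have fF: "f e = e" if "e \<in> F" for e using f(2) that by (auto simp: stepf_def F_def)
  have fE: "\<exists>Z\<ge>0. f e = e + N ^ T' * Z" "f e > B" "f e > 2 * Max \<Gamma>"
    "good (fst (cd (pseq i))) (snd (cd (pseq i))) (of_int (pseq i) * of_int m ^ k * (of_int (f e) / of_int N ^ T'))"
    if "e \<in> E - F" for e
    using f(2) that by (auto simp: stepf_def F_def E_def T'_def)
  have sp: "lacunary (f ` (E - F))" using f(2) by (simp add: stepf_def F_def E_def)
  have FE: "F \<subseteq> E" unfolding F_def E_def by (rule kept_subset[OF inv])
  note E = candidates_props[OF inv, where i = i, folded E_def T'_def]
  have shift: "\<exists>Z\<ge>0. f e = e + N ^ T' * Z" if "e \<in> E" for e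
    using fE(1)[of e] fF[of e] that by (cases "e \<in> F") (auto intro: exI[of _ 0])
  have ge: "e \<le> f e" "N ^ T' dvd f e - e" if e: "e \<in> E" for e
  proof -
    obtain Z where "Z \<ge> 0" "f e = e + N ^ T' * Z" using shift[OF e] by blast
    then show "e \<le> f e" "N ^ T' dvd f e - e" using N_gt by auto
  qed
  have diff: "f e - f e' \<in> Dset T'" if "e \<in> E" "e' \<in> E" "e \<noteq> e'" for e e'
  proof -
    obtain Z Z' where "f e = e + N ^ T' * Z" "f e' = e' + N ^ T' * Z'"
      using shift[OF \<open>e \<in> E\<close>] shift[OF \<open>e' \<in> E\<close>] by blast
    then have "f e - f e' = (e - e') + N ^ T' * (Z - Z')" by (simp add: algebra_simps)
    moreover have "e - e' \<in> Dset T'" using E(2) that by (auto simp: separated_def)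
    ultimately show ?thesis using Dset_add by simp
  qed
  have inj: "inj_on f E" using diff zero_notin_Dset by (metis inj_onI right_minus_eq)
  have J: "J \<subseteq> J'" "finite J'" using finite_nextJ[OF inv, of i] by (auto simp: J'_def T'_def nextJ_def)
  have GF: "\<Gamma> \<subseteq> F" and PF: "Plain J' \<subseteq> F" by (auto simp: F_def kept_def J'_def T'_def)
  have Fsub: "F \<subseteq> \<Gamma>'" using fF FE unfolding f(1) by (metis image_eqI subset_iff subsetI)
  show "\<Gamma> \<subseteq> \<Gamma>'" using GF Fsub by blast
  have finG: "finite \<Gamma>" using inv by (simp add: stage_inv_def)
  show "stage_inv T' \<Gamma>' J'"
    unfolding stage_inv_def
  proof (intro conjI)
    show "finite \<Gamma>'" using E(1) f(1) by simp
    show "separated T' \<Gamma>'" unfolding separated_def f(1) using diff by (metis (no_types, lifting) imageE)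
    show "card \<Gamma>' = 4 ^ T'" unfolding f(1) card_image[OF inj] by (rule E(3))
    show "0 \<in> \<Gamma>'" using inv GF Fsub by (auto simp: stage_inv_def)
    show "\<forall>\<gamma>\<in>\<Gamma>'. 0 \<le> \<gamma>" using ge(1) E(4) unfolding f(1) by force
    show "J' \<subseteq> Beatty \<inter> {..<T'}" using nextJ_subset[OF inv, of i] by (auto simp: J'_def T'_def)
    show "Plain J' \<subseteq> \<Gamma>'" using PF Fsub by blast
    have "\<Gamma>' \<subseteq> F \<union> f ` (E - F)" using fF unfolding f(1) by auto
    moreover have "F - Plain J' \<subseteq> \<Gamma> - Plain J"
      using Plain_mono[OF J] by (auto simp: F_def kept_def J'_def T'_def)
    ultimately have sub: "\<Gamma>' - Plain J' \<subseteq> (\<Gamma> - Plain J) \<union> f ` (E - F)" by blast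
    have "lacunary ((\<Gamma> - Plain J) \<union> f ` (E - F))"
      unfolding lacunary_def
    proof (intro ballI impI)
      fix x y assume xy: "x \<in> (\<Gamma> - Plain J) \<union> f ` (E - F)" "y \<in> (\<Gamma> - Plain J) \<union> f ` (E - F)" "x < y"
      have M: "0 \<le> z \<and> z \<le> Max \<Gamma>" if "z \<in> \<Gamma>" for z using that inv finG by (auto simp: stage_inv_def)
      have old: "lacunary (\<Gamma> - Plain J)" using inv by (simp add: stage_inv_def)
      from xy(1) show "2 * x \<le> y"
      proof
        assume x: "x \<in> \<Gamma> - Plain J"
        from xy(2) show ?thesis
        proof
          assume "y \<in> \<Gamma> - Plain J"
          then show ?thesis using old x xy(3) by (auto simp: lacunary_def)
        next
          assume "y \<in> f ` (E - F)"
          then have "y > 2 * Max \<Gamma>" using fE(3) by auto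
          then show ?thesis using M[of x] x by auto
        qed
      next
        assume x: "x \<in> f ` (E - F)"
        then have x2: "x > 2 * Max \<Gamma>" using fE(3) by auto
        from xy(2) show ?thesis
        proof
          assume "y \<in> \<Gamma> - Plain J"
          then show ?thesis using M[of y] x2 xy(3) by auto
        next
          assume "y \<in> f ` (E - F)"
          then show ?thesis using sp x xy(3) by (auto simp: lacunary_def)
        qed
      qed
    qed
    then show "lacunary (\<Gamma>' - Plain J')" using sub by (rule lacunary_subset)
  qed
  show "\<exists>\<gamma>\<in>\<Gamma>. \<gamma> \<le> \<gamma>' \<and> N ^ T dvd \<gamma>' - \<gamma>" if "\<gamma>' \<in> \<Gamma>'"
  proof -
    obtain e where e: "e \<in> E" "\<gamma>' = f e" using \<open>\<gamma>' \<in> \<Gamma>'\<close> unfolding f(1) by auto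
    obtain \<gamma> where g: "\<gamma> \<in> \<Gamma>" "\<gamma> \<le> e" "N ^ T dvd e - \<gamma>" using E(4)[OF e(1)] by blast
    have "N ^ T dvd N ^ T'" using nextT_props(1)[OF inv, of i] by (intro le_imp_power_dvd) (simp add: T'_def)
    then have "N ^ T dvd (f e - e) + (e - \<gamma>)" using ge(2)[OF e(1)] g(3) by (metis dvd_add dvd_trans)
    then show ?thesis using g ge(1)[OF e(1)] e(2) by (intro bexI[of _ \<gamma>]) auto
  qed
  show "\<gamma>' < N ^ (T' - (i + 1)) \<or> good (fst (cd (pseq i))) (snd (cd (pseq i)))
        (of_int (pseq i) * of_int m ^ k * (of_int \<gamma>' / of_int N ^ T'))" if "\<gamma>' \<in> \<Gamma>'"
  proof -
    obtain e where e: "e \<in> E" "\<gamma>' = f e" using \<open>\<gamma>' \<in> \<Gamma>'\<close> unfolding f(1) by auto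
    show ?thesis
    proof (cases "e \<in> F")
      case True
      then show ?thesis using kept_bounds(2)[OF inv, of e i] fF e(2) by (simp add: F_def T'_def)
    next
      case False
      then show ?thesis using fE(4)[of e] e by simp
    qed
  qed
  show "\<exists>\<gamma>'\<in>\<Gamma>'. \<gamma>' > B \<and> N ^ T' dvd \<gamma>' - N ^ (T' - 1) * h1"
  proof -
    define e where "e = N ^ (T' - 1) * h1"
    have T: "T < T'" "i + 1 \<le> T'" using nextT_props(1,4)[OF inv, of i] by (auto simp: T'_def)
    define q where "q = T' - T"
    have q: "q - 1 < q" "T' - 1 = T + (q - 1)" using T by (auto simp: q_def)
    have "N ^ (q - 1) * h1 = (\<Sum>j\<in>{q - 1}. N ^ j * h1)" by simp
    also have "\<dots> \<in> Plain {q - 1}" by (intro PlainI) (simp add: Ldig_def)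
    also have "Plain {q - 1} \<subseteq> Plain {..<q}" using q by (intro Plain_mono) auto
    finally have "N ^ (q - 1) * h1 \<in> Plain {..<q}" .
    moreover have "0 \<in> \<Gamma>" using inv by (simp add: stage_inv_def)
    ultimately have eE: "e \<in> E"
      unfolding E_def candidates_def extend_def T'_def[symmetric] q_def[symmetric] e_def q(2)
      by (intro rev_image_eqI[of "(0, N ^ (q - 1) * h1)"]) (auto simp: power_add)
    have "N ^ (T' - (i + 1)) \<le> N ^ (T' - 1)" using N_gt by (intro power_increasing) auto
    also have "\<dots> * 1 \<le> e" unfolding e_def using N_gt h_eqs(5) by (intro mult_left_mono) auto
    finally have "e \<notin> F" using kept_bounds(2)[OF inv, of e i] by (auto simp: F_def T'_def)
    then show ?thesis using fE(2)[of e] ge(2)[OF eE] eE unfolding f(1) e_def by auto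
  qed
qed

section \<open>Iteration of the stages and the limit set\<close>

text \<open>The second branch takes the maximum of the first as its bound B, which forces the marker
  points of the two outcomes apart.\<close>

primrec stage :: "(nat \<Rightarrow> bool) \<Rightarrow> nat \<Rightarrow> nat \<times> int set \<times> nat set" where
  "stage \<sigma> 0 = (0, {0}, {})"
| "stage \<sigma> (Suc n) = (let (T, \<Gamma>, J) = stage \<sigma> n; T' = nextT n T \<Gamma>;
      \<Gamma>0 = (SOME \<Gamma>'. stepP n 0 T \<Gamma> J \<Gamma>');
      \<Gamma>1 = (SOME \<Gamma>'. stepP n (Max \<Gamma>0) T \<Gamma> J \<Gamma>')
     in (T', if \<sigma> n then \<Gamma>1 else \<Gamma>0, nextJ n T T' J))"

definition level where "level \<sigma> n = fst (stage \<sigma> n)"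
definition stage_set where "stage_set \<sigma> n = fst (snd (stage \<sigma> n))"
definition free_digits where "free_digits \<sigma> n = snd (snd (stage \<sigma> n))"

definition stage_set0 where "stage_set0 \<sigma> n = (SOME \<Gamma>'. stepP n 0 (level \<sigma> n) (stage_set \<sigma> n) (free_digits \<sigma> n) \<Gamma>')"

lemma stage_Suc:
  "level \<sigma> (Suc n) = nextT n (level \<sigma> n) (stage_set \<sigma> n)"
  "free_digits \<sigma> (Suc n) = nextJ n (level \<sigma> n) (level \<sigma> (Suc n)) (free_digits \<sigma> n)"
  "stage_set \<sigma> (Suc n) = (if \<sigma> n then (SOME \<Gamma>'. stepP n (Max (stage_set0 \<sigma> n)) (level \<sigma> n) (stage_set \<sigma> n) (free_digits \<sigma> n) \<Gamma>') else stage_set0 \<sigma> n)"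
  unfolding level_def stage_set_def free_digits_def stage_set0_def by (auto simp: Let_def split: prod.split)

lemma stage_0: "level \<sigma> 0 = 0" "stage_set \<sigma> 0 = {0}" "free_digits \<sigma> 0 = {}"
  by (simp_all add: level_def stage_set_def free_digits_def)

lemma stage_step:
  assumes "stage_inv (level \<sigma> n) (stage_set \<sigma> n) (free_digits \<sigma> n)"
  shows "stepP n 0 (level \<sigma> n) (stage_set \<sigma> n) (free_digits \<sigma> n) (stage_set0 \<sigma> n)"
    "\<exists>B. stepP n B (level \<sigma> n) (stage_set \<sigma> n) (free_digits \<sigma> n) (stage_set \<sigma> (Suc n)) \<and> (\<sigma> n \<longrightarrow> B = Max (stage_set0 \<sigma> n))"
  using someI_ex[OF stepP_exists[OF assms]] by (auto simp: stage_set0_def stage_Suc(3))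

lemma inv_all: "stage_inv (level \<sigma> n) (stage_set \<sigma> n) (free_digits \<sigma> n)"
proof (induction n)
  case 0
  have "Plain {} = {0}" by (auto simp: Plain_def image_def intro!: exI[of _ "\<lambda>_. 0"])
  then show ?case by (simp add: stage_0 stage_inv_def separated_def lacunary_def)
next
  case (Suc n)
  obtain B where "stepP n B (level \<sigma> n) (stage_set \<sigma> n) (free_digits \<sigma> n) (stage_set \<sigma> (Suc n))" using stage_step(2)[OF Suc.IH] by blast
  from stepP_props(1)[OF Suc.IH this] show ?case by (simp add: stage_Suc(1,2))
qed

lemma stage_set_Suc:
  shows "stage_set \<sigma> n \<subseteq> stage_set \<sigma> (Suc n)"
    "\<gamma>' \<in> stage_set \<sigma> (Suc n) \<Longrightarrow> \<exists>\<gamma>\<in>stage_set \<sigma> n. \<gamma> \<le> \<gamma>' \<and> N ^ level \<sigma> n dvd \<gamma>' - \<gamma>"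
    "\<gamma>' \<in> stage_set \<sigma> (Suc n) \<Longrightarrow> \<gamma>' < N ^ (level \<sigma> (Suc n) - (n + 1)) \<or> good (fst (cd (pseq n))) (snd (cd (pseq n)))
        (of_int (pseq n) * of_int m ^ k * (of_int \<gamma>' / of_int N ^ level \<sigma> (Suc n)))"
proof -
  obtain B where "stepP n B (level \<sigma> n) (stage_set \<sigma> n) (free_digits \<sigma> n) (stage_set \<sigma> (Suc n))" using stage_step(2)[OF inv_all] by blast
  note * = stepP_props(2-4)[OF inv_all this, folded stage_Suc(1)]
  show "stage_set \<sigma> n \<subseteq> stage_set \<sigma> (Suc n)" by (rule *(1))
  show "\<gamma>' \<in> stage_set \<sigma> (Suc n) \<Longrightarrow> \<exists>\<gamma>\<in>stage_set \<sigma> n. \<gamma> \<le> \<gamma>' \<and> N ^ level \<sigma> n dvd \<gamma>' - \<gamma>" by (rule *(2))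
  show "\<gamma>' \<in> stage_set \<sigma> (Suc n) \<Longrightarrow> \<gamma>' < N ^ (level \<sigma> (Suc n) - (n + 1)) \<or> good (fst (cd (pseq n))) (snd (cd (pseq n)))
        (of_int (pseq n) * of_int m ^ k * (of_int \<gamma>' / of_int N ^ level \<sigma> (Suc n)))" by (rule *(3))
qed

lemma stage_set_mono: "n \<le> n' \<Longrightarrow> stage_set \<sigma> n \<subseteq> stage_set \<sigma> n'"
  using lift_Suc_mono_le[of "stage_set \<sigma>"] stage_set_Suc(1) by blast

lemma level_strict: "level \<sigma> n < level \<sigma> (Suc n)"
  using nextT_props(1)[OF inv_all[of \<sigma> n], of n] by (simp add: stage_Suc(1))

lemma strict_mono_level: "strict_mono (level \<sigma>)"
  by (rule strict_monoI_Suc) (rule level_strict)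

text \<open>New points arise by appending higher digits and moving upwards by multiples of a power
  of N, so each lies above a congruent point of any earlier stage.\<close>

lemma ancestor:
  "n \<le> n' \<Longrightarrow> \<gamma>' \<in> stage_set \<sigma> n' \<Longrightarrow> \<exists>\<gamma>\<in>stage_set \<sigma> n. \<gamma> \<le> \<gamma>' \<and> N ^ level \<sigma> n dvd \<gamma>' - \<gamma>"
proof (induction n' arbitrary: \<gamma>' rule: dec_induct)
  case base
  then show ?case by (intro bexI[of _ \<gamma>']) auto
next
  case (step n')
  obtain y where y: "y \<in> stage_set \<sigma> n'" "y \<le> \<gamma>'" "N ^ level \<sigma> n' dvd \<gamma>' - y" using stage_set_Suc(2)[OF step.prems] by blast
  obtain x where x: "x \<in> stage_set \<sigma> n" "x \<le> y" "N ^ level \<sigma> n dvd y - x" using step.IH[OF y(1)] by blast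
  have "N ^ level \<sigma> n dvd N ^ level \<sigma> n'"
    using step.hyps strict_mono_level[of \<sigma>] by (intro le_imp_power_dvd) (simp add: strict_mono_less_eq)
  then have "N ^ level \<sigma> n dvd (\<gamma>' - y) + (y - x)" using y(3) x(3) by (metis dvd_add dvd_trans)
  then show ?case using x y by (intro bexI[of _ x]) auto
qed

definition limit_set where "limit_set \<sigma> = (\<Union>n. stage_set \<sigma> n)"

lemma stage_cong: "(\<And>j. j < n \<Longrightarrow> \<sigma> j = \<sigma>' j) \<Longrightarrow> stage \<sigma> n = stage \<sigma>' n"
  by (induction n) (auto simp: Let_def)

text \<open>At the first differing index the two outcomes contain markers x < y in the same residue
  class modulo \<open>N ^ T'\<close>. If x also belonged to the limit set of the second outcome, its
  ancestor x' \<le> x would be another point of that class beside y, in a separated set.\<close>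

lemma inj_limit_set:
  assumes "limit_set \<sigma> = limit_set \<sigma>'"
  shows "\<sigma> = \<sigma>'"
proof (rule ccontr)
  have main: False if eq: "limit_set \<sigma> = limit_set \<sigma>'" and less: "\<And>j. j < n \<Longrightarrow> \<sigma> j = \<sigma>' j"
    and n: "\<not> \<sigma> n" "\<sigma>' n" for \<sigma> \<sigma>' :: "nat \<Rightarrow> bool" and n
  proof -
    have same: "level \<sigma>' n = level \<sigma> n" "stage_set \<sigma>' n = stage_set \<sigma> n" "free_digits \<sigma>' n = free_digits \<sigma> n"
      using stage_cong[OF less] by (simp_all add: level_def stage_set_def free_digits_def)
    have same0: "stage_set0 \<sigma>' n = stage_set0 \<sigma> n" by (simp add: stage_set0_def same)
    define T' where "T' = level \<sigma> (Suc n)"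
    have T': "level \<sigma>' (Suc n) = T'" by (simp add: T'_def stage_Suc(1) same)
    define e where "e = N ^ (T' - 1) * h1"
    have G0: "stage_set \<sigma> (Suc n) = stage_set0 \<sigma> n" using n by (simp add: stage_Suc(3))
    obtain x where x: "x \<in> stage_set \<sigma> (Suc n)" "N ^ T' dvd x - e"
      using stepP_props(5)[OF inv_all stage_step(1)[OF inv_all]] unfolding G0 by (auto simp: T'_def e_def stage_Suc(1))
    obtain B where B: "stepP n B (level \<sigma>' n) (stage_set \<sigma>' n) (free_digits \<sigma>' n) (stage_set \<sigma>' (Suc n))" "B = Max (stage_set0 \<sigma>' n)"
      using stage_step(2)[OF inv_all[of \<sigma>' n]] n by blast
    obtain y where y: "y \<in> stage_set \<sigma>' (Suc n)" "y > B" "N ^ T' dvd y - e"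
      using stepP_props(5)[OF inv_all B(1)] unfolding stage_Suc(1)[symmetric] T' e_def by blast
    have "finite (stage_set \<sigma> (Suc n))" using inv_all[of \<sigma> "Suc n"] by (simp add: stage_inv_def)
    then have "x \<le> B" unfolding B(2) same0 G0[symmetric] using x(1) by simp
    then have "x < y" using y(2) by simp
    have "x \<in> limit_set \<sigma>'" using x(1) eq by (auto simp: limit_set_def)
    then obtain n' where "x \<in> stage_set \<sigma>' n'" by (auto simp: limit_set_def)
    then have "x \<in> stage_set \<sigma>' (max n' (Suc n))" using stage_set_mono[where \<sigma> = \<sigma>' and n = n' and n' = "max n' (Suc n)"] by auto
    then obtain x' where x': "x' \<in> stage_set \<sigma>' (Suc n)" "x' \<le> x" "N ^ T' dvd x - x'"
      using ancestor[where \<sigma> = \<sigma>' and n = "Suc n" and n' = "max n' (Suc n)" and \<gamma>' = x] T' by auto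
    have "x' \<noteq> y" using x'(2) \<open>x < y\<close> by simp
    moreover have "separated T' (stage_set \<sigma>' (Suc n))" using inv_all[of \<sigma>' "Suc n"] T' by (simp add: stage_inv_def)
    ultimately have "y - x' \<in> Dset T'" using y(1) x'(1) by (auto simp: separated_def)
    moreover have "N ^ T' dvd (y - e) - (x - e) + (x - x')"
      by (rule dvd_add[OF dvd_diff[OF y(3) x(2)] x'(3)])
    then have "N ^ T' dvd y - x'" by simp
    then obtain z where "y - x' = N ^ T' * z" by (auto simp: dvd_def)
    ultimately show False using Dset_multiple by simp
  qed
  assume "\<sigma> \<noteq> \<sigma>'"
  then have ex: "\<exists>n. \<sigma> n \<noteq> \<sigma>' n" by auto
  define n where "n = (LEAST n. \<sigma> n \<noteq> \<sigma>' n)"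
  have n: "\<sigma> n \<noteq> \<sigma>' n" "\<And>j. j < n \<Longrightarrow> \<sigma> j = \<sigma>' j"
    using LeastI_ex[OF ex] not_less_Least unfolding n_def by blast+
  show False
  proof (cases "\<sigma> n")
    case True
    then show ?thesis using main[of \<sigma>' \<sigma> n] assms n by auto
  next
    case False
    then show ?thesis using main[of \<sigma> \<sigma>' n] assms n by auto
  qed
qed

text \<open>Only the positions added in the last stage are counted. Missing are those below the old
  level T and the top n + 1; with the rounding error this is at most T + n + 2, which
  \<open>nextT\<close> keeps below T' / (n + 1).\<close>

lemma card_free_digits: "real (card (free_digits \<sigma> (Suc n))) \<ge> \<alpha> * real (level \<sigma> (Suc n)) - real (level \<sigma> (Suc n)) / (real n + 1)"
proof -
  define T where "T = level \<sigma> n"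
  define T' where "T' = level \<sigma> (Suc n)"
  note T = nextT_props[OF inv_all[of \<sigma> n], of n, folded stage_Suc(1) T_def T'_def]
  have "Beatty \<inter> {T..<T' - (n + 1)} \<subseteq> free_digits \<sigma> (Suc n)" by (auto simp: stage_Suc(2) nextJ_def T_def T'_def)
  moreover have "finite (free_digits \<sigma> (Suc n))"
    using finite_nextJ[OF inv_all[of \<sigma> n], of n] by (simp add: stage_Suc)
  ultimately have 1: "card (Beatty \<inter> {T..<T' - (n + 1)}) \<le> card (free_digits \<sigma> (Suc n))" by (rule card_mono[rotated])
  have "Beatty \<inter> {..<T' - (n + 1)} = (Beatty \<inter> {..<T}) \<union> (Beatty \<inter> {T..<T' - (n + 1)})" using T(1) by auto
  then have "card (Beatty \<inter> {..<T' - (n + 1)}) = card (Beatty \<inter> {..<T}) + card (Beatty \<inter> {T..<T' - (n + 1)})"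
    by (simp add: card_Un_disjoint[symmetric] disjoint_iff)
  then have "int (card (Beatty \<inter> {T..<T' - (n + 1)})) = \<lfloor>\<alpha> * real (T' - (n + 1))\<rfloor> - \<lfloor>\<alpha> * real T\<rfloor>"
    unfolding card_Beatty[symmetric] by simp
  then have "real (card (Beatty \<inter> {T..<T' - (n + 1)})) = of_int \<lfloor>\<alpha> * real (T' - (n + 1))\<rfloor> - of_int \<lfloor>\<alpha> * real T\<rfloor>"
    by (metis of_int_diff of_int_of_nat_eq)
  then have 2: "real (card (free_digits \<sigma> (Suc n))) \<ge> \<alpha> * real (T' - (n + 1)) - 1 - \<alpha> * real T"
    using 1 floor_correct[of "\<alpha> * real (T' - (n + 1))"] floor_correct[of "\<alpha> * real T"] by linarith
  have "\<alpha> * real (T' - (n + 1)) = \<alpha> * real T' - \<alpha> * real (n + 1)"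
    using T(4) by (simp add: of_nat_diff algebra_simps)
  moreover have "\<alpha> * real (n + 1) \<le> 1 * real (n + 1)" "\<alpha> * real T \<le> 1 * real T"
    using \<alpha> by (intro mult_right_mono; simp)+
  moreover have "1 * real (n + 1) = real n + 1" "1 * real T = real T" by simp_all
  ultimately have "real (card (free_digits \<sigma> (Suc n))) \<ge> \<alpha> * real T' - (real T + real n + 2)"
    using 2 by linarith
  moreover have "real T + real n + 2 \<le> real T' / (real n + 1)"
    using T(3) by (simp add: field_simps)
  ultimately show ?thesis by (simp add: T'_def)
qed

end

section \<open>Completeness\<close>

context four_digit_construction
begin

definition Spec :: "(nat \<Rightarrow> bool) \<Rightarrow> real set" where
  "Spec \<sigma> = Lam (limit_set \<sigma>)"

lemma Lam_mono: "A \<subseteq> B \<Longrightarrow> Lam A \<subseteq> Lam B"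
  unfolding Lam_def by (intro image_mono) auto

lemma Spec_eq: "Spec \<sigma> = (\<Union>n. Lam (stage_set \<sigma> n))"
  unfolding Spec_def Lam_def limit_set_def by auto

lemma Lam_stage_set_mono: "n \<le> n' \<Longrightarrow> Lam (stage_set \<sigma> n) \<subseteq> Lam (stage_set \<sigma> n')"
  by (intro Lam_mono stage_set_mono)

lemma stage_set_props: "finite (stage_set \<sigma> n)" "separated (level \<sigma> n) (stage_set \<sigma> n)" "card (stage_set \<sigma> n) = 4 ^ level \<sigma> n"
  "0 \<in> stage_set \<sigma> n" "\<gamma> \<in> stage_set \<sigma> n \<Longrightarrow> 0 \<le> \<gamma>"
  using inv_all[of \<sigma> n] by (auto simp: stage_inv_def)

lemma finite_Lam_stage_set: "finite (Lam (stage_set \<sigma> n))"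
  unfolding Lam_def using stage_set_props(1) by simp

lemma finite_subset_Spec:
  assumes "finite F" "F \<subseteq> Spec \<sigma>"
  shows "\<exists>n. F \<subseteq> Lam (stage_set \<sigma> n)"
  using assms
proof (induction F rule: finite_induct)
  case (insert x F)
  then obtain n n' where "F \<subseteq> Lam (stage_set \<sigma> n)" "x \<in> Lam (stage_set \<sigma> n')" by (auto simp: Spec_eq)
  then have "insert x F \<subseteq> Lam (stage_set \<sigma> (max n n'))"
    using Lam_stage_set_mono[of n "max n n'" \<sigma>] Lam_stage_set_mono[of n' "max n n'" \<sigma>] by auto
  then show ?case by blast
qed simp

lemma Spec_difference:
  assumes "x \<in> Spec \<sigma>" "y \<in> Spec \<sigma>" "x \<noteq> y"
  shows "\<exists>T. at_zero T (x - y)"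
proof -
  obtain n where "{x, y} \<subseteq> Lam (stage_set \<sigma> n)" using finite_subset_Spec[of "{x, y}" \<sigma>] assms by auto
  then show ?thesis using Lam_difference[OF stage_set_props(2)] assms(3) by blast
qed

lemma orth_Spec:
  assumes "odd p"
  shows "orth ((\<lambda>l. of_int p * l) ` Spec \<sigma>)"
  unfolding orth_def
proof (intro ballI impI)
  fix l l' assume l: "l \<in> (\<lambda>l. of_int p * l) ` Spec \<sigma>" "l' \<in> (\<lambda>l. of_int p * l) ` Spec \<sigma>" "l \<noteq> l'"
  then obtain x y where xy: "x \<in> Spec \<sigma>" "y \<in> Spec \<sigma>" "l = of_int p * x" "l' = of_int p * y" by auto
  then obtain T where "at_zero T (x - y)" using Spec_difference l(3) by blast
  from at_zero_zero(2)[OF this assms] show "ft \<mu> (l - l') = 0" by (simp add: xy right_diff_distrib)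
qed

lemma bb_bounds:
  assumes "S \<subseteq> {1..k}"
  shows "0 \<le> bb S" "bb S \<le> bb {1..k}"
proof -
  have p: "0 \<le> real_of_int N ^ j" for j using N_real_gt by simp
  show "0 \<le> bb S" unfolding bb_def by (intro divide_nonneg_pos sum_nonneg p) auto
  show "bb S \<le> bb {1..k}"
    unfolding bb_def using assms by (intro divide_right_mono sum_mono2 p) auto
qed

text \<open>At a stage serving p every point is either in a good position or small compared with
  \<open>N ^ T'\<close>; in the second case the rescaled argument is near 0, where |ft| \<ge> 1/2.
  The frequency \<xi> and the low bits enter through \<eta> only, which is small at late stages;
  hence c is the same for all of these.\<close>

lemma truncated_le_ft_stage:
  assumes p: "odd p"
  shows "\<exists>c>0. \<exists>n0. \<forall>n\<ge>n0. pseq n = p \<longrightarrow>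
    (\<forall>l\<in>Lam (stage_set \<sigma> (Suc n)). c * cmod (truncated (level \<sigma> (Suc n)) (\<xi> + of_int p * l)) \<le> cmod (ft \<mu> (\<xi> + of_int p * l)))"
proof -
  define c1 d1 where "c1 = fst (cd p)" and "d1 = snd (cd p)"
  have c1: "c1 > 0" "d1 > 0" using cd[OF p] by (auto simp: c1_def d1_def)
  obtain d0 where d0: "d0 > 0" "\<And>y. \<bar>y\<bar> < d0 \<Longrightarrow> cmod (ft \<mu> y) \<ge> 1 / 2"
  proof -
    have "eventually (\<lambda>y. cmod (ft \<mu> y) \<ge> cmod (ft \<mu> 0) / 2) (nhds 0)"
      by (rule eventually_half_norm[OF isCont_ft]) simp
    then show ?thesis using that unfolding eventually_nhds_metric dist_real_def by auto
  qed
  define C where "C = \<bar>\<xi>\<bar> + \<bar>of_int p\<bar> * bb {1..k}"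
  define A where "A = \<bar>of_int p\<bar> * real_of_int m ^ k"
  have C0: "0 \<le> C" "0 \<le> A" using bb_bounds(1)[of "{1..k}"] m_pos by (auto simp: C_def A_def)
  have "(\<lambda>n. (C + A) / real_of_int N ^ Suc n) \<longlonglongrightarrow> 0"
    using N_power_tendsto[THEN LIMSEQ_Suc] .
  then have "eventually (\<lambda>n. (C + A) / real_of_int N ^ Suc n < min d0 d1) sequentially"
    using d0(1) c1(2) by (intro order_tendstoD(2)) auto
  then obtain n0 where n0: "\<And>n. n \<ge> n0 \<Longrightarrow> (C + A) / real_of_int N ^ Suc n < min d0 d1"
    by (auto simp: eventually_sequentially)
  have main: "min c1 (1 / 2) * cmod (truncated (level \<sigma> (Suc n)) (\<xi> + of_int p * l)) \<le> cmod (ft \<mu> (\<xi> + of_int p * l))"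
    if n: "n \<ge> n0" "pseq n = p" and l: "l \<in> Lam (stage_set \<sigma> (Suc n))" for n l
  proof (rule truncated_le_ft)
    define T' where "T' = level \<sigma> (Suc n)"
    have T': "Suc n \<le> T'" unfolding T'_def using strict_mono_imp_increasing[OF strict_mono_level] .
    obtain S \<gamma> where S: "S \<subseteq> {1..k}" and g: "\<gamma> \<in> stage_set \<sigma> (Suc n)" and l_eq: "l = bb S + of_int m ^ k * of_int \<gamma>"
      using l by (auto simp: Lam_def)
    define \<eta> where "\<eta> = (\<xi> + of_int p * bb S) / of_int N ^ T'"
    define y where "y = real_of_int p * of_int m ^ k * (of_int \<gamma> / of_int N ^ T')"
    have eq: "(\<xi> + of_int p * l) / of_int N ^ T' = y + \<eta>"
      by (simp add: l_eq y_def \<eta>_def add_divide_distrib distrib_left)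
    have NT: "real_of_int N ^ Suc n \<le> of_int N ^ T'"
      using N_real_gt T' by (intro power_increasing) auto
    have NT': "0 < real_of_int N ^ Suc n" "0 < real_of_int N ^ T'"
      using N_real_gt by (intro zero_less_power; simp)+
    have "\<bar>\<xi> + of_int p * bb S\<bar> \<le> \<bar>\<xi>\<bar> + \<bar>of_int p\<bar> * bb S"
      using bb_bounds[OF S] by (intro order_trans[OF abs_triangle_ineq]) (simp add: abs_mult)
    also have "\<dots> \<le> C" unfolding C_def using bb_bounds[OF S] by (intro add_mono mult_left_mono) auto
    finally have "\<bar>\<eta>\<bar> \<le> C / of_int N ^ T'"
      unfolding \<eta>_def using N_real_gt by (simp add: abs_divide divide_right_mono)
    also have "\<dots> \<le> C / of_int N ^ Suc n" using NT NT' C0 by (intro divide_left_mono mult_pos_pos)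
    finally have eta: "\<bar>\<eta>\<bar> \<le> C / of_int N ^ Suc n" .
    have sm: "C / of_int N ^ Suc n + A / of_int N ^ Suc n < d0" "C / of_int N ^ Suc n + A / of_int N ^ Suc n < d1"
      using n0[OF n(1)] by (simp_all add: add_divide_distrib)
    have A0: "0 \<le> A / of_int N ^ Suc n" using C0 NT' by (intro divide_nonneg_pos)
    from stage_set_Suc(3)[OF g]
    have "min c1 (1 / 2) * half_mask_prod (y + \<eta>) \<le> cmod (ft \<mu> (y + \<eta>))"
    proof
      assume "good (fst (cd (pseq n))) (snd (cd (pseq n)))
        (of_int (pseq n) * of_int m ^ k * (of_int \<gamma> / of_int N ^ level \<sigma> (Suc n)))"
      then have "good c1 d1 y" using n(2) by (simp add: c1_def d1_def y_def T'_def)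
      then have "c1 * half_mask_prod (y + \<eta>) \<le> cmod (ft \<mu> (y + \<eta>))" using eta sm(2) A0 by (auto simp: good_def)
      moreover have "min c1 (1 / 2) * half_mask_prod (y + \<eta>) \<le> c1 * half_mask_prod (y + \<eta>)"
        by (intro mult_right_mono half_mask_prod_bounds) auto
      ultimately show ?thesis by linarith
    next
      assume "\<gamma> < N ^ (level \<sigma> (Suc n) - (n + 1))"
      then have "real_of_int \<gamma> < of_int N ^ (T' - Suc n)" by (metis T'_def Suc_eq_plus1 of_int_less_iff of_int_power)
      moreover have "real_of_int N ^ T' = of_int N ^ (T' - Suc n) * of_int N ^ Suc n"
        unfolding power_add[symmetric] using T' by simp
      moreover have "0 \<le> real_of_int \<gamma>" using stage_set_props(5)[OF g] by simp
      ultimately have "\<bar>of_int \<gamma> / of_int N ^ T'\<bar> \<le> 1 / real_of_int N ^ Suc n"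
        using N_real_gt by (simp add: field_simps)
      then have "A * \<bar>of_int \<gamma> / of_int N ^ T'\<bar> \<le> A * (1 / real_of_int N ^ Suc n)"
        using C0(2) by (rule mult_left_mono)
      then have "\<bar>y\<bar> \<le> A / of_int N ^ Suc n"
        using m_pos by (simp add: y_def A_def abs_mult)
      then have "\<bar>y + \<eta>\<bar> < d0" using eta sm(1) by linarith
      then have "cmod (ft \<mu> (y + \<eta>)) \<ge> 1 / 2" by (rule d0(2))
      moreover have "min c1 (1 / 2) * half_mask_prod (y + \<eta>) \<le> (1 / 2) * 1"
        using c1(1) half_mask_prod_bounds by (intro mult_mono) auto
      ultimately show ?thesis by linarith
    qed
    then show "min c1 (1 / 2) * half_mask_prod ((\<xi> + of_int p * l) / of_int N ^ level \<sigma> (Suc n)) \<le>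
        cmod (ft \<mu> ((\<xi> + of_int p * l) / of_int N ^ level \<sigma> (Suc n)))"
      unfolding T'_def[symmetric] eq .
  qed
  show ?thesis
    using main c1(1) by (intro exI[of _ "min c1 (1 / 2)"] conjI exI[of _ n0]) auto
qed

text \<open>Let \<open>S n\<close> be the mass captured by stage \<open>n\<close>, with limit \<open>s\<close>. The approximations have mass \<open>1\<close>
  and converge to \<open>ft\<close> on each fixed stage, so domination gives \<open>c\<^sup>2 * (1 - S n) \<le> s - S n\<close>, and
  \<open>n \<longlonglongrightarrow> \<infinity>\<close> forces \<open>s \<ge> 1\<close>.\<close>

lemma Spec_complete:
  assumes p: "odd p" and e: "\<epsilon> > 0"
  shows "\<exists>F. finite F \<and> F \<subseteq> Spec \<sigma> \<and> (\<Sum>l\<in>F. (cmod (ft \<mu> (\<xi> + of_int p * l)))\<^sup>2) > 1 - \<epsilon>"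
proof (rule ccontr)
  assume neg: "\<not> ?thesis"
  define w where "w l = (cmod (ft \<mu> (\<xi> + of_int p * l)))\<^sup>2" for l
  define h where "h T l = (cmod (truncated T (\<xi> + of_int p * l)))\<^sup>2" for T l
  have le: "sum w F \<le> 1 - \<epsilon>" if "finite F" "F \<subseteq> Spec \<sigma>" for F
    using neg that by (force simp: w_def not_less)
  define S where "S n = sum w (Lam (stage_set \<sigma> n))" for n
  have Sle: "S n \<le> 1 - \<epsilon>" for n
    unfolding S_def by (intro le finite_Lam_stage_set) (auto simp: Spec_eq)
  have w0: "0 \<le> w l" for l by (simp add: w_def)
  have "incseq S"
    unfolding S_def by (intro incseq_SucI sum_mono2 finite_Lam_stage_set Lam_stage_set_mono w0) auto
  then obtain s where s: "S \<longlonglongrightarrow> s" "\<And>n. S n \<le> s"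
    using incseq_convergent[of S "1 - \<epsilon>"] Sle by auto
  have s1: "s \<le> 1 - \<epsilon>" using LIMSEQ_le_const2[OF s(1)] Sle by blast
  obtain c n0 where c: "c > 0" and n0: "\<And>n l. n \<ge> n0 \<Longrightarrow> pseq n = p \<Longrightarrow> l \<in> Lam (stage_set \<sigma> (Suc n)) \<Longrightarrow>
      c * cmod (truncated (level \<sigma> (Suc n)) (\<xi> + of_int p * l)) \<le> cmod (ft \<mu> (\<xi> + of_int p * l))"
    using truncated_le_ft_stage[OF p, of \<sigma> \<xi>] by blast
  have key: "c\<^sup>2 * (1 - S n') \<le> s - S n'" for n'
  proof (rule ccontr)
    assume "\<not> ?thesis"
    then have lt: "s - S n' < c\<^sup>2 * (1 - S n')" by simp
    have level_lim: "filterlim (\<lambda>n. level \<sigma> (Suc n)) sequentially sequentially"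
      using filterlim_subseq[OF strict_mono_level] filterlim_Suc filterlim_compose by blast
    have "(\<lambda>n. sum (h (level \<sigma> (Suc n))) (Lam (stage_set \<sigma> n'))) \<longlonglongrightarrow> S n'"
      unfolding S_def w_def h_def
      by (intro tendsto_sum tendsto_power filterlim_compose[OF truncated_tendsto level_lim])
    then have "(\<lambda>n. c\<^sup>2 * (1 - sum (h (level \<sigma> (Suc n))) (Lam (stage_set \<sigma> n')))) \<longlonglongrightarrow> c\<^sup>2 * (1 - S n')"
      by (intro tendsto_intros)
    from order_tendstoD(1)[OF this lt]
    obtain n1 where n1: "\<And>n. n \<ge> n1 \<Longrightarrow> s - S n' < c\<^sup>2 * (1 - sum (h (level \<sigma> (Suc n))) (Lam (stage_set \<sigma> n')))"
      by (auto simp: eventually_sequentially)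
    \<comment> \<open>Since p recurs infinitely often, some stage beyond all thresholds serves
      it.\<close>
    obtain n where n: "n \<ge> max n1 (max n0 n')" "pseq n = p" using pseq_infinitely_often[OF p] by blast
    define R where "R = Lam (stage_set \<sigma> (Suc n)) - Lam (stage_set \<sigma> n')"
    have sub: "Lam (stage_set \<sigma> n') \<subseteq> Lam (stage_set \<sigma> (Suc n))" using n by (intro Lam_stage_set_mono) auto
    have "sum (h (level \<sigma> (Suc n))) (Lam (stage_set \<sigma> (Suc n))) = 1"
      unfolding h_def by (rule sum_truncated_Lam[OF stage_set_props(2,1,3) p])
    then have 1: "sum (h (level \<sigma> (Suc n))) R = 1 - sum (h (level \<sigma> (Suc n))) (Lam (stage_set \<sigma> n'))"
      unfolding R_def using sum_diff[OF finite_Lam_stage_set sub, of "h (level \<sigma> (Suc n))"] by simp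
    have "c\<^sup>2 * sum (h (level \<sigma> (Suc n))) R \<le> sum w R"
      unfolding sum_distrib_left
    proof (rule sum_mono)
      fix l assume "l \<in> R"
      then have "c * cmod (truncated (level \<sigma> (Suc n)) (\<xi> + of_int p * l)) \<le> cmod (ft \<mu> (\<xi> + of_int p * l))"
        using n by (intro n0) (auto simp: R_def)
      then have "(c * cmod (truncated (level \<sigma> (Suc n)) (\<xi> + of_int p * l)))\<^sup>2 \<le> (cmod (ft \<mu> (\<xi> + of_int p * l)))\<^sup>2"
        using c by (intro power_mono) auto
      then show "c\<^sup>2 * h (level \<sigma> (Suc n)) l \<le> w l" by (simp add: h_def w_def power_mult_distrib)
    qed
    also have "sum w R = S (Suc n) - S n'"
      unfolding R_def S_def by (rule sum_diff[OF finite_Lam_stage_set sub])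
    also have "\<dots> \<le> s - S n'" using s(2) by simp
    finally show False using n1[of n] n(1) unfolding 1 by simp
  qed
  have "c\<^sup>2 * (1 - s) \<le> s - s"
  proof (rule LIMSEQ_le)
    show "(\<lambda>n. c\<^sup>2 * (1 - S n)) \<longlonglongrightarrow> c\<^sup>2 * (1 - s)" by (intro tendsto_intros s(1))
    show "(\<lambda>n. s - S n) \<longlonglongrightarrow> s - s" by (intro tendsto_intros s(1))
  qed (use key in blast)
  moreover have "c\<^sup>2 * (1 - s) > 0" using c s1 e by simp
  ultimately show False by simp
qed

lemma countable_Spec: "countable (Spec \<sigma>)"
  unfolding Spec_eq using finite_Lam_stage_set by (intro countable_UN) (auto intro: countable_finite)

lemma is_spectrum_Spec:
  assumes p: "odd p"
  shows "is_spectrum \<mu> ((\<lambda>l. of_int p * l) ` Spec \<sigma>)"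
proof (rule is_spectrumI[OF spectral])
  show "countable ((\<lambda>l. of_int p * l) ` Spec \<sigma>)" using countable_Spec by simp
  show "orth ((\<lambda>l. of_int p * l) ` Spec \<sigma>)" by (rule orth_Spec[OF p])
  fix \<xi> \<epsilon> :: real assume "\<epsilon> > 0"
  then obtain F where F: "finite F" "F \<subseteq> Spec \<sigma>" "(\<Sum>l\<in>F. (cmod (ft \<mu> (- \<xi> + of_int p * l)))\<^sup>2) > 1 - \<epsilon>"
    using Spec_complete[OF p \<open>\<epsilon> > 0\<close>, of \<sigma> "- \<xi>"] by (elim exE conjE)
  have p0: "real_of_int p \<noteq> 0" using p by auto
  have "cmod (ft \<mu> (\<xi> - of_int p * l)) = cmod (ft \<mu> (- \<xi> + of_int p * l))" for l
  proof -
    have "- \<xi> + of_int p * l = - (\<xi> - of_int p * l)" by simp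
    then show ?thesis by (simp only: ft_minus complex_mod_cnj)
  qed
  moreover have "inj_on (\<lambda>l. of_int p * l) F" using p0 by (simp add: inj_on_def)
  ultimately have "(\<Sum>l\<in>(\<lambda>l. of_int p * l) ` F. (cmod (ft \<mu> (\<xi> - l)))\<^sup>2) > 1 - \<epsilon>"
    using F(3) by (simp add: sum.reindex)
  with F show "\<exists>F. finite F \<and> F \<subseteq> (\<lambda>l. of_int p * l) ` Spec \<sigma> \<and> (\<Sum>l\<in>F. (cmod (ft \<mu> (\<xi> - l)))\<^sup>2) > 1 - \<epsilon>"
    by (intro exI[of _ "(\<lambda>l. of_int p * l) ` F"]) auto
qed

end

section \<open>The smallest 2-adic valuation in a spectrum\<close>

context four_digit_measure
begin

text \<open>Parseval for the image of \<open>\<mu>\<close> under the digit map \<open>x \<mapsto> x / N\<close>, whose density is at most \<open>4\<close>: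
  a spectrum captures at least as much of it as any orthogonal family.\<close>

lemma spectrum_dominates_orth:
  assumes \<Lambda>: "is_spectrum \<mu> \<Lambda>" and F0: "finite F0" "orth F0" and K: "K \<ge> 0"
    and bound: "\<And>F. finite F \<Longrightarrow> F \<subseteq> \<Lambda> \<Longrightarrow> (\<Sum>l\<in>F. (cmod (ft \<mu> (l / of_int N)))\<^sup>2) \<le> K"
  shows "(\<Sum>l\<in>F0. (cmod (ft \<mu> (l / of_int N)))\<^sup>2) \<le> K"
proof -
  define A where "A = (\<Sum>l\<in>F0. (cmod (ft \<mu> (l / of_int N)))\<^sup>2)"
  have A0: "A \<ge> 0" by (simp add: A_def sum_nonneg)
  have int_trig: "(\<integral>x. trig F d (x / of_int N) \<partial>\<mu>) = (\<Sum>l\<in>F. d l * ft \<mu> (l / of_int N))" for F d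
  proof -
    have "trig F d (x / of_int N) = (\<Sum>l\<in>F. d l * expo (l / of_int N) x)" for x
      by (simp add: trig_def expo_ee)
    then show ?thesis by (simp add: Bochner_Integration.integral_sum ft_def[symmetric])
  qed
  \<comment> \<open>With these coefficients both the squared norm of g and the integral of g (x / N)
    equal A. Comparing the two through \<Lambda> gives A \<le> sqrt A * sqrt K in the limit.\<close>
  define g where "g = trig F0 (\<lambda>l. cnj (ft \<mu> (l / of_int N)))"
  have g2: "(\<integral>x. (cmod (g x))\<^sup>2 \<partial>\<mu>) = A"
    unfolding g_def integral_trig_sq_orth[OF F0] by (simp add: A_def)
  have g1: "(\<integral>x. g (x / of_int N) \<partial>\<mu>) = of_real A"
    unfolding g_def int_trig A_def
    by (simp add: complex_norm_square mult.commute del: of_real_power)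
  have ineq: "A \<le> 2 * \<epsilon> + sqrt ((1 + \<epsilon>) * A + \<epsilon>\<^sup>2 + \<epsilon>) * sqrt K" if e: "\<epsilon> > 0" for \<epsilon>
  proof -
    have gL2: "g \<in> L2 \<mu>"
      unfolding L2_def g_def using borel_measurable_integrable[OF integrable_trig] by simp
    obtain F d where F: "finite F" "F \<subseteq> \<Lambda>" and d: "L2_norm \<mu> (\<lambda>x. g x - trig F d x) < \<epsilon>"
      by (rule is_spectrum_approx[OF \<Lambda> gL2 e])
    have oF: "orth F" using orth_subset[OF is_spectrum_orth[OF \<Lambda>] F(2)] .
    define v where "v x = g x - trig F d x" for x
    define B where "B = (\<Sum>l\<in>F0. cmod (cnj (ft \<mu> (l / of_int N)))) + (\<Sum>l\<in>F. cmod (d l))"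
    have cv: "continuous_on U v" for U
      unfolding v_def g_def by (intro continuous_intros)
    have bv: "cmod (v x) \<le> B" for x
      unfolding v_def g_def B_def
      by (intro order_trans[OF norm_triangle_ineq4] add_mono norm_trig_le)
    have cvN: "continuous_on UNIV (\<lambda>x. v (x / of_int N))"
      by (rule continuous_on_compose2[OF cv[of UNIV]]) (auto simp: divide_inverse intro!: continuous_intros)
    have iv2: "integrable \<mu> (\<lambda>x. (cmod (v x))\<^sup>2)"
      by (rule integrable_bounded_continuous[where B = "B\<^sup>2"])
         (auto intro!: continuous_intros cv power_mono bv)
    have ivN2: "integrable \<mu> (\<lambda>x. (cmod (v (x / of_int N)))\<^sup>2)"
      by (rule integrable_bounded_continuous[where B = "B\<^sup>2"])
         (auto intro!: continuous_intros cvN power_mono bv)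
    have ivN: "integrable \<mu> (\<lambda>x. v (x / of_int N))"
      by (rule integrable_bounded_continuous[OF cvN bv])
    have v2: "(\<integral>x. (cmod (v x))\<^sup>2 \<partial>\<mu>) < \<epsilon>\<^sup>2"
    proof -
      have "sqrt (\<integral>x. (cmod (v x))\<^sup>2 \<partial>\<mu>) < sqrt (\<epsilon>\<^sup>2)"
        using d e by (simp add: L2_norm_def v_def)
      then show ?thesis by (simp only: real_sqrt_less_iff)
    qed
    have vN2: "(\<integral>x. (cmod (v (x / of_int N)))\<^sup>2 \<partial>\<mu>) \<le> 4 * \<epsilon>\<^sup>2"
    proof -
      have "(\<integral>x. (cmod (v (x / of_int N)))\<^sup>2 \<partial>\<mu>) \<le> 4 * (\<integral>x. (cmod (v x))\<^sup>2 \<partial>\<mu>)"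
        by (rule integral_scale_le[where B = "B\<^sup>2"])
           (auto intro!: continuous_intros cv power_mono bv)
      then show ?thesis using v2 by simp
    qed
    have "cmod (\<integral>x. v (x / of_int N) \<partial>\<mu>) \<le> (\<integral>x. cmod (v (x / of_int N)) \<partial>\<mu>)"
      by (rule integral_norm_bound)
    \<comment> \<open>The bound t \<le> \<epsilon> + t^2 / (4 * \<epsilon>) takes the place of
      Cauchy-Schwarz for integrals.\<close>
    also have "\<dots> \<le> (\<integral>x. \<epsilon> + (cmod (v (x / of_int N)))\<^sup>2 / (4 * \<epsilon>) \<partial>\<mu>)"
    proof (rule integral_mono)
      show "cmod (v (x / of_int N)) \<le> \<epsilon> + (cmod (v (x / of_int N)))\<^sup>2 / (4 * \<epsilon>)" for x
      proof -
        have "0 \<le> (cmod (v (x / of_int N)) - 2 * \<epsilon>)\<^sup>2" by simp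
        then show ?thesis using e by (simp add: field_simps power2_eq_square)
      qed
    qed (use ivN ivN2 in auto)
    also have "\<dots> = \<epsilon> + (\<integral>x. (cmod (v (x / of_int N)))\<^sup>2 \<partial>\<mu>) / (4 * \<epsilon>)"
      using ivN2 prob_space by simp
    also have "\<dots> \<le> \<epsilon> + 4 * \<epsilon>\<^sup>2 / (4 * \<epsilon>)"
      using vN2 e by (intro add_left_mono divide_right_mono) auto
    also have "\<dots> = 2 * \<epsilon>" using e by (simp add: power2_eq_square)
    finally have 1: "cmod (\<integral>x. v (x / of_int N) \<partial>\<mu>) \<le> 2 * \<epsilon>" .
    \<comment> \<open>Young's inequality with weight \<epsilon> keeps the constant in front of A at
      1 + \<epsilon>, so nothing is lost as \<epsilon> tends to 0.\<close>
    have d2: "(\<Sum>l\<in>F. (cmod (d l))\<^sup>2) \<le> (1 + \<epsilon>) * A + \<epsilon>\<^sup>2 + \<epsilon>"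
    proof -
      have pt: "(cmod (trig F d x))\<^sup>2 \<le> (1 + \<epsilon>) * (cmod (g x))\<^sup>2 + (1 + 1 / \<epsilon>) * (cmod (v x))\<^sup>2" for x
      proof -
        have "trig F d x = g x - v x" by (simp add: v_def)
        then have "(cmod (trig F d x))\<^sup>2 \<le> (cmod (g x) + cmod (v x))\<^sup>2"
          by (intro power_mono) (simp_all add: norm_triangle_ineq4)
        also have "\<dots> \<le> (1 + \<epsilon>) * (cmod (g x))\<^sup>2 + (1 + 1 / \<epsilon>) * (cmod (v x))\<^sup>2"
        proof -
          have "0 \<le> (\<epsilon> * cmod (g x) - cmod (v x))\<^sup>2 / \<epsilon>" using e by simp
          also have "\<dots> = \<epsilon> * (cmod (g x))\<^sup>2 + (cmod (v x))\<^sup>2 / \<epsilon> - 2 * cmod (g x) * cmod (v x)"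
            using e by (simp add: field_simps power2_eq_square)
          finally show ?thesis by (simp add: power2_sum algebra_simps)
        qed
        finally show ?thesis .
      qed
      have ig: "integrable \<mu> (\<lambda>x. (cmod (g x))\<^sup>2)" by (simp add: g_def)
      have "(\<Sum>l\<in>F. (cmod (d l))\<^sup>2) = (\<integral>x. (cmod (trig F d x))\<^sup>2 \<partial>\<mu>)"
        by (rule integral_trig_sq_orth[OF F(1) oF, symmetric])
      also have "\<dots> \<le> (\<integral>x. (1 + \<epsilon>) * (cmod (g x))\<^sup>2 + (1 + 1 / \<epsilon>) * (cmod (v x))\<^sup>2 \<partial>\<mu>)"
        by (rule integral_mono[OF _ _ pt]) (use ig iv2 in auto)
      also have "\<dots> = (1 + \<epsilon>) * A + (1 + 1 / \<epsilon>) * (\<integral>x. (cmod (v x))\<^sup>2 \<partial>\<mu>)"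
        using ig iv2 by (simp add: g2)
      also have "\<dots> \<le> (1 + \<epsilon>) * A + (1 + 1 / \<epsilon>) * \<epsilon>\<^sup>2"
        using v2 e by (intro add_left_mono mult_left_mono) auto
      also have "\<dots> = (1 + \<epsilon>) * A + \<epsilon>\<^sup>2 + \<epsilon>" using e by (simp add: field_simps power2_eq_square)
      finally show ?thesis .
    qed
    have "cmod (\<Sum>l\<in>F. d l * ft \<mu> (l / of_int N)) \<le> (\<Sum>l\<in>F. cmod (d l) * cmod (ft \<mu> (l / of_int N)))"
      by (rule order_trans[OF norm_sum]) (simp add: norm_mult)
    also have "\<dots> \<le> sqrt ((\<Sum>l\<in>F. (cmod (d l))\<^sup>2) * (\<Sum>l\<in>F. (cmod (ft \<mu> (l / of_int N)))\<^sup>2))"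
      by (intro real_le_rsqrt Cauchy_Schwarz_ineq_sum)
    also have "\<dots> \<le> sqrt (((1 + \<epsilon>) * A + \<epsilon>\<^sup>2 + \<epsilon>) * K)"
      using d2 bound[OF F] A0 e by (intro real_sqrt_le_mono mult_mono) (auto intro!: sum_nonneg)
    finally have 2: "cmod (\<Sum>l\<in>F. d l * ft \<mu> (l / of_int N)) \<le> sqrt ((1 + \<epsilon>) * A + \<epsilon>\<^sup>2 + \<epsilon>) * sqrt K"
      by (simp add: real_sqrt_mult)
    have itN: "integrable \<mu> (\<lambda>x. trig F d (x / of_int N))" for F d
      by (rule integrable_bounded_continuous[OF _ norm_trig_le])
         (rule continuous_on_compose2[OF continuous_trig[of UNIV]]; auto simp: divide_inverse intro!: continuous_intros)
    have "(\<integral>x. v (x / of_int N) \<partial>\<mu>) = of_real A - (\<Sum>l\<in>F. d l * ft \<mu> (l / of_int N))"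
      unfolding v_def g1[symmetric] int_trig[symmetric] g_def
      by (rule Bochner_Integration.integral_diff) (rule itN)+
    then have "complex_of_real A = (\<integral>x. v (x / of_int N) \<partial>\<mu>) + (\<Sum>l\<in>F. d l * ft \<mu> (l / of_int N))"
      by simp
    then have "cmod (complex_of_real A) \<le> cmod (\<integral>x. v (x / of_int N) \<partial>\<mu>) + cmod (\<Sum>l\<in>F. d l * ft \<mu> (l / of_int N))"
      by (simp only: norm_triangle_ineq)
    then show ?thesis using 1 2 A0 by simp
  qed
  have "A \<le> 2 * 0 + sqrt ((1 + 0) * A + 0\<^sup>2 + 0) * sqrt K"
  proof (rule tendsto_lowerbound)
    show "((\<lambda>\<epsilon>. 2 * \<epsilon> + sqrt ((1 + \<epsilon>) * A + \<epsilon>\<^sup>2 + \<epsilon>) * sqrt K) \<longlongrightarrow> 2 * 0 + sqrt ((1 + 0) * A + 0\<^sup>2 + 0) * sqrt K) (at_right 0)"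
      by (intro tendsto_intros)
    show "eventually (\<lambda>\<epsilon>. A \<le> 2 * \<epsilon> + sqrt ((1 + \<epsilon>) * A + \<epsilon>\<^sup>2 + \<epsilon>) * sqrt K) (at_right 0)"
      using ineq by (auto simp: eventually_at_right_field intro!: exI[of _ 1])
  qed simp
  then have le: "sqrt A * sqrt A \<le> sqrt A * sqrt K" using A0 by simp
  have "A \<le> K"
  proof (cases "A = 0")
    case False
    then have "sqrt A > 0" using A0 by simp
    then have "sqrt A \<le> sqrt K" using le by (simp only: mult_le_cancel_left_pos)
    then show ?thesis by simp
  qed (use K in simp)
  then show ?thesis by (simp add: A_def)
qed

text \<open>Zeros with odd normalization come from the first level \<open>mask (z / N)\<close>, through its
  zeros with the smallest 2-adic valuation.\<close>

lemma ft_zero_cases: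
  assumes "ft \<mu> z = 0"
  shows "(\<exists>n. odd n \<and> 2 ^ (\<tau> + 1) * of_int G * z / 2 ^ \<beta> = of_int n) \<or>
    (\<exists>n. even n \<and> 2 ^ (\<tau> + 1) * of_int G * z / 2 ^ \<beta> = of_int n) \<and>
      (ft \<mu> (z / of_int N) = 0 \<or> oddreal (2 * of_int G * (z / of_int N)))"
proof -
  obtain j where j: "j \<ge> 1" "mask (z / of_int N ^ j) = 0" using ft_zeroD[OF assms] by blast
  obtain i where i: "j = Suc i" using j(1) by (cases j) auto
  have N0: "real_of_int N \<noteq> 0" using N_real_gt by simp
  have deep: "ft \<mu> (z / of_int N) = 0" if "i > 0"
    using that j(2) by (intro ft_zeroI[of i]) (auto simp: i)
  have Nj: "real_of_int N ^ j / 2 ^ \<beta> = of_int (m * N ^ i)"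
    by (simp add: i N_eq)
  from mask_zero[OF j(2)] show ?thesis
  proof (elim disjE conjE)
    assume o: "oddreal (2 * of_int G * (z / of_int N ^ j))"
    then obtain v where v: "2 * of_int G * (z / of_int N ^ j) = of_int v" by (auto simp: oddreal_def)
    have "2 ^ (\<tau> + 1) * of_int G * z / 2 ^ \<beta> = 2 ^ \<tau> * (2 * of_int G * (z / of_int N ^ j)) * (of_int N ^ j / 2 ^ \<beta>)"
      using N0 by simp
    also have "\<dots> = of_int (2 ^ \<tau> * v * (m * N ^ i))" unfolding v Nj by simp
    finally have "\<exists>n. even n \<and> 2 ^ (\<tau> + 1) * of_int G * z / 2 ^ \<beta> = of_int n"
      using \<tau>_pos by (intro exI[of _ "2 ^ \<tau> * v * (m * N ^ i)"]) simp
    moreover have "ft \<mu> (z / of_int N) = 0 \<or> oddreal (2 * of_int G * (z / of_int N))"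
      using deep o by (cases "i = 0") (auto simp: i)
    ultimately show ?thesis by blast
  next
    assume "oddreal (2 * (2 ^ \<tau> * of_int l1 * (z / of_int N ^ j)))"
    then obtain v where v: "odd v" "2 ^ (\<tau> + 1) * of_int G * (z / of_int N ^ j) = of_int v"
      using oddreal_G unfolding oddreal_def by blast
    have "2 ^ (\<tau> + 1) * of_int G * z / 2 ^ \<beta> = 2 ^ (\<tau> + 1) * of_int G * (z / of_int N ^ j) * (of_int N ^ j / 2 ^ \<beta>)"
      using N0 by simp
    then have n: "2 ^ (\<tau> + 1) * of_int G * z / 2 ^ \<beta> = of_int (v * (m * N ^ i))" unfolding v(2) Nj by simp
    show ?thesis
    proof (cases "i = 0")
      case True
      then show ?thesis using n v(1) odds by (intro disjI1 exI[of _ "v * (m * N ^ i)"]) simp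
    next
      case False
      then have "even (v * (m * N ^ i))" "ft \<mu> (z / of_int N) = 0" using even_N deep by auto
      then show ?thesis using n by blast
    qed
  qed
qed

end

context four_digit_construction
begin

section \<open>An orthogonal set of mass above 2\<close>

text \<open>A difference certified by the first kind, or by the second kind on a level above k, is
  an integer, since \<open>N ^ j\<close> absorbs the power of 2. Only the k lowest \<delta>-bits
  produce other differences.\<close>

lemma Spec_difference_cases:
  assumes "x \<in> Spec \<sigma>" "y \<in> Spec \<sigma>"
  shows "(x - y) \<in> \<int> \<or> (\<exists>j\<in>{1..k}. \<exists>v. odd v \<and> 2 ^ (\<tau> + 1) * (x - y) = of_int (N ^ j * v))"
proof (cases "x = y")
  case False
  define d where "d = x - y"
  have N0: "real_of_int N ^ j \<noteq> 0" for j using N_real_gt by simp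
  obtain T where "at_zero T d" using Spec_difference[OF assms False] by (auto simp: d_def)
  then show ?thesis
    unfolding at_zero_def d_def[symmetric]
  proof (elim disjE bexE)
    fix j assume j: "j \<in> {1..T+k}" "oddreal (2 ^ (\<tau> + 1) * (d / of_int N ^ j))"
    then obtain v where v: "odd v" "2 ^ (\<tau> + 1) * (d / of_int N ^ j) = of_int v" by (auto simp: oddreal_def)
    then have e: "2 ^ (\<tau> + 1) * d = of_int N ^ j * of_int v" using N0 by (simp add: field_simps)
    show "d \<in> \<int> \<or> (\<exists>j\<in>{1..k}. \<exists>v. odd v \<and> 2 ^ (\<tau> + 1) * d = of_int (N ^ j * v))"
    proof (cases "j \<le> k")
      case True
      then show ?thesis using j(1) v(1) e by (intro disjI2 bexI[of _ j] exI[of _ v]) auto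
    next
      case False
      then have "\<beta> * Suc k \<le> \<beta> * j" by (intro mult_le_mono) auto
      then have "\<tau> + 1 \<le> \<beta> * j" using r \<tau>_eq by simp
      then have "\<beta> * j = (\<tau> + 1) + (\<beta> * j - (\<tau> + 1))" by simp
      then have "(2::real) ^ (\<beta> * j) = 2 ^ (\<tau> + 1) * 2 ^ (\<beta> * j - (\<tau> + 1))" by (metis power_add)
      then have "2 ^ (\<tau> + 1) * d = 2 ^ (\<tau> + 1) * (2 ^ (\<beta> * j - (\<tau> + 1)) * of_int m ^ j * of_int v)"
        unfolding e N_power_real by simp
      then have "d = of_int (2 ^ (\<beta> * j - (\<tau> + 1)) * m ^ j * v)" by simp
      then show ?thesis by simp
    qed
  next
    fix j assume j: "j \<in> {1..T}" "oddreal (2 * (d / of_int N ^ j))"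
    then obtain v where v: "2 * (d / of_int N ^ j) = of_int v" by (auto simp: oddreal_def)
    then have e: "2 * d = of_int (N ^ j * v)" using N0 by (simp add: field_simps)
    have "even (N ^ j * v)" using even_N j(1) by simp
    then obtain w where "N ^ j * v = 2 * w" by (elim evenE)
    then have "d = of_int w" using e by simp
    then show "d \<in> \<int> \<or> (\<exists>j\<in>{1..k}. \<exists>v. odd v \<and> 2 ^ (\<tau> + 1) * d = of_int (N ^ j * v))" by simp
  qed
qed simp

text \<open>Moves l up by one level and adds b as the contribution of a new lowest level.\<close>

definition refine :: "real \<Rightarrow> real \<Rightarrow> real" where
  "refine b l = b + of_int N * l"

lemma ft_refine_same:
  assumes "x \<in> Spec \<sigma>" "y \<in> Spec \<sigma>" "x \<noteq> y"
  shows "ft \<mu> (refine b x - refine b y) = 0"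
proof -
  obtain T where "at_zero T (x - y)" using Spec_difference[OF assms] by blast
  from at_zero_zero(2)[OF this, of 1] have "ft \<mu> (x - y) = 0" by simp
  moreover have "refine b x - refine b y = of_int N * (x - y)" by (simp add: refine_def right_diff_distrib)
  ultimately show ?thesis using N_real_gt by (subst ft_rec) simp
qed

text \<open>Scaled by \<open>2 ^ (\<tau> + 1)\<close>, all differences within \<open>Spec\<close>
  are even, so the odd number 1 + c decides and the first mask vanishes. The even c covers two pairs
  of digits: c = 0 for \<open>b1\<close> against 0, and c = \<open>- (2 ^ \<tau> * m ^ k)\<close>
  for \<open>b1\<close> against \<open>b2\<close>.\<close>

lemma ft_refine_low:
  assumes "x \<in> Spec \<sigma>" "y \<in> Spec \<sigma>" "even c"
    "b - b' = of_int N * (1 + of_int c) / 2 ^ (\<tau> + 1)"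
  shows "ft \<mu> (refine b x - refine b' y) = 0"
proof -
  have "\<exists>n. even n \<and> 2 ^ (\<tau> + 1) * (x - y) = of_int n"
    using Spec_difference_cases[OF assms(1,2)]
  proof (elim disjE bexE exE conjE)
    assume "x - y \<in> \<int>"
    then obtain n where "x - y = of_int n" by (auto simp: Ints_def)
    then show ?thesis by (intro exI[of _ "2 ^ (\<tau> + 1) * n"]) simp
  next
    fix j v assume "j \<in> {1..k}" "2 ^ (\<tau> + 1) * (x - y) = of_int (N ^ j * v)"
    then show ?thesis using even_N by (intro exI[of _ "N ^ j * v"]) auto
  qed
  then obtain n where n: "even n" "2 ^ (\<tau> + 1) * (x - y) = of_int n" by blast
  have "(refine b x - refine b' y) / of_int N = (1 + of_int c) / 2 ^ (\<tau> + 1) + (x - y)"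
    using assms(4) N_real_gt by (simp add: refine_def field_simps)
  then have "2 ^ (\<tau> + 1) * ((refine b x - refine b' y) / of_int N) =
      2 ^ (\<tau> + 1) * ((1 + of_int c) / 2 ^ (\<tau> + 1)) + 2 ^ (\<tau> + 1) * (x - y)"
    by (simp only: distrib_left)
  also have "\<dots> = of_int (1 + c + n)"
  proof -
    have "(2::real) ^ (\<tau> + 1) \<noteq> 0" by simp
    from nonzero_mult_div_cancel_left[OF this] show ?thesis
      unfolding n(2) by (simp only: times_divide_eq_right of_int_add of_int_1)
  qed
  finally have "2 ^ (\<tau> + 1) * ((refine b x - refine b' y) / of_int N) = of_int (1 + c + n)" .
  then have "oddreal (2 ^ (\<tau> + 1) * ((refine b x - refine b' y) / of_int N))"
    using n(1) assms(3) by (simp only: oddreal_of_int) simp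
  from zeroI2(1)[OF this] show ?thesis by (subst ft_rec) simp
qed

text \<open>If x - y is an integer, the odd multiple \<open>m ^ k / 2\<close> of 1/2 gives a zero of
  the first kind. Otherwise the \<delta>-bit of level j \<le> k prevails, because
  \<open>2 ^ \<tau> * m ^ k\<close> is an even multiple of \<open>N ^ j\<close>.\<close>

lemma ft_refine_high:
  assumes "x \<in> Spec \<sigma>" "y \<in> Spec \<sigma>" "b - b' = of_int N * of_int m ^ k / 2"
  shows "ft \<mu> (refine b x - refine b' y) = 0"
proof -
  define z where "z = (refine b x - refine b' y) / of_int N"
  have z: "z = of_int m ^ k / 2 + (x - y)"
    unfolding z_def using assms(3) N_real_gt by (simp add: refine_def field_simps)
  have "mask z = 0 \<or> ft \<mu> z = 0"
    using Spec_difference_cases[OF assms(1,2)]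
  proof (elim disjE bexE exE conjE)
    assume "x - y \<in> \<int>"
    then obtain n where "x - y = of_int n" by (auto simp: Ints_def)
    then have "2 * z = of_int (m ^ k + 2 * n)" by (simp add: z)
    then have "oddreal (2 * z)" using odds by (simp only: oddreal_of_int) simp
    then show ?thesis by (simp add: mask_zeroI1)
  next
    fix j v assume j: "j \<in> {1..k}" "odd v" "2 ^ (\<tau> + 1) * (x - y) = of_int (N ^ j * v)"
    have "j \<le> k" using j(1) by simp
    then obtain w where e: "2 ^ \<tau> * m ^ k = N ^ j * (2 * w)" by (rule level_power)
    have "2 ^ (\<tau> + 1) * z = of_int (2 ^ \<tau> * m ^ k) + of_int (N ^ j * v)"
      unfolding z j(3)[symmetric] by (simp add: distrib_left)
    also have "\<dots> = of_int N ^ j * of_int (2 * w + v)"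
      unfolding e by (simp add: distrib_left)
    finally have "2 ^ (\<tau> + 1) * (z / of_int N ^ j) = of_int (2 * w + v)"
      using N_real_gt by (simp add: field_simps)
    then have "oddreal (2 ^ (\<tau> + 1) * (z / of_int N ^ j))"
      using j(2) by (simp only: oddreal_of_int) simp
    from zeroI2(1)[OF this] have "ft \<mu> z = 0" using j(1) by (intro ft_zeroI[of j]) auto
    then show ?thesis by simp
  qed
  then show ?thesis unfolding z_def by (subst ft_rec) auto
qed

text \<open>By completeness of \<open>Spec\<close>, each refinement by one lowest digit captures,
  after division by N, a mass as close to 1 as desired. Three mutually orthogonal refinements of
  mass above 3/4 give 9/4 > 2.\<close>

lemma exists_orth_large:
  "\<exists>F. finite F \<and> orth F \<and> (\<Sum>l\<in>F. (cmod (ft \<mu> (l / of_int N)))\<^sup>2) > 2"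
proof -
  define \<sigma> :: "nat \<Rightarrow> bool" where "\<sigma> = (\<lambda>_. False)"
  define b1 where "b1 = real_of_int N / 2 ^ (\<tau> + 1)"
  define b2 where "b2 = real_of_int N * of_int m ^ k / 2"
  have "\<exists>F. finite F \<and> F \<subseteq> Spec \<sigma> \<and> (\<Sum>l\<in>F. (cmod (ft \<mu> (refine b l / of_int N)))\<^sup>2) > 3 / 4" for b
  proof -
    have "refine b l / of_int N = b / of_int N + of_int 1 * l" for l
      using N_real_gt by (simp add: refine_def add_divide_distrib)
    then show ?thesis using Spec_complete[of 1 "1 / 4" \<sigma> "b / of_int N"] by simp
  qed
  then obtain F where F: "\<And>b. finite (F b)" "\<And>b. F b \<subseteq> Spec \<sigma>"
    "\<And>b. (\<Sum>l\<in>F b. (cmod (ft \<mu> (refine b l / of_int N)))\<^sup>2) > 3 / 4" by metis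
  define R where "R b = refine b ` F b" for b
  have inj: "inj_on (refine b) (F b)" for b using N_real_gt by (auto simp: inj_on_def refine_def)
  have RF: "finite (R b)" "(\<Sum>l\<in>R b. (cmod (ft \<mu> (l / of_int N)))\<^sup>2) > 3 / 4" for b
    unfolding R_def using F(1,3)[of b] by (auto simp: sum.reindex[OF inj])
  have same: "ft \<mu> (u - v) = 0" if uv: "u \<in> R b" "v \<in> R b" "u \<noteq> v" for u v b
  proof -
    obtain x y where "x \<in> Spec \<sigma>" "y \<in> Spec \<sigma>" "u = refine b x" "v = refine b y"
      using uv(1,2) F(2)[of b] unfolding R_def by blast
    then show ?thesis using ft_refine_same uv(3) by blast
  qed
  have diff: "ft \<mu> (u - v) = 0 \<and> u \<noteq> v"
    if b: "(b, b') \<in> {(b1, 0), (b2, 0), (b1, b2)}" and uv: "u \<in> R b" "v \<in> R b'" for u v b b'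
  proof -
    obtain x y where xy: "x \<in> Spec \<sigma>" "y \<in> Spec \<sigma>" "u = refine b x" "v = refine b' y"
      using uv F(2) unfolding R_def by blast
    have "ft \<mu> (refine b x - refine b' y) = 0"
    proof -
      consider "b = b1" "b' = 0" | "b = b2" "b' = 0" | "b = b1" "b' = b2" using b by auto
      then show ?thesis
      proof cases
        case 1
        then show ?thesis by (intro ft_refine_low[OF xy(1,2), of 0]) (simp_all add: b1_def)
      next
        case 2
        then show ?thesis by (intro ft_refine_high[OF xy(1,2)]) (simp_all add: b2_def)
      next
        case 3
        show ?thesis
        proof (rule ft_refine_low[OF xy(1,2)])
          show "even (- (2 ^ \<tau> * m ^ k))" using \<tau>_pos by simp
          show "b - b' = of_int N * (1 + of_int (- (2 ^ \<tau> * m ^ k))) / 2 ^ (\<tau> + 1)"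
            unfolding 3 b1_def b2_def by (simp add: field_simps)
        qed
      qed
    qed
    moreover have "ft \<mu> 0 \<noteq> 0" by simp
    ultimately show ?thesis unfolding xy by (metis right_minus_eq)
  qed
  have sym: "ft \<mu> (u - v) = 0 \<Longrightarrow> ft \<mu> (v - u) = 0" for u v
    using ft_minus[of "u - v"] by simp
  have o: "orth (R 0 \<union> R b1 \<union> R b2)"
    unfolding orth_def
  proof (intro ballI impI)
    fix u v assume "u \<in> R 0 \<union> R b1 \<union> R b2" "v \<in> R 0 \<union> R b1 \<union> R b2" "u \<noteq> v"
    then obtain b b' where b: "u \<in> R b" "v \<in> R b'" "b \<in> {0, b1, b2}" "b' \<in> {0, b1, b2}" by blast
    show "ft \<mu> (u - v) = 0"
    proof (cases "b = b'")
      case True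
      then show ?thesis using same b \<open>u \<noteq> v\<close> by blast
    next
      case False
      then have "(b, b') \<in> {(b1, 0), (b2, 0), (b1, b2)} \<or> (b', b) \<in> {(b1, 0), (b2, 0), (b1, b2)}"
        using b(3,4) by auto
      then show ?thesis
      proof
        assume "(b, b') \<in> {(b1, 0), (b2, 0), (b1, b2)}"
        from diff[OF this b(1,2)] show ?thesis by blast
      next
        assume "(b', b) \<in> {(b1, 0), (b2, 0), (b1, b2)}"
        from diff[OF this b(2,1)] show ?thesis using sym by blast
      qed
    qed
  qed
  have ne: "u \<noteq> v" if "(b, b') \<in> {(b1, 0), (b2, 0), (b1, b2)}" "u \<in> R b" "v \<in> R b'" for u v b b'
    using diff[OF that] by blast
  have disj: "R 0 \<inter> R b1 = {}" "(R 0 \<union> R b1) \<inter> R b2 = {}"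
    using ne[of b1 0] ne[of b2 0] ne[of b1 b2] by blast+
  have "(\<Sum>l\<in>R 0 \<union> R b1 \<union> R b2. (cmod (ft \<mu> (l / of_int N)))\<^sup>2) =
      (\<Sum>l\<in>R 0. (cmod (ft \<mu> (l / of_int N)))\<^sup>2) + (\<Sum>l\<in>R b1. (cmod (ft \<mu> (l / of_int N)))\<^sup>2) +
      (\<Sum>l\<in>R b2. (cmod (ft \<mu> (l / of_int N)))\<^sup>2)"
    using RF(1) disj by (simp add: sum.union_disjoint)
  also have "\<dots> > 2" using RF(2)[of 0] RF(2)[of b1] RF(2)[of b2] by simp
  finally show ?thesis using o RF(1) by (intro exI[of _ "R 0 \<union> R b1 \<union> R b2"]) auto
qed

section \<open>Odd differences and the common denominator\<close>

text \<open>Without odd differences, \<open>(x - y) / N\<close> is a zero unless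
  \<open>q x y\<close> is odd. The parity of q, measured from a representative of each class of
  points with integral q, colours \<Lambda> with two colours such that q is never odd within a
  colour. So each colour class divided by N is orthogonal and has mass at most 1 by Bessel.\<close>

lemma spectrum_has_odd_difference:
  assumes \<Lambda>: "is_spectrum \<mu> \<Lambda>"
  shows "\<exists>x\<in>\<Lambda>. \<exists>y\<in>\<Lambda>. \<exists>n. odd n \<and> 2 ^ (\<tau> + 1) * of_int G * (x - y) / 2 ^ \<beta> = of_int n"
proof (rule ccontr)
  assume neg: "\<not> ?thesis"
  have split: "ft \<mu> ((x - y) / of_int N) = 0 \<or> oddreal (2 * of_int G * ((x - y) / of_int N))"
    if "x \<in> \<Lambda>" "y \<in> \<Lambda>" "x \<noteq> y" for x y
  proof -
    have "ft \<mu> (x - y) = 0" using is_spectrum_orth[OF \<Lambda>] that by (auto simp: orth_def)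
    from ft_zero_cases[OF this] neg that show ?thesis by blast
  qed
  define q where "q x y = 2 * real_of_int G * ((x - y) / real_of_int N)" for x y
  have q_add: "q x z = q x y + q y z" for x y z
    by (simp add: q_def diff_divide_distrib algebra_simps)
  define rep where "rep x = (SOME y. q x y \<in> \<int>)" for x
  have rep: "q x (rep x) \<in> \<int>" for x
    unfolding rep_def by (rule someI[of _ x]) (simp add: q_def)
  have rep_eq: "rep x = rep y" if "q x y \<in> \<int>" for x y
  proof -
    have "q x z \<in> \<int> \<longleftrightarrow> q y z \<in> \<int>" for z
      using that q_add[of x z y] by (metis Ints_add Ints_diff add_diff_cancel_left')
    then show ?thesis by (simp add: rep_def)
  qed
  define col where "col x \<longleftrightarrow> even \<lfloor>q x (rep x)\<rfloor>" for x
  have orth_col: "orth ((\<lambda>l. l / of_int N) ` {x \<in> \<Lambda>. col x = c})" for c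
    unfolding orth_def
  proof (intro ballI impI)
    fix l l' assume l: "l \<in> (\<lambda>l. l / of_int N) ` {x \<in> \<Lambda>. col x = c}" "l' \<in> (\<lambda>l. l / of_int N) ` {x \<in> \<Lambda>. col x = c}" "l \<noteq> l'"
    then obtain x y where xy: "x \<in> \<Lambda>" "y \<in> \<Lambda>" "col x = c" "col y = c" "l = x / of_int N" "l' = y / of_int N"
      by blast
    have "x \<noteq> y" using l(3) xy by auto
    have "\<not> oddreal (q x y)"
    proof
      assume "oddreal (q x y)"
      then obtain n where n: "odd n" "q x y = of_int n" by (auto simp: oddreal_def)
      then have re: "rep x = rep y" using rep_eq[of x y] by simp
      obtain u v where uv: "q x (rep x) = of_int u" "q y (rep x) = of_int v"
        using rep[of x] rep[of y] unfolding re by (auto simp: Ints_def)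
      have "of_int u = of_int n + (of_int v :: real)" using q_add[of x "rep x" y] n uv by simp
      then have "u = n + v" by linarith
      moreover have "even u = even v" using xy(3,4) uv re by (simp add: col_def)
      ultimately show False using n(1) by simp
    qed
    with split[OF xy(1,2) \<open>x \<noteq> y\<close>] show "ft \<mu> (l - l') = 0"
      by (simp add: xy q_def diff_divide_distrib)
  qed
  have "(\<Sum>l\<in>F. (cmod (ft \<mu> (l / of_int N)))\<^sup>2) \<le> 2" if F: "finite F" "F \<subseteq> \<Lambda>" for F
  proof -
    have one: "(\<Sum>l\<in>{x \<in> F. col x = c}. (cmod (ft \<mu> (l / of_int N)))\<^sup>2) \<le> 1" for c
    proof -
      have inj: "inj_on (\<lambda>l. l / of_int N) {x \<in> F. col x = c}" using N_real_gt by (auto simp: inj_on_def)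
      have "orth ((\<lambda>l. l / of_int N) ` {x \<in> F. col x = c})"
        by (rule orth_subset[OF orth_col[of c]]) (use F in auto)
      then have "(\<Sum>l\<in>(\<lambda>l. l / of_int N) ` {x \<in> F. col x = c}. (cmod (ft \<mu> (0 - l)))\<^sup>2) \<le> 1"
        using F(1) by (intro bessel_ft) auto
      then show ?thesis by (simp add: sum.reindex[OF inj] ft_minus)
    qed
    have "F = {x \<in> F. col x = True} \<union> {x \<in> F. col x = False}" by auto
    then have "(\<Sum>l\<in>F. (cmod (ft \<mu> (l / of_int N)))\<^sup>2) =
        (\<Sum>l\<in>{x \<in> F. col x = True} \<union> {x \<in> F. col x = False}. (cmod (ft \<mu> (l / of_int N)))\<^sup>2)" by simp
    also have "\<dots> = (\<Sum>l\<in>{x \<in> F. col x = True}. (cmod (ft \<mu> (l / of_int N)))\<^sup>2) +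
        (\<Sum>l\<in>{x \<in> F. col x = False}. (cmod (ft \<mu> (l / of_int N)))\<^sup>2)"
      using F(1) by (intro sum.union_disjoint) auto
    also have "\<dots> \<le> 2" using one[of True] one[of False] by simp
    finally show ?thesis .
  qed
  moreover obtain F0 where "finite F0" "orth F0" "(\<Sum>l\<in>F0. (cmod (ft \<mu> (l / of_int N)))\<^sup>2) > 2"
    using exists_orth_large by blast
  ultimately show False using spectrum_dominates_orth[OF \<Lambda>, of F0 2] by force
qed

text \<open>In every spectrum all differences times c are integers, and one is odd. An odd value u
  for \<Lambda> serves as T for all s at once: \<open>s * u\<close> is an integer q, and a pair with
  odd value q' for \<open>s * \<Lambda>\<close> yields \<open>q * u' = q' * u\<close>, so q is
  odd.\<close>

lemma common_denominator:
  assumes "is_spectrum \<mu> \<Lambda>" "\<And>s. s \<in> S \<Longrightarrow> is_spectrum \<mu> ((\<lambda>l. s * l) ` \<Lambda>)" and S0: "0 \<notin> S"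
  shows "\<exists>T\<in>\<O>. S \<subseteq> (\<lambda>u. inverse T * u) ` \<O>"
proof -
  define c where "c = 2 ^ (\<tau> + 1) * real_of_int G / 2 ^ \<beta>"
  have dvd: "\<exists>n::int. c * (x - y) = of_int n" if "is_spectrum \<mu> L" "x \<in> L" "y \<in> L" for L x y
  proof (cases "x = y")
    case False
    then have "ft \<mu> (x - y) = 0" using is_spectrum_orth[OF that(1)] that by (auto simp: orth_def)
    from ft_zero_cases[OF this] show ?thesis by (auto simp: c_def)
  qed (auto intro: exI[of _ 0])
  have odd: "\<exists>x\<in>L. \<exists>y\<in>L. \<exists>n. odd n \<and> c * (x - y) = of_int n" if "is_spectrum \<mu> L" for L
    using spectrum_has_odd_difference[OF that] by (auto simp: c_def)
  obtain x y u where xy: "x \<in> \<Lambda>" "y \<in> \<Lambda>" "odd u" "c * (x - y) = of_int u" using odd[OF assms(1)] by blast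
  have "s \<in> (\<lambda>v. inverse (of_int u) * v) ` \<O>" if s: "s \<in> S" for s
  proof -
    obtain q where q: "c * (s * x - s * y) = of_int q" using dvd[OF assms(2)[OF s]] xy by blast
    obtain x' y' q' where x': "x' \<in> \<Lambda>" "y' \<in> \<Lambda>" "odd q'" "c * (s * x' - s * y') = of_int q'"
      using odd[OF assms(2)[OF s]] by blast
    obtain u' where u': "c * (x' - y') = of_int u'" using dvd[OF assms(1) x'(1,2)] by blast
    have sq: "s * of_int u = of_int q" unfolding xy(4)[symmetric] q[symmetric] by (simp add: algebra_simps)
    have sq': "s * of_int u' = of_int q'" unfolding x'(4)[symmetric] u'[symmetric] by (simp add: algebra_simps)
    have "real_of_int (q * u') = s * of_int u * of_int u'" by (simp add: sq)
    also have "\<dots> = real_of_int (q' * u)" by (simp add: sq'[symmetric])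
    finally have "q * u' = q' * u" by (simp only: of_int_eq_iff)
    then have "odd q" using x'(3) xy(3) by (metis even_mult_iff)
    moreover have "u \<noteq> 0" using xy(3) by auto
    then have "s = inverse (of_int u) * of_int q" using sq by (simp add: field_simps)
    ultimately show ?thesis by (auto simp: odd_reals_def)
  qed
  then show ?thesis using xy(3) by (intro bexI[of _ "of_int u"]) (auto simp: odd_reals_def)
qed

end

section \<open>Beurling dimension\<close>

lemma lacunary_Max:
  assumes "finite A" "A \<noteq> {}" "lacunary A" "\<And>x. x \<in> A \<Longrightarrow> x \<ge> 1"
  shows "2 ^ (card A - 1) \<le> Max A"
  using assms
proof (induction "card A" arbitrary: A)
  case (Suc n)
  define M where "M = Max A"
  have M: "M \<in> A" using Suc.prems by (simp add: M_def)
  define A' where "A' = A - {M}"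
  have c: "card A' = n" using Suc.hyps(2) M Suc.prems(1) by (simp add: A'_def)
  show ?case
  proof (cases "A' = {}")
    case True
    then have "card A = 1" using c Suc.hyps(2) by simp
    then show ?thesis using Suc.prems(4)[OF M] by (simp add: M_def)
  next
    case False
    have fA: "finite A'" using Suc.prems by (simp add: A'_def)
    then have "n > 0" using False c by auto
    have M': "Max A' \<in> A'" using fA False by simp
    have "2 ^ (card A' - 1) \<le> Max A'"
    proof (rule Suc.hyps(1)[OF c[symmetric] fA False])
      show "lacunary A'" using Suc.prems(3) by (rule lacunary_subset) (simp add: A'_def)
      show "1 \<le> x" if "x \<in> A'" for x using Suc.prems(4) that by (simp add: A'_def)
    qed
    moreover have "Max A' < M" using M' Suc.prems(1) by (auto simp: A'_def M_def order.strict_iff_order)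
    then have "2 * Max A' \<le> M" using Suc.prems(3) M M' by (auto simp: lacunary_def A'_def)
    moreover have "(2::int) ^ (card A - 1) = 2 * 2 ^ (card A' - 1)"
      using \<open>n > 0\<close> c Suc.hyps(2)[symmetric] by (cases n) auto
    ultimately show ?thesis by (simp add: M_def)
  qed
qed simp

text \<open>A window need not lie near 0, so its length controls gaps only: the gap between the two
  largest elements is at least the second largest, which is at least
  \<open>2 ^ (card A - 2)\<close>.\<close>

lemma lacunary_card:
  assumes "finite A" "lacunary A" "\<And>x. x \<in> A \<Longrightarrow> x \<ge> 1"
    and h: "h \<ge> 1" "\<And>x y. x \<in> A \<Longrightarrow> y \<in> A \<Longrightarrow> real_of_int (x - y) < h"
  shows "real (card A) \<le> 2 + ln h / ln 2"
proof (cases "card A \<le> 1")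
  case True
  have "0 \<le> ln h / ln 2" using h(1) by simp
  then show ?thesis using True by linarith
next
  case False
  then have "A \<noteq> {}" by auto
  define M where "M = Max A"
  have M: "M \<in> A" using assms(1) \<open>A \<noteq> {}\<close> by (simp add: M_def)
  define A' where "A' = A - {M}"
  have c: "card A = Suc (card A')" unfolding A'_def by (rule card.remove[OF assms(1) M])
  have "A' \<noteq> {}" using False c by (cases "A' = {}") auto
  then have fA: "finite A'" "A' \<noteq> {}" using assms(1) by (auto simp: A'_def)
  have M': "Max A' \<in> A'" using fA by simp
  have "2 ^ (card A' - 1) \<le> Max A'"
  proof (rule lacunary_Max[OF fA])
    show "lacunary A'" using assms(2) by (rule lacunary_subset) (simp add: A'_def)
    show "1 \<le> x" if "x \<in> A'" for x using assms(3) that by (simp add: A'_def)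
  qed
  moreover have "Max A' < M" using M' assms(1) by (auto simp: A'_def M_def order.strict_iff_order)
  then have "2 * Max A' \<le> M" using assms(2) M M' by (auto simp: lacunary_def A'_def)
  ultimately have "2 ^ (card A' - 1) \<le> M - Max A'" by simp
  then have "real_of_int (2 ^ (card A' - 1)) \<le> of_int (M - Max A')" by (simp only: of_int_le_iff)
  also have "\<dots> < h" using h(2) M M' by (auto simp: A'_def)
  finally have "ln (2 ^ (card A' - 1)) \<le> ln h" using h(1) by (subst ln_le_cancel_iff) auto
  then have "real (card A' - 1) \<le> ln h / ln 2" by (simp add: ln_realpow field_simps)
  then show ?thesis using c False by simp
qed

context four_digit_measure
begin

section \<open>Counting digit sums and points in windows\<close>

lemma Plain_PiE: "Plain J = (\<lambda>l. \<Sum>j\<in>J. N ^ j * l j) ` (PiE J (\<lambda>_. Ldig))"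
proof (intro equalityI subsetI)
  fix x assume "x \<in> Plain J"
  then obtain l where l: "\<And>j. l j \<in> Ldig" "x = (\<Sum>j\<in>J. N ^ j * l j)" by (auto simp: Plain_def)
  then show "x \<in> (\<lambda>l. \<Sum>j\<in>J. N ^ j * l j) ` (PiE J (\<lambda>_. Ldig))"
    by (intro rev_image_eqI[of "restrict l J"]) (auto intro!: sum.cong)
next
  fix x assume "x \<in> (\<lambda>l. \<Sum>j\<in>J. N ^ j * l j) ` (PiE J (\<lambda>_. Ldig))"
  then obtain l where l: "l \<in> PiE J (\<lambda>_. Ldig)" "x = (\<Sum>j\<in>J. N ^ j * l j)" by auto
  have "x = (\<Sum>j\<in>J. N ^ j * (if j \<in> J then l j else 0))" unfolding l(2) by (intro sum.cong) auto
  then show "x \<in> Plain J" using l(1) by (simp only:) (rule PlainI, auto)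
qed

lemma finite_Ldig: "finite Ldig"
  by (simp add: Ldig_def)

lemma card_Plain_le: "finite J \<Longrightarrow> card (Plain J) \<le> 4 ^ card J"
  unfolding Plain_PiE
  by (rule order_trans[OF card_image_le]) (auto simp: finite_PiE finite_Ldig card_PiE card_Ldig)

text \<open>Injectivity is inherited from the full block of positions, where
  \<open>Plain {..<q}\<close> has as many elements as there are digit words.\<close>

lemma card_Plain:
  assumes "J \<subseteq> {..<q}"
  shows "card (Plain J) = 4 ^ card J"
proof -
  define s where "s J l = (\<Sum>j\<in>J. N ^ j * l j)" for J and l :: "nat \<Rightarrow> int"
  have fin: "finite J" using assms finite_subset by blast
  have "card (s {..<q} ` (PiE {..<q} (\<lambda>_. Ldig))) = card (PiE {..<q} (\<lambda>_. Ldig))"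
    using Plain_block[of q] unfolding Plain_PiE s_def by (simp add: card_PiE card_Ldig)
  then have inj: "inj_on (s {..<q}) (PiE {..<q} (\<lambda>_. Ldig))"
    by (intro eq_card_imp_inj_on) (auto simp: finite_PiE finite_Ldig)
  define ext where "ext l = (\<lambda>j\<in>{..<q}. if j \<in> J then l j else 0)" for l :: "nat \<Rightarrow> int"
  have "inj_on (s J) (PiE J (\<lambda>_. Ldig))"
  proof (rule inj_onI)
    fix l l' assume l: "l \<in> PiE J (\<lambda>_. Ldig)" "l' \<in> PiE J (\<lambda>_. Ldig)" "s J l = s J l'"
    have e: "s J l = s {..<q} (ext l)" for l
      unfolding s_def using assms by (intro sum.mono_neutral_cong_left) (auto simp: ext_def)
    have "ext l \<in> PiE {..<q} (\<lambda>_. Ldig)" "ext l' \<in> PiE {..<q} (\<lambda>_. Ldig)"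
      using l(1,2) by (auto simp: ext_def PiE_def Pi_def)
    then have "ext l = ext l'" using inj l(3) unfolding e by (auto dest: inj_onD)
    have "l j = l' j" if "j \<in> J" for j
    proof -
      have "ext l j = ext l' j" using \<open>ext l = ext l'\<close> by simp
      moreover have "j < q" using that assms by auto
      ultimately show ?thesis using that by (simp add: ext_def)
    qed
    then show "l = l'" using l(1,2) by (auto intro: PiE_ext)
  qed
  then have "card (s J ` PiE J (\<lambda>_. Ldig)) = card (PiE J (\<lambda>_. Ldig))" by (rule card_image)
  then show ?thesis using fin unfolding Plain_PiE s_def by (simp add: card_PiE card_Ldig)
qed

text \<open>Digits lie between 0 and N - 1, so this is a genuine base-N expansion and the remainder
  is its low part.\<close>

lemma Plain_mod:
  assumes "finite J" "x \<in> Plain J"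
  shows "x mod N ^ t \<in> Plain (J \<inter> {..<t})"
proof -
  obtain l where l: "\<And>j. l j \<in> Ldig" "x = (\<Sum>j\<in>J. N ^ j * l j)" using assms(2) by (auto simp: Plain_def)
  define lo where "lo = (\<Sum>j\<in>J \<inter> {..<t}. N ^ j * l j)"
  have lo: "lo \<in> Plain (J \<inter> {..<t})" unfolding lo_def by (rule PlainI) (rule l(1))
  have "x = lo + (\<Sum>j\<in>J - {..<t}. N ^ j * l j)"
    unfolding l(2) lo_def using assms(1) by (rule sum.Int_Diff)
  moreover have "N ^ t dvd (\<Sum>j\<in>J - {..<t}. N ^ j * l j)"
    by (intro dvd_sum dvd_mult2 le_imp_power_dvd) auto
  ultimately have "x mod N ^ t = lo mod N ^ t" by (metis dvd_imp_mod_0 mod_add_right_eq add.right_neutral)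
  also have "\<dots> = lo"
    using Plain_bounds[OF _ lo, of t] by (intro mod_pos_pos_trivial) auto
  finally show ?thesis using lo by simp
qed

end

context four_digit_construction
begin

text \<open>On a window of length at most \<open>N ^ t\<close>, the points built from free digits
  are distinguished by their residues, whose digits sit at Beatty positions below t. The other
  points are lacunary and contribute logarithmically.\<close>

lemma card_interval_limit_set:
  fixes A :: "int set"
  assumes A: "A \<subseteq> limit_set \<sigma>" "finite A" and h: "h \<ge> 1" "h \<le> real_of_int N ^ t"
    and diff: "\<And>x y. x \<in> A \<Longrightarrow> y \<in> A \<Longrightarrow> real_of_int (x - y) < h"
  shows "real (card A) \<le> 4 ^ card (Beatty \<inter> {..<t}) + 2 + ln h / ln 2"
proof -
  define P where "P = (\<Union>n. Plain (free_digits \<sigma> n))"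
  have free_digits: "free_digits \<sigma> n \<subseteq> Beatty \<inter> {..<level \<sigma> n}" "lacunary (stage_set \<sigma> n - Plain (free_digits \<sigma> n))" for n
    using inv_all[of \<sigma> n] by (auto simp: stage_inv_def)
  have fJ: "finite (free_digits \<sigma> n)" for n using finite_subset[OF free_digits(1)] by simp
  have "card (A \<inter> P) \<le> card (Plain (Beatty \<inter> {..<t}))"
  proof (rule card_inj_on_le)
    show "(\<lambda>x. x mod N ^ t) ` (A \<inter> P) \<subseteq> Plain (Beatty \<inter> {..<t})"
    proof clarify
      fix x assume "x \<in> P"
      then obtain n where "x \<in> Plain (free_digits \<sigma> n)" by (auto simp: P_def)
      from Plain_mod[OF fJ this, of t] show "x mod N ^ t \<in> Plain (Beatty \<inter> {..<t})"
        using Plain_mono[of "free_digits \<sigma> n \<inter> {..<t}" "Beatty \<inter> {..<t}"] free_digits(1)[of n] by auto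
    qed
    show "inj_on (\<lambda>x. x mod N ^ t) (A \<inter> P)"
    proof (rule inj_onI)
      fix x y assume xy: "x \<in> A \<inter> P" "y \<in> A \<inter> P" "x mod N ^ t = y mod N ^ t"
      have lt: "u - v < N ^ t" if "u \<in> A" "v \<in> A" for u v
      proof -
        have "real_of_int (u - v) < real_of_int (N ^ t)" using diff[OF that] h(2) by simp
        then show ?thesis by (simp only: of_int_less_iff)
      qed
      have "N ^ t dvd x - y" using xy(3) by (simp add: mod_eq_dvd_iff)
      moreover have "\<bar>x - y\<bar> < N ^ t" using lt[of x y] lt[of y x] xy by auto
      ultimately show "x = y" using dvd_imp_le_int[of "x - y" "N ^ t"] N_gt by force
    qed
    show "finite (Plain (Beatty \<inter> {..<t}))" by (rule finite_Plain) simp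
  qed
  also have "\<dots> \<le> 4 ^ card (Beatty \<inter> {..<t})" by (rule card_Plain_le) simp
  finally have 1: "card (A \<inter> P) \<le> 4 ^ card (Beatty \<inter> {..<t})" .
  have 2: "real (card (A - P)) \<le> 2 + ln h / ln 2"
  proof (rule lacunary_card)
    show "finite (A - P)" using A(2) by simp
    show "lacunary (A - P)"
      unfolding lacunary_def
    proof (intro ballI impI)
      fix x y assume xy: "x \<in> A - P" "y \<in> A - P" "x < y"
      then obtain n n' where "x \<in> stage_set \<sigma> n" "y \<in> stage_set \<sigma> n'" using A(1) unfolding limit_set_def by blast
      then have "x \<in> stage_set \<sigma> (max n n')" "y \<in> stage_set \<sigma> (max n n')"
        using stage_set_mono[where \<sigma> = \<sigma> and n = n and n' = "max n n'"] stage_set_mono[where \<sigma> = \<sigma> and n = n' and n' = "max n n'"]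
        by auto
      then show "2 * x \<le> y" using free_digits(2)[of "max n n'"] xy by (auto simp: lacunary_def P_def)
    qed
    show "1 \<le> x" if "x \<in> A - P" for x
    proof -
      have "0 \<in> P" using zero_in_Plain by (auto simp: P_def)
      then have "x \<noteq> 0" using that by auto
      moreover have "0 \<le> x" using that A(1) stage_set_props(5) by (auto simp: limit_set_def)
      ultimately show ?thesis by simp
    qed
  qed (use h diff in auto)
  have "real (card A) = real (card (A \<inter> P)) + real (card (A - P))"
    using card_Int_Diff[OF A(2), of P] by simp
  moreover have "real (card (A \<inter> P)) \<le> 4 ^ card (Beatty \<inter> {..<t})" using 1 by (metis of_nat_le_iff of_nat_numeral of_nat_power)
  ultimately show ?thesis using 2 by linarith
qed

lemma ln_N_pos: "ln (real_of_int N) > 0"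
  using N_real_gt by simp

lemma finite_interval_ints: "finite {\<gamma>::int. u < real_of_int \<gamma> \<and> real_of_int \<gamma> < v}"
proof (rule finite_subset)
  show "{\<gamma>::int. u < real_of_int \<gamma> \<and> real_of_int \<gamma> < v} \<subseteq> {\<lfloor>u\<rfloor>..\<lceil>v\<rceil>}"
    by (auto; linarith)
qed simp

text \<open>There is one window of integers for each of the \<open>2 ^ k\<close> sets of low bits,
  and dividing by C with |C| \<ge> 1 only shortens it.\<close>

lemma card_interval_Spec:
  fixes x h :: real and \<sigma> :: "nat \<Rightarrow> bool"
  assumes U: "odd U" and h: "h \<ge> 1"
  defines "s \<equiv> \<alpha> * ln 4 / ln (real_of_int N)"
  defines "I \<equiv> (\<lambda>l. of_int U * l) ` Spec \<sigma> \<inter> {x - h/2 <..< x + h/2}"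
  shows "finite I" "real (card I) \<le> 2 ^ k * (exp (s * ln h) * (6 + 2 * ln h))"
proof -
  define C where "C = of_int U * real_of_int m ^ k"
  have U1: "\<bar>real_of_int U\<bar> \<ge> 1" using U by (cases "U = 0") auto
  have "real_of_int m ^ k \<ge> 1" using m_pos by simp
  then have "1 * 1 \<le> \<bar>real_of_int U\<bar> * real_of_int m ^ k" using U1 by (intro mult_mono) auto
  then have C1: "\<bar>C\<bar> \<ge> 1" using m_pos by (simp add: C_def abs_mult)
  define y where "y S = (x - of_int U * bb S) / C" for S
  define G0 where "G0 S = {\<gamma> \<in> limit_set \<sigma>. \<bar>real_of_int \<gamma> - y S\<bar> < h / 2}" for S
  have fG: "finite (G0 S)" for S
  proof (rule finite_subset[OF _ finite_interval_ints[of "y S - h / 2" "y S + h / 2"]], rule subsetI)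
    fix \<gamma> assume "\<gamma> \<in> G0 S"
    then have "\<bar>real_of_int \<gamma> - y S\<bar> < h / 2" by (simp only: G0_def mem_Collect_eq)
    then show "\<gamma> \<in> {\<gamma>. y S - h / 2 < real_of_int \<gamma> \<and> real_of_int \<gamma> < y S + h / 2}"
      unfolding mem_Collect_eq abs_less_iff by linarith
  qed
  have sub: "I \<subseteq> (\<Union>S\<in>Pow {1..k}. (\<lambda>\<gamma>. of_int U * (bb S + of_int m ^ k * of_int \<gamma>)) ` G0 S)"
  proof
    fix z assume "z \<in> I"
    then obtain S \<gamma> where S: "S \<subseteq> {1..k}" "\<gamma> \<in> limit_set \<sigma>" and z: "z = of_int U * (bb S + of_int m ^ k * of_int \<gamma>)"
      and zi: "x - h / 2 < z" "z < x + h / 2"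
      by (auto simp: I_def Spec_def Lam_def)
    have "C \<noteq> 0" using C1 by auto
    then have "C * y S = x - of_int U * bb S" by (simp add: y_def)
    then have "z - x = C * (of_int \<gamma> - y S)"
      unfolding right_diff_distrib z C_def by (simp add: algebra_simps)
    moreover have "\<bar>z - x\<bar> < h / 2" using zi by linarith
    ultimately have "\<bar>C\<bar> * \<bar>of_int \<gamma> - y S\<bar> < h / 2" by (simp add: abs_mult)
    moreover have "1 * \<bar>of_int \<gamma> - y S\<bar> \<le> \<bar>C\<bar> * \<bar>of_int \<gamma> - y S\<bar>" using C1 by (intro mult_right_mono) auto
    ultimately have "\<gamma> \<in> G0 S" using S by (simp add: G0_def)
    then show "z \<in> (\<Union>S\<in>Pow {1..k}. (\<lambda>\<gamma>. of_int U * (bb S + of_int m ^ k * of_int \<gamma>)) ` G0 S)"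
      using S z by blast
  qed
  have fU: "finite (\<Union>S\<in>Pow {1..k}. (\<lambda>\<gamma>. of_int U * (bb S + of_int m ^ k * of_int \<gamma>)) ` G0 S)"
    using fG by auto
  show "finite I" using finite_subset[OF sub fU] .
  \<comment> \<open>The least t with h \<le> \<open>N ^ t\<close>; rounding up costs at most one
    digit, hence the factor 4 below.\<close>
  define t where "t = nat \<lceil>ln h / ln (real_of_int N)\<rceil>"
  have lnh: "ln h \<ge> 0" using h by simp
  have t0: "ln h / ln (real_of_int N) \<ge> 0" using lnh ln_N_pos by simp
  have t: "ln h / ln (real_of_int N) \<le> real t" "real t \<le> ln h / ln (real_of_int N) + 1"
    using t0 by (simp_all add: t_def)
  have hN: "h \<le> real_of_int N ^ t"
  proof -
    have "ln h \<le> real t * ln (real_of_int N)" using t(1) ln_N_pos by (simp add: field_simps)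
    then have "ln h \<le> ln (real_of_int N ^ t)" using N_real_gt by (simp add: ln_realpow)
    then show ?thesis using h N_real_gt by (subst (asm) ln_le_cancel_iff) auto
  qed
  have "real (card (Beatty \<inter> {..<t})) \<le> \<alpha> * real t"
    using card_Beatty[of t] by (metis of_int_floor_le of_int_of_nat_eq)
  also have "\<dots> \<le> \<alpha> * (ln h / ln (real_of_int N) + 1)" using t(2) \<alpha> by (intro mult_left_mono) auto
  also have "\<dots> \<le> \<alpha> * ln h / ln (real_of_int N) + 1" using \<alpha> by (simp add: distrib_left)
  finally have cB: "real (card (Beatty \<inter> {..<t})) \<le> \<alpha> * ln h / ln (real_of_int N) + 1" .
  have "(4::real) ^ card (Beatty \<inter> {..<t}) = exp (real (card (Beatty \<inter> {..<t})) * ln 4)"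
    by (simp add: exp_of_nat_mult)
  also have "\<dots> \<le> exp ((\<alpha> * ln h / ln (real_of_int N) + 1) * ln 4)"
    using cB by (simp only: exp_le_cancel_iff) (intro mult_right_mono, auto)
  also have "(\<alpha> * ln h / ln (real_of_int N) + 1) * ln 4 = s * ln h + ln 4"
    by (simp add: s_def algebra_simps)
  also have "exp (s * ln h + ln 4) = 4 * exp (s * ln h)" by (simp add: exp_add)
  finally have p4: "(4::real) ^ card (Beatty \<inter> {..<t}) \<le> 4 * exp (s * ln h)" .
  have s0: "s \<ge> 0" unfolding s_def using \<alpha> ln_N_pos by simp
  have e1: "exp (s * ln h) \<ge> 1" using s0 lnh by simp
  have ln2: "ln h / ln 2 \<le> 2 * ln h"
  proof -
    have "(1::real) \<le> 2 * ln 2" using ln2_ge_two_thirds by simp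
    then have "1 * ln h \<le> (2 * ln 2) * ln h" using lnh by (intro mult_right_mono)
    then show ?thesis by (simp add: field_simps)
  qed
  \<comment> \<open>The 6 collects this factor 4 and the constant 2 of the lacunary part; all terms
    are multiplied by the exponential, which is at least 1.\<close>
  have cG: "real (card (G0 S)) \<le> exp (s * ln h) * (6 + 2 * ln h)" for S
  proof -
    have "real (card (G0 S)) \<le> 4 ^ card (Beatty \<inter> {..<t}) + 2 + ln h / ln 2"
    proof (rule card_interval_limit_set[OF _ fG h hN])
      show "G0 S \<subseteq> limit_set \<sigma>" by (auto simp: G0_def)
      show "real_of_int (u - v) < h" if "u \<in> G0 S" "v \<in> G0 S" for u v
      proof -
        have "\<bar>real_of_int u - y S\<bar> < h / 2" "\<bar>real_of_int v - y S\<bar> < h / 2"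
          using that by (simp_all only: G0_def mem_Collect_eq)
        then show ?thesis unfolding of_int_diff by linarith
      qed
    qed
    also have "\<dots> \<le> 4 * exp (s * ln h) + (2 * 1 + 1 * (2 * ln h))" using p4 ln2 by simp
    also have "\<dots> \<le> 4 * exp (s * ln h) + (2 * exp (s * ln h) + exp (s * ln h) * (2 * ln h))"
      using e1 lnh by (intro add_left_mono add_mono mult_right_mono mult_left_mono) auto
    finally show ?thesis by (simp add: algebra_simps)
  qed
  have "card I \<le> card (\<Union>S\<in>Pow {1..k}. (\<lambda>\<gamma>. of_int U * (bb S + of_int m ^ k * of_int \<gamma>)) ` G0 S)"
    by (rule card_mono[OF fU sub])
  also have "\<dots> \<le> (\<Sum>S\<in>Pow {1..k}. card ((\<lambda>\<gamma>. of_int U * (bb S + of_int m ^ k * of_int \<gamma>)) ` G0 S))"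
    by (rule card_UN_le) simp
  also have "\<dots> \<le> (\<Sum>S\<in>Pow {1..k}. card (G0 S))"
    by (intro sum_mono card_image_le fG)
  finally have "real (card I) \<le> real (\<Sum>S\<in>Pow {1..k}. card (G0 S))" by (simp only: of_nat_le_iff)
  also have "\<dots> = (\<Sum>S\<in>Pow {1..k}. real (card (G0 S)))" by simp
  also have "\<dots> \<le> (\<Sum>S\<in>Pow {1..k}. exp (s * ln h) * (6 + 2 * ln h))" by (intro sum_mono cG)
  also have "\<dots> = 2 ^ k * (exp (s * ln h) * (6 + 2 * ln h))" by (simp add: card_Pow)
  finally show "real (card I) \<le> 2 ^ k * (exp (s * ln h) * (6 + 2 * ln h))" .
qed

lemma log_card_ge:
  assumes "finite A" "c > 0" "c \<le> card A"
  shows "ereal (ln (real c)) \<le> log_card A"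
proof -
  have "A \<noteq> {}" using assms by auto
  then show ?thesis using assms by (simp add: log_card_def)
qed

lemma log_card_le:
  assumes "finite A" "real (card A) \<le> c"
  shows "log_card A \<le> ereal (ln c)"
proof (cases "A = {}")
  case False
  then have "card A > 0" using assms(1) by (simp add: card_gt_0_iff)
  then show ?thesis using assms False by (simp add: log_card_def)
qed (use assms in \<open>simp add: log_card_def\<close>)

text \<open>For the upper bound, the window count gives a bound that is uniform in x and tends to s.
  For the lower bound, windows about 0 of length proportional to \<open>N ^ T n\<close> contain the
  images of all sums over the free digits of stage n + 1, and these positions have asymptotic
  density \<alpha>.\<close>

lemma beurling_dim_Spec:
  assumes U: "odd U"
  shows "beurling_dim ((\<lambda>l. of_int U * l) ` Spec \<sigma>) = ereal (\<alpha> * ln 4 / ln (real_of_int N))"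
proof (rule antisym)
  define L where "L = (\<lambda>l. of_int U * l) ` Spec \<sigma>"
  define f where "f h = (SUP x::real. log_card (L \<inter> {x - h/2 <..< x + h/2}) / ereal (ln h))" for h :: real
  define s where "s = \<alpha> * ln 4 / ln (real_of_int N)"
  have bd: "beurling_dim L = Limsup at_top f" by (simp add: beurling_dim_def f_def[abs_def])
  define g where "g h = (k * ln 2 + s * ln h + ln (6 + 2 * ln h)) / ln h" for h :: real
  have fg: "f h \<le> ereal (g h)" if "h > 1" for h
    unfolding f_def
  proof (rule SUP_least)
    fix x :: real
    have h1: "h \<ge> 1" "ln h > 0" using that by auto
    note c = card_interval_Spec[OF U h1(1), of \<sigma> x, folded s_def L_def]
    have "log_card (L \<inter> {x - h/2 <..< x + h/2}) \<le> ereal (ln (2 ^ k * (exp (s * ln h) * (6 + 2 * ln h))))"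
      by (rule log_card_le[OF c])
    also have "ln (2 ^ k * (exp (s * ln h) * (6 + 2 * ln h))) = k * ln 2 + s * ln h + ln (6 + 2 * ln h)"
    proof -
      have "6 + 2 * ln h > 0" using h1(2) by linarith
      then show ?thesis by (simp add: ln_mult ln_realpow)
    qed
    finally have "log_card (L \<inter> {x - h/2 <..< x + h/2}) / ereal (ln h) \<le> ereal (k * ln 2 + s * ln h + ln (6 + 2 * ln h)) / ereal (ln h)"
      using h1 by (intro ereal_divide_right_mono) auto
    then show "log_card (L \<inter> {x - h/2 <..< x + h/2}) / ereal (ln h) \<le> ereal (g h)"
      using h1 by (simp add: g_def)
  qed
  have "(g \<longlongrightarrow> s) at_top"
  proof -
    have 1: "((\<lambda>h::real. (real k * ln 2 + ln (6 + 2 * ln h)) / ln h) \<longlongrightarrow> 0) at_top"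
      by real_asymp
    have "((\<lambda>h. (real k * ln 2 + ln (6 + 2 * ln h)) / ln h + s) \<longlongrightarrow> 0 + s) at_top"
      by (intro tendsto_intros 1)
    moreover have "eventually (\<lambda>h. (real k * ln 2 + ln (6 + 2 * ln h)) / ln h + s = g h) at_top"
      using eventually_gt_at_top[of 1]
    proof eventually_elim
      case (elim h)
      then have "ln h \<noteq> 0" by simp
      then show ?case by (simp add: g_def field_simps)
    qed
    ultimately show ?thesis by (simp add: tendsto_cong)
  qed
  then have "Limsup at_top (\<lambda>h. ereal (g h)) = ereal s"
    by (intro lim_imp_Limsup) auto
  moreover have "Limsup at_top f \<le> Limsup at_top (\<lambda>h. ereal (g h))"
    by (rule Limsup_mono, rule eventually_mono[OF eventually_gt_at_top[of 1]]) (rule fg)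
  ultimately have "Limsup at_top f \<le> ereal s" by simp
  then show "beurling_dim ((\<lambda>l. of_int U * l) ` Spec \<sigma>) \<le> ereal (\<alpha> * ln 4 / ln (real_of_int N))"
    by (simp only: L_def[symmetric] bd s_def[symmetric])
  have "ereal s \<le> Limsup at_top f"
  proof (rule ccontr)
    assume "\<not> ?thesis"
    then have "Limsup at_top f < ereal s" by simp
    then obtain y where y: "Limsup at_top f < ereal y" "y < s"
      using ereal_dense2[of "Limsup at_top f" "ereal s"] by auto
    have ev: "eventually (\<lambda>h. f h < ereal y) at_top" using Limsup_lessD[OF y(1)] .
    define C where "C = \<bar>of_int U\<bar> * real_of_int m ^ k"
    have "U \<noteq> 0" using U by auto
    then have C0: "C > 0" using m_pos by (simp add: C_def)
    define T where "T n = level \<sigma> (Suc n)" for n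
    define h where "h n = 2 * C * real_of_int N ^ T n" for n
    have level: "filterlim T sequentially sequentially"
      unfolding T_def[abs_def] using filterlim_subseq[OF strict_mono_level] filterlim_Suc filterlim_compose by blast
    have "filterlim (\<lambda>t. 2 * C * real_of_int N ^ t) at_top sequentially"
      using N_real_gt C0 by real_asymp
    then have hlim: "filterlim h at_top sequentially"
      unfolding h_def[abs_def] by (rule filterlim_compose[OF _ level])
    have fh: "ereal ((\<alpha> * real (T n) - real (T n) / (real n + 1)) * ln 4 / ln (h n)) \<le> f (h n)"
      if hn: "h n > 1" for n
    proof -
      define J where "J = free_digits \<sigma> (Suc n)"
      have J: "J \<subseteq> {..<T n}" "Plain J \<subseteq> stage_set \<sigma> (Suc n)"
        using inv_all[of \<sigma> "Suc n"] by (auto simp: stage_inv_def J_def T_def)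
      define I where "I = L \<inter> {0 - h n / 2 <..< 0 + h n / 2}"
      have fI: "finite I" unfolding I_def L_def using hn by (intro card_interval_Spec(1)[OF U]) simp
      have "(\<lambda>\<gamma>. of_int U * (of_int m ^ k * real_of_int \<gamma>)) ` Plain J \<subseteq> I"
      proof
        fix z assume "z \<in> (\<lambda>\<gamma>. of_int U * (of_int m ^ k * real_of_int \<gamma>)) ` Plain J"
        then obtain \<gamma> where g: "\<gamma> \<in> Plain J" "z = of_int U * (of_int m ^ k * real_of_int \<gamma>)" by blast
        have "bb {} = 0" by (simp add: bb_def)
        then have "of_int m ^ k * real_of_int \<gamma> \<in> Lam (stage_set \<sigma> (Suc n))"
          using g(1) J(2) unfolding Lam_def by (intro rev_image_eqI[of "({}, \<gamma>)"]) auto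
        then have "z \<in> L" unfolding L_def Spec_eq g(2) by blast
        moreover have "\<bar>z\<bar> < h n / 2"
        proof -
          have "0 \<le> \<gamma>" "\<gamma> < N ^ T n" using Plain_bounds[OF J(1) g(1)] by auto
          then have "\<bar>real_of_int \<gamma>\<bar> < real_of_int N ^ T n" by (metis abs_of_nonneg of_int_0_le_iff of_int_less_iff of_int_power)
          then have "C * \<bar>real_of_int \<gamma>\<bar> < C * real_of_int N ^ T n" using C0 by (intro mult_strict_left_mono)
          moreover have "\<bar>z\<bar> = C * \<bar>real_of_int \<gamma>\<bar>" using m_pos by (simp add: g(2) C_def abs_mult)
          ultimately show ?thesis by (simp add: h_def)
        qed
        then have "- (h n / 2) < z" "z < h n / 2" by linarith+
        ultimately show "z \<in> I" by (simp add: I_def)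
      qed
      moreover have "inj_on (\<lambda>\<gamma>. of_int U * (of_int m ^ k * real_of_int \<gamma>)) (Plain J)"
        using U m_pos by (auto simp: inj_on_def)
      ultimately have "card (Plain J) \<le> card I" using fI by (metis card_image card_mono)
      then have "4 ^ card J \<le> card I" using card_Plain[OF J(1)] by simp
      then have "ereal (ln (real (4 ^ card J))) \<le> log_card I" by (intro log_card_ge fI) auto
      then have "ereal (real (card J) * ln 4) \<le> log_card I" by (simp add: ln_realpow)
      moreover have "(\<alpha> * real (T n) - real (T n) / (real n + 1)) * ln 4 \<le> real (card J) * ln 4"
        using card_free_digits[of \<sigma> n] by (intro mult_right_mono) (auto simp: J_def T_def)
      ultimately have "ereal ((\<alpha> * real (T n) - real (T n) / (real n + 1)) * ln 4) \<le> log_card I"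
        by (meson ereal_less_eq(3) order_trans)
      then have "ereal ((\<alpha> * real (T n) - real (T n) / (real n + 1)) * ln 4) / ereal (ln (h n)) \<le> log_card I / ereal (ln (h n))"
        using hn by (intro ereal_divide_right_mono) auto
      also have "\<dots> \<le> f (h n)" unfolding f_def I_def by (rule SUP_upper) simp
      finally show ?thesis using hn by simp
    qed
    have "(\<lambda>n. (\<alpha> - 1 / (real n + 1)) * ln 4 / (ln (2 * C) / real (T n) + ln (real_of_int N))) \<longlonglongrightarrow>
        (\<alpha> - 0) * ln 4 / (0 + ln (real_of_int N))"
    proof (intro tendsto_intros)
      show "(\<lambda>n. 1 / (real n + 1)) \<longlonglongrightarrow> 0" by real_asymp
      have "(\<lambda>t. ln (2 * C) / real t) \<longlonglongrightarrow> 0" by real_asymp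
      from filterlim_compose[OF this level] show "(\<lambda>n. ln (2 * C) / real (T n)) \<longlonglongrightarrow> 0" .
      show "0 + ln (real_of_int N) \<noteq> 0" using ln_N_pos by simp
    qed
    then have "(\<lambda>n. (\<alpha> - 1 / (real n + 1)) * ln 4 / (ln (2 * C) / real (T n) + ln (real_of_int N))) \<longlonglongrightarrow> s"
      by (simp add: s_def)
    from order_tendstoD(1)[OF this y(2)]
    have "eventually (\<lambda>n. y < (\<alpha> - 1 / (real n + 1)) * ln 4 / (ln (2 * C) / real (T n) + ln (real_of_int N))) sequentially" .
    moreover have "eventually (\<lambda>n. f (h n) < ereal y) sequentially"
      using eventually_compose_filterlim[OF ev hlim] .
    moreover have "eventually (\<lambda>n. h n > 1) sequentially"
      using hlim by (simp add: filterlim_at_top_dense)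
    moreover have "eventually (\<lambda>n. T n > 0) sequentially"
      using level eventually_compose_filterlim[OF eventually_gt_at_top[of 0]] by blast
    ultimately have "eventually (\<lambda>n. False) sequentially"
    proof eventually_elim
      case (elim n)
      have "ln (h n) = ln (2 * C) + real (T n) * ln (real_of_int N)"
        unfolding h_def using C0 N_real_gt by (simp add: ln_mult ln_realpow)
      also have "\<dots> = real (T n) * (ln (2 * C) / real (T n) + ln (real_of_int N))"
        using elim(4) by (simp add: distrib_left)
      finally have "(\<alpha> * real (T n) - real (T n) / (real n + 1)) * ln 4 / ln (h n) =
          (real (T n) * ((\<alpha> - 1 / (real n + 1)) * ln 4)) / (real (T n) * (ln (2 * C) / real (T n) + ln (real_of_int N)))"
        by (simp add: algebra_simps)
      also have "\<dots> = (\<alpha> - 1 / (real n + 1)) * ln 4 / (ln (2 * C) / real (T n) + ln (real_of_int N))"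
        using elim(4) by (intro mult_divide_mult_cancel_left) simp
      finally have "ereal y < f (h n)"
        using fh[OF elim(3)] elim(1) by (metis ereal_less_eq(3) less_ereal.simps(1) order_less_le_trans)
      then show ?case using elim(2) by simp
    qed
    then show False by simp
  qed
  then show "ereal (\<alpha> * ln 4 / ln (real_of_int N)) \<le> beurling_dim ((\<lambda>l. of_int U * l) ` Spec \<sigma>)"
    by (simp only: L_def[symmetric] bd s_def[symmetric])
qed

end

section \<open>Cardinality\<close>

lemma odd_reals_iff: "x \<in> \<O> \<longleftrightarrow> (\<exists>n. odd n \<and> x = of_int n)"
  by (auto simp: odd_reals_def)

lemma class_translate_rel: "\<Lambda>' \<in> translate_rel `` {\<Lambda>} \<longleftrightarrow> (\<exists>x. \<Lambda>' = (\<lambda>l. l + x) ` \<Lambda>)"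
  by (auto simp: translate_rel_def)

lemma V_nonempty_iff:
  "V \<mu> S \<noteq> {} \<longleftrightarrow> (\<exists>\<Lambda>. is_spectrum \<mu> \<Lambda> \<and> (\<forall>a\<in>S. is_spectrum \<mu> ((\<lambda>l. a * l) ` \<Lambda>)))"
  by (auto simp: V_def quotient_def)

context four_digit_construction
begin

section \<open>Recovering the binary choices and counting translation classes\<close>

lemma Spec_nonneg: "l \<in> Spec \<sigma> \<Longrightarrow> 0 \<le> l"
  using bb_bounds(1) stage_set_props(5) m_pos unfolding Spec_eq Lam_def by auto

lemma Spec_memI: "\<gamma> \<in> limit_set \<sigma> \<Longrightarrow> of_int m ^ k * of_int \<gamma> \<in> Spec \<sigma>"
  unfolding Spec_def Lam_def by (intro rev_image_eqI[of "({}, \<gamma>)"]) (auto simp: bb_def)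

lemma zero_in_Spec: "0 \<in> Spec \<sigma>"
  using Spec_memI[of 0 \<sigma>] stage_set_props(4) by (auto simp: limit_set_def)

text \<open>For nonempty S, \<open>2 ^ (\<tau> + 1) * bb S\<close> is an odd multiple of some
  \<open>N ^ j\<close> with j \<le> k, whereas an integer times \<open>m ^ k\<close> would give a
  multiple of \<open>4 * N ^ j\<close>. Hence \<open>Spec \<sigma>\<close> determines
  \<open>limit_set \<sigma>\<close>.\<close>

lemma bb_not_multiple:
  assumes "S \<subseteq> {1..k}" "bb S = of_int m ^ k * of_int d"
  shows "S = {}"
proof (rule ccontr)
  assume "S \<noteq> {}"
  have "separated 0 {0}" by (simp add: separated_def)
  from Lam_difference_at_zero[OF this assms(1), of "{}" 0 0] \<open>S \<noteq> {}\<close>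
  have "at_zero 0 (bb S)" by (simp add: bb_def)
  then obtain j where j: "j \<in> {1..k}" "oddreal (2 ^ (\<tau> + 1) * (bb S / of_int N ^ j))" by (auto simp: at_zero_def)
  have "j \<le> k" using j(1) by simp
  then obtain w where "2 ^ (\<tau> + 1) * m ^ k = N ^ j * (4 * w)" by (rule level_power)
  then have "2 ^ (\<tau> + 1) * real_of_int m ^ k = of_int N ^ j * of_int (4 * w)"
    by (metis of_int_mult of_int_numeral of_int_power)
  then have "2 ^ (\<tau> + 1) * (bb S / of_int N ^ j) = of_int (4 * w * d)"
    unfolding assms(2) using N_real_gt by (simp add: field_simps)
  then show False using j(2) by (simp only: oddreal_of_int) simp
qed

lemma Spec_subset_imp:
  assumes "Spec \<sigma> \<subseteq> Spec \<sigma>'"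
  shows "limit_set \<sigma> \<subseteq> limit_set \<sigma>'"
proof
  fix \<gamma> assume "\<gamma> \<in> limit_set \<sigma>"
  then have "of_int m ^ k * of_int \<gamma> \<in> Spec \<sigma>'" using Spec_memI assms by blast
  then obtain S \<gamma>' where S: "S \<subseteq> {1..k}" "\<gamma>' \<in> limit_set \<sigma>'"
    "of_int m ^ k * of_int \<gamma> = bb S + of_int m ^ k * of_int \<gamma>'" by (auto simp: Spec_def Lam_def)
  then have "bb S = of_int m ^ k * of_int (\<gamma> - \<gamma>')" by (simp add: algebra_simps)
  then have "S = {}" using bb_not_multiple S(1) by blast
  then have "\<gamma> = \<gamma>'" using S(3) m_pos by (simp add: bb_def)
  then show "\<gamma> \<in> limit_set \<sigma>'" using S(2) by simp
qed

text \<open>Every \<open>Spec\<close> has minimum 0, so no nonzero translation carries one to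
  another.\<close>

lemma Spec_translate_inj:
  assumes U: "odd U" and eq: "(\<lambda>l. of_int U * l) ` Spec \<sigma>' = (\<lambda>l. l + x) ` (\<lambda>l. of_int U * l) ` Spec \<sigma>"
  shows "\<sigma> = \<sigma>'"
proof -
  have "U \<noteq> 0" using U by auto
  define y where "y = x / of_int U"
  have x: "x = of_int U * y" using \<open>U \<noteq> 0\<close> by (simp add: y_def)
  have "(\<lambda>l. of_int U * l) ` Spec \<sigma>' = (\<lambda>l. of_int U * l) ` (\<lambda>l. l + y) ` Spec \<sigma>"
    unfolding eq image_image x by (simp add: distrib_left)
  moreover have "inj (\<lambda>l. real_of_int U * l)" using \<open>U \<noteq> 0\<close> by (simp add: inj_on_def)
  ultimately have e: "Spec \<sigma>' = (\<lambda>l. l + y) ` Spec \<sigma>" by (simp add: inj_image_eq_iff)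
  have "y \<in> Spec \<sigma>'" unfolding e using zero_in_Spec[of \<sigma>] by (intro rev_image_eqI[of 0]) auto
  then have "y \<ge> 0" by (rule Spec_nonneg)
  moreover obtain l where "l \<in> Spec \<sigma>" "0 = l + y" using zero_in_Spec[of \<sigma>'] unfolding e by blast
  then have "y \<le> 0" using Spec_nonneg[of l \<sigma>] by simp
  ultimately have "Spec \<sigma>' = Spec \<sigma>" using e by simp
  then have "limit_set \<sigma> = limit_set \<sigma>'" using Spec_subset_imp[of \<sigma> \<sigma>'] Spec_subset_imp[of \<sigma>' \<sigma>] by auto
  then show ?thesis by (rule inj_limit_set)
qed

lemma Spec_valid:
  fixes \<sigma> :: "nat \<Rightarrow> bool"
  assumes U: "odd U" and S: "S \<subseteq> (\<lambda>u. inverse (of_int U) * u) ` \<O>"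
  defines "\<Lambda> \<equiv> (\<lambda>l. of_int U * l) ` Spec \<sigma>"
  shows "is_spectrum \<mu> \<Lambda> \<and> (\<forall>a\<in>S. is_spectrum \<mu> ((\<lambda>l. a * l) ` \<Lambda>))"
proof (intro conjI ballI)
  show "is_spectrum \<mu> \<Lambda>" unfolding \<Lambda>_def by (rule is_spectrum_Spec[OF U])
  fix a assume "a \<in> S"
  with S obtain w where "w \<in> \<O>" "a = inverse (of_int U) * w" by blast
  then obtain v where v: "odd v" "a = inverse (of_int U) * of_int v" unfolding odd_reals_iff by blast
  have "U \<noteq> 0" using U by auto
  then have "(\<lambda>l. a * l) ` \<Lambda> = (\<lambda>l. of_int v * l) ` Spec \<sigma>"
    unfolding \<Lambda>_def image_image v(2) by (intro image_cong) (auto simp: field_simps)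
  then show "is_spectrum \<mu> ((\<lambda>l. a * l) ` \<Lambda>)" using is_spectrum_Spec[OF v(1)] by simp
qed

text \<open>Each translation class has a member through 0. By the form of the zeros this member lies
  in the fixed lattice \<int> / c, so a class is encoded by a set of integers.\<close>

lemma classes_lepoll_nat_sets: "V \<mu> S \<lesssim> (UNIV :: nat set set)"
proof -
  define c where "c = 2 ^ (\<tau> + 1) * real_of_int G / 2 ^ \<beta>"
  have c0: "c \<noteq> 0" using G_nonzero by (simp add: c_def)
  define rep where "rep C = (SOME \<Lambda>. \<Lambda> \<in> C \<and> 0 \<in> \<Lambda>)" for C :: "real set set"
  have rep: "rep C \<in> C \<and> 0 \<in> rep C \<and> is_spectrum \<mu> (rep C)" if C: "C \<in> V \<mu> S" for C
  proof -
    obtain \<Lambda> where L: "is_spectrum \<mu> \<Lambda>" "C = translate_rel `` {\<Lambda>}" using C by (auto simp: V_def quotient_def)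
    have sp: "is_spectrum \<mu> \<Lambda>'" if L': "\<Lambda>' \<in> C" for \<Lambda>'
    proof -
      obtain x where "\<Lambda>' = (\<lambda>l. l + x) ` \<Lambda>"
        using L' unfolding L(2) class_translate_rel by (elim exE)
      then show ?thesis using is_spectrum_translate[OF real_distribution_axioms L(1)] by simp
    qed
    obtain l where "l \<in> \<Lambda>" using spectrum_has_odd_difference[OF L(1)] by blast
    then have "0 \<in> (\<lambda>x. x + (- l)) ` \<Lambda>" by (intro rev_image_eqI[of l]) auto
    moreover have "(\<lambda>x. x + (- l)) ` \<Lambda> \<in> C" unfolding L(2) class_translate_rel by blast
    ultimately have "\<exists>\<Lambda>. \<Lambda> \<in> C \<and> 0 \<in> \<Lambda>" by (intro exI conjI)
    from someI_ex[OF this] have "rep C \<in> C \<and> 0 \<in> rep C" unfolding rep_def .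
    then show ?thesis using sp by blast
  qed
  have lattice: "\<exists>n::int. l = of_int n / c" if "C \<in> V \<mu> S" "l \<in> rep C" for C l
  proof (cases "l = 0")
    case False
    have "ft \<mu> (l - 0) = 0"
      using is_spectrum_orth[of "rep C"] rep[OF that(1)] that(2) False unfolding orth_def by blast
    from ft_zero_cases[OF this] obtain n :: int where "c * l = of_int n" by (auto simp: c_def)
    then show ?thesis using c0 by (intro exI[of _ n]) (simp add: field_simps)
  qed (auto intro: exI[of _ 0])
  define g where "g C = {n. of_int (int_decode n) / c \<in> rep C}" for C
  have "inj_on g (V \<mu> S)"
  proof (rule inj_onI)
    fix C C' assume C: "C \<in> V \<mu> S" "C' \<in> V \<mu> S" "g C = g C'"
    have *: "rep C \<subseteq> rep C'" if VC: "C \<in> V \<mu> S" and eq: "g C = g C'" for C C'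
    proof
      fix l assume l: "l \<in> rep C"
      then obtain n :: int where n: "l = of_int n / c" using lattice[OF VC] by blast
      then have "int_encode n \<in> g C" using l by (simp add: g_def)
      then show "l \<in> rep C'" unfolding eq using n by (simp add: g_def)
    qed
    have "rep C = rep C'" using *[OF C(1,3)] *[OF C(2) C(3)[symmetric]] by blast
    then have "C \<inter> C' \<noteq> {}" using rep C(1,2) by (metis IntI emptyE)
    moreover have "C \<in> UNIV // translate_rel" "C' \<in> UNIV // translate_rel"
      using C(1,2) by (auto simp: V_def quotient_def)
    ultimately show "C = C'" using quotient_disj[OF equiv_translate_rel] by blast
  qed
  then show ?thesis unfolding lepoll_def by blast
qed

lemma classes_eqpoll:
  assumes U: "odd U" and S: "S \<subseteq> (\<lambda>u. inverse (of_int U) * u) ` \<O>"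
  shows "{C \<in> V \<mu> S. \<forall>\<Lambda>\<in>C. beurling_dim \<Lambda> = ereal (\<alpha> * ln 4 / ln (real_of_int N))} \<approx> (UNIV :: real set)"
    (is "?A \<approx> _")
proof (rule lepoll_antisym)
  have "?A \<lesssim> V \<mu> S" by (rule subset_imp_lepoll) auto
  also have "V \<mu> S \<lesssim> (UNIV :: nat set set)" by (rule classes_lepoll_nat_sets)
  also have "(UNIV :: nat set set) \<lesssim> (UNIV :: real set)" by (rule eqpoll_imp_lepoll[OF nat_sets_eqpoll_reals])
  finally show "?A \<lesssim> (UNIV :: real set)" .
  define L where "L A = (\<lambda>l. of_int U * l) ` Spec (\<lambda>n. n \<in> A)" for A
  define f where "f A = translate_rel `` {L A}" for A
  have "f A \<in> ?A" for A
  proof (rule CollectI, intro conjI ballI)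
    show "f A \<in> V \<mu> S"
      unfolding V_def f_def L_def by (intro quotientI CollectI Spec_valid[OF U S])
    fix \<Lambda> assume "\<Lambda> \<in> f A"
    then obtain x where "\<Lambda> = (\<lambda>l. l + x) ` L A" unfolding f_def class_translate_rel by blast
    then show "beurling_dim \<Lambda> = ereal (\<alpha> * ln 4 / ln (real_of_int N))"
      by (simp only: beurling_dim_translate L_def beurling_dim_Spec[OF U])
  qed
  moreover have "inj f"
  proof (rule injI)
    fix A B assume "f A = f B"
    moreover have "L B \<in> f B" unfolding f_def class_translate_rel by (intro exI[of _ 0]) simp
    ultimately have "L B \<in> f A" by simp
    then obtain x where "L B = (\<lambda>l. l + x) ` L A" unfolding f_def class_translate_rel by blast
    then have "(\<lambda>n. n \<in> A) = (\<lambda>n. n \<in> B)" unfolding L_def by (rule Spec_translate_inj[OF U])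
    then show "A = B" by (metis Collect_mem_eq)
  qed
  ultimately have "(UNIV :: nat set set) \<lesssim> ?A" unfolding lepoll_def by blast
  moreover have "(UNIV :: real set) \<lesssim> (UNIV :: nat set set)"
    by (rule eqpoll_imp_lepoll[OF eqpoll_sym[OF nat_sets_eqpoll_reals]])
  ultimately show "(UNIV :: real set) \<lesssim> ?A" by (rule lepoll_trans[rotated])
qed

end

context four_digit_measure
begin

section \<open>Consequences for \<open>V\<close> and \<open>E2\<close>\<close>

lemma construction:
  assumes "0 \<le> \<alpha>" "\<alpha> \<le> 1"
  shows "four_digit_construction \<mu> \<beta> \<tau> k r N m a l1 l2 \<alpha>"
  using assms by unfold_locales

lemma V_nonempty:
  assumes "0 \<notin> S"
  shows "V \<mu> S \<noteq> {} \<longleftrightarrow> (\<exists>T\<in>\<O>. S \<subseteq> (\<lambda>u. inverse T * u) ` \<O>)"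
proof -
  \<comment> \<open>Any density would do for the existence of a spectrum; 0 is one admissible
    value.\<close>
  interpret four_digit_construction \<mu> \<beta> \<tau> k r N m a l1 l2 0
    by (rule construction) auto
  show ?thesis
  proof
    assume "V \<mu> S \<noteq> {}"
    then show "\<exists>T\<in>\<O>. S \<subseteq> (\<lambda>u. inverse T * u) ` \<O>"
      unfolding V_nonempty_iff using common_denominator assms by blast
  next
    assume "\<exists>T\<in>\<O>. S \<subseteq> (\<lambda>u. inverse T * u) ` \<O>"
    then obtain U where "odd U" "S \<subseteq> (\<lambda>u. inverse (of_int U) * u) ` \<O>" by (auto simp: odd_reals_iff)
    then show "V \<mu> S \<noteq> {}" unfolding V_nonempty_iff using Spec_valid by blast
  qed
qed

lemma V_eqpoll:
  assumes "T \<in> \<O>" "S \<subseteq> (\<lambda>u. inverse T * u) ` \<O>" "0 \<le> s" "s \<le> ln 4 / ln (real_of_int N)"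
  shows "{C \<in> V \<mu> S. \<forall>\<Lambda>\<in>C. beurling_dim \<Lambda> = ereal s} \<approx> (UNIV :: real set)"
proof -
  have lnN: "ln (real_of_int N) > 0" using N_real_gt by simp
  \<comment> \<open>The density for which \<open>\<alpha> * ln 4 / ln N\<close> equals s; the range
    of s corresponds to 0 \<le> \<alpha> \<le> 1.\<close>
  define \<alpha> where "\<alpha> = s * ln (real_of_int N) / ln 4"
  have "0 \<le> \<alpha>" "\<alpha> \<le> 1" using assms(3,4) lnN by (auto simp: \<alpha>_def field_simps)
  then interpret four_digit_construction \<mu> \<beta> \<tau> k r N m a l1 l2 \<alpha>
    by (rule construction)
  obtain U where U: "odd U" "T = of_int U" using assms(1) by (auto simp: odd_reals_iff)
  have "\<alpha> * ln 4 / ln (real_of_int N) = s" using lnN by (simp add: \<alpha>_def)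
  then show ?thesis using classes_eqpoll[OF U(1), of S] assms(2) U(2) by simp
qed

lemma E2_eq: "E2 \<mu> = odd_ratios"
proof -
  have O0: "0 \<notin> \<O>" by (auto simp: odd_reals_iff)
  have "t \<in> E2 \<mu> \<longleftrightarrow> t \<in> odd_ratios" for t
  proof
    assume "t \<in> E2 \<mu>"
    then have "t \<noteq> 0" "V \<mu> {1, t} \<noteq> {}" by (auto simp: E2_def)
    then obtain T where "T \<in> \<O>" "{1, t} \<subseteq> (\<lambda>u. inverse T * u) ` \<O>" using V_nonempty[of "{1, t}"] by auto
    then show "t \<in> odd_ratios" by (auto simp: odd_ratios_def divide_inverse mult.commute)
  next
    assume "t \<in> odd_ratios"
    then obtain u v where uv: "t = u / v" "u \<in> \<O>" "v \<in> \<O>" by (auto simp: odd_ratios_def)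
    then have nz: "u \<noteq> 0" "v \<noteq> 0" using O0 by metis+
    \<comment> \<open>The denominator v itself serves as T, since 1 = v / v and v is odd.\<close>
    have "1 = inverse v * v" "t = inverse v * u" using uv(1) nz by (simp_all add: divide_inverse)
    then have "{1, t} \<subseteq> (\<lambda>u. inverse v * u) ` \<O>" using uv(2,3) by blast
    then show "t \<in> E2 \<mu>" using V_nonempty[of "{1, t}"] uv nz by (auto simp: E2_def)
  qed
  then show ?thesis by blast
qed

end

theorem theorem1p8:
  fixes \<beta> \<tau> k r :: nat and N m a l1 l2 :: int and D :: "int set" and \<mu> :: "real measure"
  assumes "\<beta> \<ge> 1"
    and "N = 2 ^ \<beta> * m"
    and "D = {0, a, 2 ^ \<tau> * l1, a + 2 ^ \<tau> * l2}"
    and "odd m" and "odd a" and "odd l1" and "odd l2"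
    and "\<tau> = \<beta> * k + r" and "0 < r" and "r < \<beta>"
    and "self_similar_measure N D \<mu>"
    and "lebesgue_singular \<mu>"
    and "spectral_measure \<mu>"
    and "N > 4"
  shows "E2 \<mu> = odd_ratios \<and>
    (\<forall>S \<subseteq> UNIV - {0}.
       (V \<mu> S \<noteq> {} \<longleftrightarrow> (\<exists>T\<in>\<O>. S \<subseteq> (\<lambda>u. inverse T * u) ` \<O>)) \<and>
       ((\<exists>T\<in>\<O>. S \<subseteq> (\<lambda>u. inverse T * u) ` \<O>) \<longrightarrow>
          (\<forall>s::real. 0 \<le> s \<and> s \<le> ln 4 / ln (real_of_int N) \<longrightarrow>
             {C \<in> V \<mu> S. \<forall>\<Lambda>\<in>C. beurling_dim \<Lambda> = ereal s} \<approx> (UNIV :: real set))))"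
proof -
  have "real_distribution \<mu>" using \<open>self_similar_measure N D \<mu>\<close> by (simp add: self_similar_measure_def)
  then interpret real_distribution \<mu> .
  interpret four_digit_measure \<mu> \<beta> \<tau> k r N m a l1 l2
    by unfold_locales (use assms in simp_all)
  show ?thesis
  proof (intro conjI allI impI E2_eq)
    fix S :: "real set" assume "S \<subseteq> UNIV - {0}"
    then show "V \<mu> S \<noteq> {} \<longleftrightarrow> (\<exists>T\<in>\<O>. S \<subseteq> (\<lambda>u. inverse T * u) ` \<O>)"
      by (intro V_nonempty) auto
  next
    fix S :: "real set" and s :: real
    assume "\<exists>T\<in>\<O>. S \<subseteq> (\<lambda>u. inverse T * u) ` \<O>" and s: "0 \<le> s \<and> s \<le> ln 4 / ln (real_of_int N)"
    then obtain T where T: "T \<in> \<O>" "S \<subseteq> (\<lambda>u. inverse T * u) ` \<O>" by (elim bexE)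
    from s show "{C \<in> V \<mu> S. \<forall>\<Lambda>\<in>C. beurling_dim \<Lambda> = ereal s} \<approx> (UNIV :: real set)"
      by (intro V_eqpoll[OF T]) auto
  qed
qed

end
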